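(* Let $c,\sigma>0$, $y_0\in\mathbb R$, and let $Y$ solve $\mathrm dY_t=-cY_t^3\,\mathrm dt+\sigma\,\mathrm dW_t$, $Y_0=y_0$. For $T>0$ define $$N_T:=\mathbb E_{y_0}\Big[\exp\Big\{\frac1{2\sigma^2}\int_0^Tc^2Y_s^6\,\mathrm ds\Big\}\Big]\in[1,\infty].$$ Then, for every $y_0\in\mathbb R$, $$N_T<\infty\quad\Longleftrightarrow\quad c\sigma^2T^2<\frac{\pi^2}{3}.$$ At equality $c\sigma^2T^2=\pi^2/3$, and also whenever $c\sigma^2T^2>\pi^2/3$, $N_T=\infty$. An equivalence with the same threshold holds for affine--cubic drift: for every $\kappa\ge0$, if $Y$ solves $\mathrm dY_t=(-\kappa Y_t-cY_t^3)\,\mathrm dt+\sigma\,\mathrm dW_t$, $Y_0=y_0$, then $$\mathbb E_{y_0}\Big[\exp\Big\{\frac1{2\sigma^2}\int_0^T(\kappa Y_s+cY_s^3)^2\,\mathrm ds\Big\}\Big]<\infty\quad\Longleftrightarrow\quad c\sigma^2T^2<\frac{\pi^2}{3}.$$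
   Context: $W$ is a standard one-dimensional Brownian motion. For $c,\sigma>0$ and $\kappa\ge0$, the stochastic differential equations $\mathrm dY_t=-cY_t^3\,\mathrm dt+\sigma\,\mathrm dW_t$ and $\mathrm dY_t=(-\kappa Y_t-cY_t^3)\,\mathrm dt+\sigma\,\mathrm dW_t$, with $Y_0=y_0$, have pathwise unique, non-explosive global strong solutions; $\mathbb E_{y_0}$ denotes expectation when the process starts at $y_0$. *)

theory Defs
  imports "HOL-Probability.Probability"
begin

text \<open>
  Standard one-dimensional Brownian motion relative to a filtration. The time index is all of
  \<open>real\<close>, but \<open>W\<close> is constrained only at times \<open>t \<ge> 0\<close>; the values of \<open>F\<close> at negative times play
  no role (one may take \<open>F t = F 0\<close> there). Taking \<open>F\<close> to be the (augmented) filtration generated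
  by \<open>W\<close> gives Brownian motion and strong solutions without reference to an external filtration.
\<close>

locale brownian_motion = prob_space M + filtration "space M" F
  for M :: "'a measure" and F :: "real \<Rightarrow> 'a measure" and W :: "real \<Rightarrow> 'a \<Rightarrow> real" +
  assumes F_subalgebra: "\<And>t. 0 \<le> t \<Longrightarrow> subalgebra M (F t)"
    and W_adapted: "\<And>t. 0 \<le> t \<Longrightarrow> W t \<in> borel_measurable (F t)"
    and W_zero: "AE \<omega> in M. W 0 \<omega> = 0"
    and W_increment_normal: "\<And>s t. 0 \<le> s \<Longrightarrow> s < t \<Longrightarrow>
      distributed M lborel (\<lambda>\<omega>. W t \<omega> - W s \<omega>) (\<lambda>x. ennreal (normal_density 0 (sqrt (t - s)) x))"
    and W_increment_indep: "\<And>s t. 0 \<le> s \<Longrightarrow> s < t \<Longrightarrow>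
      indep_set (sets (F s)) {(\<lambda>\<omega>. W t \<omega> - W s \<omega>) -` A \<inter> space M | A. A \<in> sets borel}"
    and W_continuous: "AE \<omega> in M. continuous_on {0..} (\<lambda>t. W t \<omega>)"

text \<open>
  Global solution of \<open>dY = b(Y) dt + \<sigma> dW\<close>, \<open>Y\<^sub>0 = y0\<close>, in integral form. As \<open>\<sigma>\<close> is constant and
  \<open>W\<^sub>0 = 0\<close> almost surely, the stochastic integral of \<open>\<sigma>\<close> over \<open>[0,t]\<close> is \<open>\<sigma> W\<^sub>t\<close>.
\<close>

definition solves_sde ::
  "'a measure \<Rightarrow> (real \<Rightarrow> 'a measure) \<Rightarrow> (real \<Rightarrow> 'a \<Rightarrow> real) \<Rightarrow> (real \<Rightarrow> real) \<Rightarrow> real \<Rightarrow> real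
    \<Rightarrow> (real \<Rightarrow> 'a \<Rightarrow> real) \<Rightarrow> bool" where
  "solves_sde M F W b \<sigma> y0 Y \<longleftrightarrow>
    (\<forall>t\<ge>0. Y t \<in> borel_measurable (F t)) \<and>
    (AE \<omega> in M. continuous_on {0..} (\<lambda>t. Y t \<omega>)) \<and>
    (AE \<omega> in M. \<forall>t\<ge>0.
      set_integrable lborel {0..t} (\<lambda>s. b (Y s \<omega>)) \<and>
      Y t \<omega> = y0 + (LBINT s:{0..t}. b (Y s \<omega>)) + \<sigma> * W t \<omega>)"

end

theory Submission
  imports Defs "HOL-Real_Asymp.Real_Asymp"
begin

text \<open>
  Let \<open>b\<close> be the drift, \<open>V = b\<^sup>2 / (2 \<sigma>\<^sup>2)\<close>, and let \<open>G\<close> be the even primitive of \<open>- b / \<sigma>\<^sup>2\<close>. Conjugation with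
  \<open>exp G\<close>, the analytic form of Girsanov's theorem, turns the Feynman-Kac equation
  \<open>u\<^sub>t + b u\<^sub>y + \<sigma>\<^sup>2/2 u\<^sub>y\<^sub>y + V u = 0\<close> into one with the quadratic potential \<open>- b' / 2 = (\<kappa> + 3 c y\<^sup>2) / 2\<close>, which
  has explicit solutions of the form polynomial times Gaussian. With \<open>\<theta>\<^sup>2 = 3 c \<sigma>\<^sup>2\<close> they live on time
  intervals of length less than \<open>\<pi> / \<theta>\<close>. Because of the quartic growth of \<open>G\<close>, the terminal values are
  bounded below for every positive Gaussian solution, which gives finiteness for \<open>\<theta> T < \<pi>\<close>.
  Conversely, a solution with factor \<open>1 - y\<^sup>2 / \<rho>\<close> at the terminal time is bounded above there, while its
  initial value explodes as the length of the interval tends to \<open>\<pi> / \<theta>\<close>; this gives divergence for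
  \<open>\<theta> T \<ge> \<pi>\<close>.

  Instead of Ito's formula, one inequality suffices: \<open>u(0, y\<^sub>0) \<le> E [u(S, Y\<^sub>S) exp (\<integral>V(Y)); |Y| \<le> R on [0, S]]\<close>
  if \<open>u\<close> is negative near \<open>|y| = R\<close>. It follows from a second-order Taylor expansion on a grid of mesh \<open>h\<close>,
  with errors of order \<open>h\<^sup>3\<^sup>/\<^sup>2\<close> or \<open>h\<close> times the modulus of continuity of the path. A path that leaves
  the box from a point where \<open>u\<close> may be positive has a large oscillation in a single step, and at most one
  step of each path does so.
\<close>

text \<open>The one inequality serves both halves because its effect depends on the sign of the test
  function: minus a positive Gaussian turns it into an upper bound for the moment, a factor that is
  positive only near the origin turns it into a lower bound. Negativity of \<open>u\<close> near the
  boundary replaces a stopping time: paths that have left the box are dropped from the right-hand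
  side, and what is dropped is negative up to the error of a single step. Summing over the grid is
  harmless, since S / h errors of order h^(3/2) add up to order h^(1/2), and since the events of
  leaving in a given step are disjoint, so that their total cost is one expected modulus of
  continuity. The number \<pi> comes from the Riccati equation for the Gaussian exponent: with a =
  \<psi>' / (2 \<sigma>^2 \<psi>) it becomes \<psi>'' = - \<theta>^2 \<psi>, and a positive solution
  exists on a closed interval exactly when its length is below \<pi> / \<theta>. The linear part of
  the drift enters the conjugated potential only as the constant \<kappa> / 2, which cannot move
  this threshold.\<close>

section \<open>Taylor expansion of the weighted increment\<close>

lemma second_order_taylor_bound:
  fixes f f' f'' f''' :: "real \<Rightarrow> real"
  assumes "\<And>x. a \<le> x \<Longrightarrow> x \<le> b \<Longrightarrow> (f has_real_derivative f' x) (at x)"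
    and "\<And>x. a \<le> x \<Longrightarrow> x \<le> b \<Longrightarrow> (f' has_real_derivative f'' x) (at x)"
    and "\<And>x. a \<le> x \<Longrightarrow> x \<le> b \<Longrightarrow> (f'' has_real_derivative f''' x) (at x)"
    and bound: "\<And>x. a \<le> x \<Longrightarrow> x \<le> b \<Longrightarrow> \<bar>f''' x\<bar> \<le> K"
    and "a \<le> x" "x \<le> b" "a \<le> y" "y \<le> b"
  shows "\<bar>f y - (f x + (y - x) * f' x + (y - x)\<^sup>2 / 2 * f'' x)\<bar> \<le> K * \<bar>y - x\<bar> ^ 3"
proof (cases "y = x")
  case False
  define df where "df m = (if m = 0 then f else if m = 1 then f' else if m = 2 then f'' else f''')" for m :: nat
  have "\<exists>t. (if y < x then y < t \<and> t < x else x < t \<and> t < y) \<and>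
      f y = (\<Sum>m<3. df m x / fact m * (y - x) ^ m) + df 3 t / fact 3 * (y - x) ^ 3"
  proof (rule Taylor)
    show "\<forall>m t. m < 3 \<and> a \<le> t \<and> t \<le> b \<longrightarrow> (df m has_real_derivative df (Suc m) t) (at t)"
    proof (intro allI impI)
      fix m :: nat and t assume "m < 3 \<and> a \<le> t \<and> t \<le> b"
      moreover then have "m = 0 \<or> m = 1 \<or> m = 2" by auto
      ultimately show "(df m has_real_derivative df (Suc m) t) (at t)"
        using assms(1-3)[of t] by (auto simp: df_def numeral_2_eq_2)
    qed
  qed (use False assms in \<open>auto simp: df_def\<close>)
  then obtain t where tc: "if y < x then y < t \<and> t < x else x < t \<and> t < y"
    and eq: "f y = (\<Sum>m<3. df m x / fact m * (y - x) ^ m) + df 3 t / fact 3 * (y - x) ^ 3"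
    by blast
  have t: "a \<le> t" "t \<le> b" using tc assms(5-8) by (auto split: if_splits)
  have "(\<Sum>m<3. df m x / fact m * (y - x) ^ m) = f x + (y - x) * f' x + (y - x)\<^sup>2 / 2 * f'' x"
    by (simp add: eval_nat_numeral df_def)
  then have "f y - (f x + (y - x) * f' x + (y - x)\<^sup>2 / 2 * f'' x) = f''' t / 6 * (y - x) ^ 3"
    using eq by (simp add: df_def fact_numeral)
  then have "\<bar>f y - (f x + (y - x) * f' x + (y - x)\<^sup>2 / 2 * f'' x)\<bar> = \<bar>f''' t\<bar> / 6 * \<bar>y - x\<bar> ^ 3"
    by (simp only: abs_mult power_abs abs_divide abs_numeral)
  also have "\<dots> \<le> K * \<bar>y - x\<bar> ^ 3"
    using bound[OF t] by (intro mult_right_mono) auto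
  finally show ?thesis .
qed simp

lemma first_order_taylor_bound:
  fixes f f' f'' :: "real \<Rightarrow> real"
  assumes f': "\<And>x. a \<le> x \<Longrightarrow> x \<le> b \<Longrightarrow> (f has_real_derivative f' x) (at x)"
    and f'': "\<And>x. a \<le> x \<Longrightarrow> x \<le> b \<Longrightarrow> (f' has_real_derivative f'' x) (at x)"
    and bound: "\<And>x. a \<le> x \<Longrightarrow> x \<le> b \<Longrightarrow> \<bar>f'' x\<bar> \<le> K"
    and "a \<le> x" "x \<le> y" "y \<le> b"
  shows "\<bar>f y - (f x + (y - x) * f' x)\<bar> \<le> K * (y - x)\<^sup>2"
proof (cases "y = x")
  case False
  then have "x < y" using assms by simp
  then obtain s where s: "x < s" "s < y" "f y - f x = (y - x) * f' s"
    using MVT2[of x y f f'] f' assms by (metis (no_types, lifting) order.trans)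
  then obtain r where r: "x < r" "r < s" "f' s - f' x = (s - x) * f'' r"
    using MVT2[of x s f' f''] f'' assms
    by (metis (no_types, lifting) dual_order.strict_implies_order order.trans)
  have "f y - (f x + (y - x) * f' x) = (y - x) * (f' s - f' x)"
    using s by (simp add: algebra_simps)
  also have "\<bar>\<dots>\<bar> = (y - x) * ((s - x) * \<bar>f'' r\<bar>)"
    using s r by (simp add: abs_mult)
  also have "\<dots> \<le> (y - x) * ((y - x) * K)"
    using s r assms by (intro mult_left_mono mult_mono bound) auto
  finally show ?thesis by (simp add: power2_eq_square mult_ac)
qed simp

lemma lipschitz_of_derivative_bound:
  fixes f f' :: "real \<Rightarrow> real"
  assumes "\<And>x. a \<le> x \<Longrightarrow> x \<le> b \<Longrightarrow> (f has_real_derivative f' x) (at x)"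
    and "\<And>x. a \<le> x \<Longrightarrow> x \<le> b \<Longrightarrow> \<bar>f' x\<bar> \<le> K"
    and "a \<le> x" "x \<le> b" "a \<le> y" "y \<le> b"
  shows "\<bar>f y - f x\<bar> \<le> K * \<bar>y - x\<bar>"
  using field_differentiable_bound[of "{a..b}" f f' K y x] assms
  by (auto simp: has_field_derivative_at_within)

text \<open>The expansion moves first in space at time \<open>t\<close>, then in time at the new
  point \<open>z\<close>, and finally takes \<open>ut\<close> back from \<open>z\<close> to
  \<open>y\<close>. The last move is the source of the error
  \<open>h * \<bar>z - y\<bar>\<close>.\<close>

lemma parabolic_taylor_bound:
  fixes u ut uy uyy uyyy utt uty :: "real \<Rightarrow> real \<Rightarrow> real"
  assumes "\<And>t y. 0 \<le> t \<Longrightarrow> t \<le> S \<Longrightarrow> \<bar>y\<bar> \<le> R \<Longrightarrow> (u t has_real_derivative uy t y) (at y)"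
    and "\<And>t y. 0 \<le> t \<Longrightarrow> t \<le> S \<Longrightarrow> \<bar>y\<bar> \<le> R \<Longrightarrow> (uy t has_real_derivative uyy t y) (at y)"
    and "\<And>t y. 0 \<le> t \<Longrightarrow> t \<le> S \<Longrightarrow> \<bar>y\<bar> \<le> R \<Longrightarrow> (uyy t has_real_derivative uyyy t y) (at y)"
    and "\<And>t y. 0 \<le> t \<Longrightarrow> t \<le> S \<Longrightarrow> \<bar>y\<bar> \<le> R \<Longrightarrow> (ut t has_real_derivative uty t y) (at y)"
    and "\<And>t y. 0 \<le> t \<Longrightarrow> t \<le> S \<Longrightarrow> \<bar>y\<bar> \<le> R \<Longrightarrow> ((\<lambda>t. u t y) has_real_derivative ut t y) (at t)"
    and "\<And>t y. 0 \<le> t \<Longrightarrow> t \<le> S \<Longrightarrow> \<bar>y\<bar> \<le> R \<Longrightarrow> ((\<lambda>t. ut t y) has_real_derivative utt t y) (at t)"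
    and bound: "\<And>t y. 0 \<le> t \<Longrightarrow> t \<le> S \<Longrightarrow> \<bar>y\<bar> \<le> R \<Longrightarrow>
        \<bar>uyyy t y\<bar> \<le> K \<and> \<bar>uty t y\<bar> \<le> K \<and> \<bar>utt t y\<bar> \<le> K"
    and t: "0 \<le> t" "0 \<le> h" "t + h \<le> S" and y: "\<bar>y\<bar> \<le> R" and z: "\<bar>z\<bar> \<le> R"
  shows "\<bar>u (t + h) z - (u t y + h * ut t y + (z - y) * uy t y + (z - y)\<^sup>2 / 2 * uyy t y)\<bar>
    \<le> K * (h\<^sup>2 + h * \<bar>z - y\<bar> + \<bar>z - y\<bar> ^ 3)"
proof -
  have "\<bar>u t z - (u t y + (z - y) * uy t y + (z - y)\<^sup>2 / 2 * uyy t y)\<bar> \<le> K * \<bar>z - y\<bar> ^ 3"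
    using assms
    by (intro second_order_taylor_bound[of "-R" R "u t" "uy t" "uyy t" "uyyy t" K y z]) auto
  moreover have "\<bar>u (t + h) z - (u t z + h * ut t z)\<bar> \<le> K * h\<^sup>2"
    using first_order_taylor_bound[of 0 S "\<lambda>t. u t z" "\<lambda>t. ut t z" "\<lambda>t. utt t z" K t "t + h"] assms
    by auto
  moreover have "\<bar>ut t z - ut t y\<bar> \<le> K * \<bar>z - y\<bar>"
    using assms by (intro lipschitz_of_derivative_bound[of "-R" R _ "uty t"]) auto
  then have "\<bar>h * ut t z - h * ut t y\<bar> \<le> h * (K * \<bar>z - y\<bar>)"
    unfolding right_diff_distrib[symmetric] abs_mult using t by (intro mult_mono) auto
  ultimately show ?thesis by (simp add: algebra_simps)
qed

text \<open>The Euler increment of the product of the test function and the Feynman-Kac weight: the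
  drift terms cancel by the backward equation \<open>u\<^sub>t + b u\<^sub>y + \<sigma>\<^sup>2/2 u\<^sub>y\<^sub>y + V u = 0\<close>.\<close>

lemma feynman_kac_step:
  fixes K \<sigma> :: real
  assumes K: "0 \<le> K" and \<sigma>: "0 < \<sigma>"
  shows "\<exists>C\<ge>0. \<forall>h w D r b v u0 u1 ut uy uyy x.
    0 < h \<longrightarrow> h \<le> 1 \<longrightarrow> 0 \<le> D \<longrightarrow> D \<le> 1 \<longrightarrow> \<bar>r\<bar> \<le> K * h * (h + D) \<longrightarrow>
    \<bar>b\<bar> \<le> K \<longrightarrow> 0 \<le> v \<longrightarrow> v \<le> K \<longrightarrow> \<bar>u1\<bar> \<le> K \<longrightarrow> \<bar>ut\<bar> \<le> K \<longrightarrow> \<bar>uy\<bar> \<le> K \<longrightarrow> \<bar>uyy\<bar> \<le> K \<longrightarrow>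
    ut + b * uy + \<sigma>\<^sup>2 / 2 * uyy + v * u0 = 0 \<longrightarrow>
    x = h * b + \<sigma> * w + r \<longrightarrow>
    \<bar>u1 - (u0 + h * ut + x * uy + x\<^sup>2 / 2 * uyy)\<bar> \<le> K * (h\<^sup>2 + h * \<bar>x\<bar> + \<bar>x\<bar> ^ 3) \<longrightarrow>
    \<bar>exp (h * v) * u1 - (u0 + \<sigma> * w * uy + \<sigma>\<^sup>2 / 2 * uyy * (w\<^sup>2 - h))\<bar>
      \<le> C * (h * sqrt h + \<bar>w\<bar> ^ 3 + h * D)"
proof -
  \<comment> \<open>\<open>L\<close> bounds the increment: |x| \<le> L (h + |w|), as drift and
    remainder together are at most 3 K h. The four constants after it belong to the Taylor error,
    the cancellation, the replacement of \<open>u0\<close> by \<open>u1\<close> in the potential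
    term, and the second-order part of the exponential.\<close>
  define L where "L = 3 * K + \<sigma>"
  have L0: "0 \<le> L" using K \<sigma> by (simp add: L_def)
  define CT where "CT = K * (1 + 2 * L + 8 * L ^ 3)"
  define CM where "CM = K * 2 * K + 6 * K * L * K"
  define CV where "CV = K * (K + 2 * L * K + 4 * L\<^sup>2 * K + CT)"
  define CE where "CE = K ^ 3 * exp K"
  have CT0: "0 \<le> CT" using K L0 by (simp add: CT_def)
  show ?thesis
  proof (intro exI[of _ "CT + CM + CV + CE"] conjI allI impI)
    show "0 \<le> CT + CM + CV + CE"
      using K L0 by (simp add: CM_def CV_def CE_def CT_def)
  next
    fix h w D r b v u0 u1 ut uy uyy x :: real
    assume h: "0 < h" "h \<le> 1" and D: "0 \<le> D" "D \<le> 1" and r: "\<bar>r\<bar> \<le> K * h * (h + D)"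
      and b: "\<bar>b\<bar> \<le> K" and v: "0 \<le> v" "v \<le> K" and u1: "\<bar>u1\<bar> \<le> K" and ut: "\<bar>ut\<bar> \<le> K"
      and uy: "\<bar>uy\<bar> \<le> K" and uyy: "\<bar>uyy\<bar> \<le> K"
      and pde: "ut + b * uy + \<sigma>\<^sup>2 / 2 * uyy + v * u0 = 0"
      and x: "x = h * b + \<sigma> * w + r"
      and tay: "\<bar>u1 - (u0 + h * ut + x * uy + x\<^sup>2 / 2 * uyy)\<bar> \<le> K * (h\<^sup>2 + h * \<bar>x\<bar> + \<bar>x\<bar> ^ 3)"
    define q where "q = \<bar>w\<bar>"
    \<comment> \<open>The common gauge into which every error monomial is absorbed. Mixed terms such
      as \<open>h * q\<close> are compared at the Brownian scale \<open>q = sqrt h\<close>, below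
      which \<open>h * sqrt h\<close> dominates and above which \<open>q ^ 3\<close> does.\<close>
    define g where "g = h * sqrt h + q ^ 3 + h * D"
    have q0: "0 \<le> q" by (simp add: q_def)
    have sh: "0 < sqrt h" "sqrt h \<le> 1" "sqrt h * sqrt h = h" "h \<le> sqrt h"
      using h by (auto intro: real_le_rsqrt simp: power2_eq_square mult_left_le)
    have q3: "0 \<le> q ^ 3" using q0 by simp
    have hD: "0 \<le> h * D" using h D by simp
    have g1: "h\<^sup>2 \<le> g"
    proof -
      have "h * h \<le> h * sqrt h" using h sh by (intro mult_left_mono) auto
      then show ?thesis using q3 hD unfolding g_def power2_eq_square by linarith
    qed
    have g2: "h * q \<le> g"
    proof (cases "q \<le> sqrt h")
      case True
      then have "h * q \<le> h * sqrt h" using h by (intro mult_left_mono) auto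
      then show ?thesis using q3 hD unfolding g_def by linarith
    next
      case False
      then have "sqrt h * sqrt h \<le> q * q" using sh by (intro mult_mono) auto
      then have "h * q \<le> q * q * q" using q0 sh by (intro mult_right_mono) auto
      moreover have "0 \<le> h * sqrt h" using h sh by simp
      ultimately show ?thesis using hD unfolding g_def power3_eq_cube by linarith
    qed
    have g3: "h * q\<^sup>2 \<le> g"
    proof (cases "q \<le> sqrt h")
      case True
      then have "q \<le> 1" using sh(2) by linarith
      then have "h * q\<^sup>2 \<le> h * q" using q0 h by (intro mult_left_mono) (auto simp: power2_eq_square mult_left_le)
      then show ?thesis using g2 by simp
    next
      case False
      then have "h * q\<^sup>2 \<le> q * q\<^sup>2" using sh by (intro mult_right_mono) auto
      moreover have "q * q\<^sup>2 = q ^ 3" by (simp add: power3_eq_cube power2_eq_square)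
      moreover have "0 \<le> h * sqrt h" using h sh by simp
      ultimately show ?thesis using hD unfolding g_def by linarith
    qed
    have g4: "q ^ 3 \<le> g" using h hD sh by (simp add: g_def add_increasing)
    have g0: "0 \<le> g" using g1 by (meson order_trans zero_le_power2)
    have g5: "h * q ^ 3 \<le> g"
      using mult_right_mono[OF h(2) q3] g4 by simp
    have g6: "h ^ 3 \<le> g"
      using g1 mult_right_mono[OF h(2), of "h\<^sup>2"] by (simp add: power3_eq_cube power2_eq_square)
    have rg: "\<bar>r\<bar> \<le> K * 2 * g"
    proof -
      have "0 \<le> h * sqrt h" using h by simp
      then have "h * D \<le> g" using q3 unfolding g_def by linarith
      then have "h\<^sup>2 + h * D \<le> 2 * g" using g1 by linarith
      then have "K * (h\<^sup>2 + h * D) \<le> K * (2 * g)" using K by (rule mult_left_mono)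
      then show ?thesis using r by (simp add: power2_eq_square algebra_simps)
    qed
    have r2: "\<bar>r\<bar> \<le> 2 * K * h"
    proof -
      have "K * h * (h + D) \<le> K * h * 2" using K h D by (intro mult_left_mono) auto
      then show ?thesis using r by simp
    qed
    have dr: "\<bar>h * b + r\<bar> \<le> 3 * K * h"
    proof -
      have "\<bar>h * b\<bar> \<le> h * K" using b h by (simp add: abs_mult)
      then show ?thesis using r2 by (simp add: mult_ac)
    qed
    have x1: "\<bar>x\<bar> \<le> L * (h + q)"
    proof -
      have "\<bar>\<sigma> * w\<bar> = \<sigma> * q" using \<sigma> by (simp add: abs_mult q_def)
      then have "\<bar>x\<bar> \<le> 3 * K * h + \<sigma> * q" using dr unfolding x by linarith
      also have "\<dots> \<le> L * (h + q)" using K \<sigma> h q0 by (simp add: L_def algebra_simps)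
      finally show ?thesis .
    qed
    have xs: "\<bar>x + \<sigma> * w\<bar> \<le> 2 * L * (h + q)"
    proof -
      have "\<sigma> * q \<le> L * (h + q)" using K \<sigma> h q0 by (simp add: L_def algebra_simps)
      moreover have "\<bar>\<sigma> * w\<bar> = \<sigma> * q" using \<sigma> by (simp add: abs_mult q_def)
      ultimately show ?thesis using x1 by linarith
    qed
    have hx: "h * \<bar>x\<bar> \<le> L * (2 * g)"
    proof -
      have "h * \<bar>x\<bar> \<le> h * (L * (h + q))" using x1 h by (intro mult_left_mono) auto
      also have "\<dots> = L * (h\<^sup>2 + h * q)" by (simp add: power2_eq_square algebra_simps)
      also have "\<dots> \<le> L * (2 * g)" using g1 g2 L0 by (intro mult_left_mono) auto
      finally show ?thesis .
    qed
    have hx2: "h * x\<^sup>2 \<le> L\<^sup>2 * (4 * g)"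
    proof -
      have "x\<^sup>2 \<le> (L * (h + q))\<^sup>2" using x1 by (metis abs_ge_zero power2_abs power_mono)
      also have "\<dots> \<le> L\<^sup>2 * (2 * (h\<^sup>2 + q\<^sup>2))"
        unfolding power_mult_distrib using sum_squares_ge_zero[of "h - q" 0]
        by (intro mult_left_mono) (auto simp: power2_eq_square algebra_simps)
      finally have "h * x\<^sup>2 \<le> h * (L\<^sup>2 * (2 * (h\<^sup>2 + q\<^sup>2)))" using h by (intro mult_left_mono) auto
      also have "\<dots> = L\<^sup>2 * (2 * (h ^ 3 + h * q\<^sup>2))"
        by (simp add: power3_eq_cube power2_eq_square algebra_simps)
      also have "\<dots> \<le> L\<^sup>2 * (4 * g)" using g6 g3 by (intro mult_left_mono) auto
      finally show ?thesis .
    qed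
    have x3: "\<bar>x\<bar> ^ 3 \<le> L ^ 3 * (8 * g)"
    proof -
      have "\<bar>x\<bar> ^ 3 \<le> (L * (h + q)) ^ 3" using x1 by (intro power_mono) auto
      also have "\<dots> = L ^ 3 * (h + q) ^ 3" by (simp add: power_mult_distrib)
      also have "(h + q) ^ 3 = h ^ 3 + 3 * (h * (h * q)) + 3 * (h * q\<^sup>2) + q ^ 3"
        by (simp add: power3_eq_cube power2_eq_square algebra_simps)
      also have "L ^ 3 * \<dots> \<le> L ^ 3 * (8 * g)"
      proof (intro mult_left_mono)
        have "h * (h * q) \<le> 1 * (h * q)" using h q0 by (intro mult_right_mono) auto
        then show "h ^ 3 + 3 * (h * (h * q)) + 3 * (h * q\<^sup>2) + q ^ 3 \<le> 8 * g"
          using g6 g2 g3 g4 by simp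
      qed (use L0 in simp)
      finally show ?thesis .
    qed
    have E1: "\<bar>u1 - (u0 + h * ut + x * uy + x\<^sup>2 / 2 * uyy)\<bar> \<le> CT * g"
    proof -
      have "K * (h\<^sup>2 + h * \<bar>x\<bar> + \<bar>x\<bar> ^ 3) \<le> K * (g + L * (2 * g) + L ^ 3 * (8 * g))"
        using g1 hx x3 K by (intro mult_left_mono add_mono) auto
      then show ?thesis using tay by (simp add: CT_def algebra_simps)
    qed
    \<comment> \<open>The square of the increment differs from that of its noise part by a product
      with the factor \<open>X\<close> of order \<open>h\<close>, so the two may be exchanged. The
      remaining terms of order \<open>h\<close> are exactly \<open>h\<close> times the backward
      equation, and \<open>w\<^sup>2 - h\<close> is left over as a mean-zero term.\<close>
    have E2: "\<bar>u0 + h * ut + x * uy + x\<^sup>2 / 2 * uyy + h * v * u0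
        - (u0 + \<sigma> * w * uy + \<sigma>\<^sup>2 / 2 * uyy * (w\<^sup>2 - h))\<bar> \<le> CM * g"
    proof -
      define X where "X = h * b + r"
      define Z where "Z = x + \<sigma> * w"
      have "x\<^sup>2 - (\<sigma> * w)\<^sup>2 = X * Z"
        by (simp add: X_def Z_def x power2_eq_square algebra_simps)
      then have x2: "x\<^sup>2 = \<sigma>\<^sup>2 * w\<^sup>2 + X * Z" by (simp add: power_mult_distrib)
      have xu: "x * uy = h * b * uy + \<sigma> * w * uy + r * uy" unfolding x by (simp add: algebra_simps)
      have "u0 + h * ut + x * uy + x\<^sup>2 / 2 * uyy + h * v * u0
          - (u0 + \<sigma> * w * uy + \<sigma>\<^sup>2 / 2 * uyy * (w\<^sup>2 - h))
        = h * (ut + b * uy + \<sigma>\<^sup>2 / 2 * uyy + v * u0) + (r * uy + X * Z / 2 * uyy)"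
        unfolding x2 xu by (simp add: field_simps)
      then have eq: "u0 + h * ut + x * uy + x\<^sup>2 / 2 * uyy + h * v * u0
          - (u0 + \<sigma> * w * uy + \<sigma>\<^sup>2 / 2 * uyy * (w\<^sup>2 - h)) = r * uy + X * Z / 2 * uyy"
        unfolding pde by simp
      have r3: "\<bar>r * uy\<bar> \<le> K * 2 * g * K"
        unfolding abs_mult using rg uy K g0 by (intro mult_mono) auto
      have XZ: "\<bar>X * Z\<bar> \<le> (3 * K * h) * (2 * L * (h + q))"
        unfolding abs_mult X_def Z_def using dr xs K h by (intro mult_mono) auto
      have "(6 * K * L) * (h\<^sup>2 + h * q) \<le> (6 * K * L) * (2 * g)"
        using g1 g2 K L0 by (intro mult_left_mono) auto
      then have "\<bar>X * Z\<bar> \<le> 12 * K * L * g" using XZ by (simp add: power2_eq_square algebra_simps)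
      then have "\<bar>X * Z\<bar> / 2 * \<bar>uyy\<bar> \<le> (12 * K * L * g) / 2 * K"
        using uyy K L0 g0 by (intro mult_mono divide_right_mono) auto
      moreover have "\<bar>X * Z / 2 * uyy\<bar> = \<bar>X * Z\<bar> / 2 * \<bar>uyy\<bar>" by (simp add: abs_mult)
      moreover have "CM * g = K * 2 * g * K + (12 * K * L * g) / 2 * K"
        by (simp add: CM_def algebra_simps)
      ultimately show ?thesis unfolding eq using r3 by linarith
    qed
    have E3: "\<bar>h * v * u1 - h * v * u0\<bar> \<le> CV * g"
    proof -
      have a1: "\<bar>u1 - u0\<bar> \<le> CT * g + h * K + \<bar>x\<bar> * K + x\<^sup>2 * K"
      proof -
        have "\<bar>h * ut\<bar> \<le> h * K" "\<bar>x * uy\<bar> \<le> \<bar>x\<bar> * K" "\<bar>x\<^sup>2 * uyy\<bar> \<le> x\<^sup>2 * K"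
          unfolding abs_mult using ut uy uyy h by (auto intro!: mult_mono)
        moreover have "\<bar>x\<^sup>2 / 2 * uyy\<bar> \<le> \<bar>x\<^sup>2 * uyy\<bar>" by (simp add: abs_mult)
        ultimately show ?thesis using E1 by linarith
      qed
      have "h * \<bar>u1 - u0\<bar> \<le> h * (CT * g + h * K + \<bar>x\<bar> * K + x\<^sup>2 * K)"
        using a1 h by (intro mult_left_mono) auto
      also have "\<dots> = CT * (h * g) + h\<^sup>2 * K + h * \<bar>x\<bar> * K + h * x\<^sup>2 * K"
        by (simp add: power2_eq_square algebra_simps)
      also have "\<dots> \<le> CT * g + g * K + L * (2 * g) * K + L\<^sup>2 * (4 * g) * K"
        using CT0 K h g0 g1 hx hx2
        by (intro add_mono mult_right_mono mult_left_mono) (auto simp: mult_left_le_one_le)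
      finally have "v * (h * \<bar>u1 - u0\<bar>) \<le> K * (CT * g + g * K + L * (2 * g) * K + L\<^sup>2 * (4 * g) * K)"
        using v K h by (intro mult_mono) auto
      moreover have "\<bar>h * v * u1 - h * v * u0\<bar> = v * (h * \<bar>u1 - u0\<bar>)"
        using h v by (simp add: abs_mult flip: right_diff_distrib)
      ultimately show ?thesis by (simp add: CV_def algebra_simps)
    qed
    have E4: "\<bar>(exp (h * v) - 1 - h * v) * u1\<bar> \<le> CE * g"
    proof -
      have hv: "0 \<le> h * v" "h * v \<le> K" using h v K mult_mono[of h 1 v K] by auto
      have "exp (h * v) - 1 - h * v \<le> (h * v)\<^sup>2 * exp K"
      proof -
        obtain t where t: "\<bar>t\<bar> \<le> \<bar>h * v\<bar>"
          and e: "exp (h * v) = (\<Sum>m<2. (h * v) ^ m / fact m) + exp t / fact 2 * (h * v) ^ 2"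
          using Maclaurin_exp_le by blast
        have "exp t * (h * v)\<^sup>2 \<le> exp K * (h * v)\<^sup>2"
          using t hv by (intro mult_right_mono) auto
        moreover have "0 \<le> exp K * (h * v)\<^sup>2" by simp
        moreover have "exp (h * v) = 1 + h * v + exp t * (h * v)\<^sup>2 / 2"
          using e by (simp add: eval_nat_numeral)
        ultimately show ?thesis
          unfolding mult.commute[of "(h * v)\<^sup>2"] by linarith
      qed
      moreover have "0 \<le> exp (h * v) - 1 - h * v"
        using exp_ge_add_one_self[of "h * v"] by linarith
      ultimately have "\<bar>(exp (h * v) - 1 - h * v) * u1\<bar> \<le> (h * v)\<^sup>2 * exp K * K"
        unfolding abs_mult using u1 K by (intro mult_mono) auto
      also have "(h * v)\<^sup>2 * exp K * K = h\<^sup>2 * (v\<^sup>2 * exp K * K)" by (simp add: power_mult_distrib)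
      also have "\<dots> \<le> g * (K\<^sup>2 * exp K * K)"
        using g1 g0 v K by (intro mult_mono mult_right_mono power_mono) auto
      finally show ?thesis by (simp add: CE_def power2_eq_square power3_eq_cube mult_ac)
    qed
    have "\<bar>exp (h * v) * u1 - (u0 + \<sigma> * w * uy + \<sigma>\<^sup>2 / 2 * uyy * (w\<^sup>2 - h))\<bar>
        \<le> CT * g + CM * g + CV * g + CE * g"
      using E1 E2 E3 E4 by (simp add: left_diff_distrib)
    then show "\<bar>exp (h * v) * u1 - (u0 + \<sigma> * w * uy + \<sigma>\<^sup>2 / 2 * uyy * (w\<^sup>2 - h))\<bar>
      \<le> (CT + CM + CV + CE) * (h * sqrt h + \<bar>w\<bar> ^ 3 + h * D)"
      by (simp add: g_def q_def algebra_simps)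
  qed
qed

section \<open>Pathwise estimates\<close>

text \<open>Applied with \<open>f = b\<close>, the second estimate yields the remainder
  \<open>r\<close> of the Euler step: freezing the path at its left endpoint costs the step length
  times the oscillation, which is of order \<open>h + D\<close> while the path stays in the
  box.\<close>

lemma path_integral_increment:
  fixes y w b f :: "real \<Rightarrow> real"
  assumes cont: "continuous_on {0..} y"
    and eq: "\<And>s. 0 \<le> s \<Longrightarrow> y s = y0 + integral {0..s} (\<lambda>r. b (y r)) + \<sigma> * w s"
    and b: "continuous_on UNIV b" and f: "continuous_on UNIV f"
    and bound: "\<And>x. \<bar>x\<bar> \<le> R \<Longrightarrow> \<bar>b x\<bar> \<le> K"
    and lip: "\<And>x z. \<bar>x\<bar> \<le> R \<Longrightarrow> \<bar>z\<bar> \<le> R \<Longrightarrow> \<bar>f z - f x\<bar> \<le> L * \<bar>z - x\<bar>"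
    and pos: "0 \<le> K" "0 \<le> L" "0 \<le> R" "0 \<le> \<sigma>" and t: "0 \<le> t" "0 \<le> h"
    and stay: "\<And>s. t \<le> s \<Longrightarrow> s \<le> t + h \<Longrightarrow> \<bar>y s\<bar> \<le> R"
    and D: "\<And>s. t \<le> s \<Longrightarrow> s \<le> t + h \<Longrightarrow> min 1 \<bar>w s - w t\<bar> \<le> D" "0 \<le> D"
  shows "\<And>s. t \<le> s \<Longrightarrow> s \<le> t + h \<Longrightarrow> y s - y t = integral {t..s} (\<lambda>r. b (y r)) + \<sigma> * (w s - w t)"
    and "\<bar>integral {t..t + h} (\<lambda>r. f (y r)) - h * f (y t)\<bar> \<le> L * (K + \<sigma> + 2 * R) * (h * (h + D))"
proof -
  have int: "(\<lambda>r. g (y r)) integrable_on {a..c}" if "continuous_on UNIV g" "0 \<le> a" for g :: "real \<Rightarrow> real" and a c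
    using that cont
    by (intro integrable_continuous_interval continuous_on_compose2[OF that(1)] continuous_on_subset[OF cont]) auto
  show incr: "y s - y t = integral {t..s} (\<lambda>r. b (y r)) + \<sigma> * (w s - w t)"
    if "t \<le> s" "s \<le> t + h" for s
    using Henstock_Kurzweil_Integration.integral_combine[OF t(1) that(1) int[OF b, of 0 s]] eq[of s] eq[of t] t that
    by (simp add: algebra_simps)
  have ib: "\<bar>integral {t..s} (\<lambda>r. b (y r))\<bar> \<le> K * (s - t)"
    if "t \<le> s" "s \<le> t + h" for s
  proof -
    have "continuous_on {t..s} (\<lambda>r. b (y r))"
      using t by (intro continuous_on_compose2[OF b] continuous_on_subset[OF cont]) auto
    then show ?thesis using integral_bound[of t s "\<lambda>r. b (y r)" K] that stay bound by auto
  qed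
  have osc: "\<bar>y s - y t\<bar> \<le> (K + \<sigma> + 2 * R) * (h + D)" if s: "t \<le> s" "s \<le> t + h" for s
  proof (cases "1 \<le> D")
    \<comment> \<open>Where the cap in \<open>D\<close> is active, \<open>D\<close> says nothing
      about the increment of \<open>w\<close>; the box itself bounds the oscillation by
      \<open>2 * R\<close>.\<close>
    case True
    have "\<bar>y s - y t\<bar> \<le> 2 * R * 1" using stay[of s] stay[of t] s t by auto
    also have "\<dots> \<le> (K + \<sigma> + 2 * R) * (h + D)"
      using True pos t by (intro mult_mono) auto
    finally show ?thesis .
  next
    case False
    then have "\<bar>w s - w t\<bar> \<le> D" using D(1)[OF s] by auto
    then have "\<bar>\<sigma> * (w s - w t)\<bar> \<le> \<sigma> * D" using pos by (auto simp: abs_mult intro!: mult_left_mono)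
    moreover have "K * (s - t) \<le> K * h" using s pos by (intro mult_left_mono) auto
    moreover have "0 \<le> K * D" "0 \<le> \<sigma> * h" "0 \<le> R * h" "0 \<le> R * D" using pos t D by auto
    ultimately show ?thesis unfolding incr[OF s] using ib[OF s] by (simp add: algebra_simps)
  qed
  have "integral {t..t + h} (\<lambda>r. f (y r)) - h * f (y t) = integral {t..t + h} (\<lambda>r. f (y r) - f (y t))"
    using t by (subst integral_diff) (auto intro!: int f)
  moreover have "\<bar>integral {t..t + h} (\<lambda>r. f (y r) - f (y t))\<bar> \<le> L * ((K + \<sigma> + 2 * R) * (h + D)) * (t + h - t)"
    unfolding real_norm_def[symmetric]
  proof (rule integral_bound)
    show "continuous_on {t..t + h} (\<lambda>r. f (y r) - f (y t))"
      using t by (intro continuous_intros continuous_on_compose2[OF f] continuous_on_subset[OF cont]) auto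
    fix s assume "s \<in> {t..t + h}"
    then have s: "t \<le> s" "s \<le> t + h" by auto
    have "\<bar>f (y s) - f (y t)\<bar> \<le> L * \<bar>y s - y t\<bar>" using lip stay s t by auto
    also have "\<dots> \<le> L * ((K + \<sigma> + 2 * R) * (h + D))" using osc[OF s] pos by (intro mult_left_mono)
    finally show "norm (f (y s) - f (y t)) \<le> \<dots>" by simp
  qed (use t in simp)
  ultimately show "\<bar>integral {t..t + h} (\<lambda>r. f (y r)) - h * f (y t)\<bar> \<le> L * (K + \<sigma> + 2 * R) * (h * (h + D))"
    by (simp add: mult_ac)
qed

text \<open>The hypothesis on \<open>h\<close> limits the drift to half of the gap
  \<open>R - R'\<close>, so the noise has to cover the other half.\<close>

lemma path_exit_oscillation:
  fixes y w b :: "real \<Rightarrow> real"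
  assumes cont: "continuous_on {0..} y"
    and eq: "\<And>s. 0 \<le> s \<Longrightarrow> y s = y0 + integral {0..s} (\<lambda>r. b (y r)) + \<sigma> * w s"
    and b: "continuous_on UNIV b"
    and bound: "\<And>x. \<bar>x\<bar> \<le> R \<Longrightarrow> \<bar>b x\<bar> \<le> K" and pos: "0 \<le> K" "0 < \<sigma>" and t: "0 \<le> t" "0 \<le> h"
    and start: "\<bar>y t\<bar> \<le> R'" "R' < R" and s: "t \<le> s" "s \<le> t + h" "R < \<bar>y s\<bar>"
    and h: "K * h \<le> (R - R') / 2"
  shows "\<exists>r. t \<le> r \<and> r \<le> t + h \<and> (R - R') / (2 * \<sigma>) \<le> \<bar>w r - w t\<bar>"
proof -
  have "continuous_on {t..s} (\<lambda>r. \<bar>y r\<bar>)"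
    using t by (intro continuous_intros continuous_on_subset[OF cont]) auto
  \<comment> \<open>The drift bound holds only inside the box, hence the detour over the first time
    \<open>e\<close> at which level \<open>R\<close> is reached: up to \<open>e\<close> the path is
    confined, and at \<open>e\<close> it sits on the boundary by left continuity.\<close>
  define E where "E = {r \<in> {t..s}. R \<le> \<bar>y r\<bar>}"
  have "closed E" unfolding E_def
    using continuous_closed_preimage[OF \<open>continuous_on {t..s} (\<lambda>r. \<bar>y r\<bar>)\<close>, of "{R..}"]
    by (auto simp: vimage_def Int_def)
  moreover have "E \<noteq> {}" "bdd_below E" using s by (auto simp: E_def intro!: exI[of _ s] bdd_belowI[of _ t])
  ultimately have "Inf E \<in> E" by (intro closed_contains_Inf)
  define e where "e = Inf E"
  have e: "t \<le> e" "e \<le> s" "R \<le> \<bar>y e\<bar>" using \<open>Inf E \<in> E\<close> by (auto simp: E_def e_def)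
  have before: "\<bar>y r\<bar> < R" if "t \<le> r" "r < e" for r
    using cInf_lower[OF _ \<open>bdd_below E\<close>, of r] that e unfolding e_def[symmetric] by (force simp: E_def not_le[symmetric])
  have te: "t < e" using e start by (cases "t = e") auto
  have "\<bar>y e\<bar> \<le> R"
  proof (rule ccontr)
    assume "\<not> \<bar>y e\<bar> \<le> R"
    moreover have "((\<lambda>r. \<bar>y r\<bar>) \<longlongrightarrow> \<bar>y e\<bar>) (at e within {t..s})"
      using \<open>continuous_on {t..s} (\<lambda>r. \<bar>y r\<bar>)\<close> e by (simp add: continuous_on_def)
    then have "((\<lambda>r. \<bar>y r\<bar>) \<longlongrightarrow> \<bar>y e\<bar>) (at e within {t..<e})"
      using e by (auto elim!: tendsto_within_subset)
    moreover have "at e within {t..<e} \<noteq> bot"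
      using te by (simp add: at_within_eq_bot_iff islimpt_greaterThanLessThan2 trivial_limit_within
          islimpt_Ico)
    moreover have "eventually (\<lambda>r. \<bar>y r\<bar> \<le> R) (at e within {t..<e})"
      using before by (auto simp: eventually_at_filter less_imp_le)
    ultimately have "\<bar>y e\<bar> \<le> R"
      by (intro tendsto_upperbound[where F = "at e within {t..<e}"])
    then show False using \<open>\<not> \<bar>y e\<bar> \<le> R\<close> by simp
  qed
  then have "\<bar>y r\<bar> \<le> R" if "t \<le> r" "r \<le> e" for r
    using before[of r] that by (cases "r = e") auto
  note stay = this
  have "(\<lambda>r. b (y r)) integrable_on {0..e}"
    by (intro integrable_continuous_interval continuous_on_compose2[OF b] continuous_on_subset[OF cont]) auto
  then have "y e - y t = integral {t..e} (\<lambda>r. b (y r)) + \<sigma> * (w e - w t)"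
    using Henstock_Kurzweil_Integration.integral_combine[of 0 t e "\<lambda>r. b (y r)"] eq[of e] eq[of t] t e
    by (simp add: algebra_simps)
  moreover have "continuous_on {t..e} (\<lambda>r. b (y r))"
    using t by (intro continuous_on_compose2[OF b] continuous_on_subset[OF cont]) auto
  then have "\<bar>integral {t..e} (\<lambda>r. b (y r))\<bar> \<le> K * (e - t)"
    using integral_bound[of t e "\<lambda>r. b (y r)" K] e stay bound by auto
  moreover have "K * (e - t) \<le> K * h" using e s pos by (intro mult_left_mono) auto
  ultimately have "(R - R') / 2 \<le> \<bar>\<sigma> * (w e - w t)\<bar>"
    using e(3) start h unfolding diff_divide_distrib by linarith
  then have "(R - R') / (2 * \<sigma>) \<le> \<bar>w e - w t\<bar>"
    using pos unfolding abs_mult by (simp add: field_simps)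
  then show ?thesis using e s by auto
qed

text \<open>The collar R' \<le> |x| \<le> R, where \<open>u\<close> is at most \<open>- m\<close>,
  makes leaving the box harmless: from the collar a negative value is lost, and from |x| < R' the
  path has to cross the whole collar in one step. A single \<open>K\<close> bounds everything on the
  compact box.\<close>

locale feynman_kac_box =
  fixes b V :: "real \<Rightarrow> real" and \<sigma> S R R' K m :: real and u ut uy uyy :: "real \<Rightarrow> real \<Rightarrow> real"
  assumes \<sigma>: "0 < \<sigma>" and S: "0 < S" and R: "0 \<le> R'" "R' < R" and m: "0 < m" and K: "0 \<le> K"
    and b_cont: "continuous_on UNIV b" and V_cont: "continuous_on UNIV V"
    and b_bound: "\<And>x. \<bar>x\<bar> \<le> R \<Longrightarrow> \<bar>b x\<bar> \<le> K"
    and b_lip: "\<And>x z. \<bar>x\<bar> \<le> R \<Longrightarrow> \<bar>z\<bar> \<le> R \<Longrightarrow> \<bar>b z - b x\<bar> \<le> K * \<bar>z - x\<bar>"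
    and V_nonneg: "\<And>x. 0 \<le> V x" and V_bound: "\<And>x. \<bar>x\<bar> \<le> R \<Longrightarrow> V x \<le> K"
    and u_bound: "\<And>t x. 0 \<le> t \<Longrightarrow> t \<le> S \<Longrightarrow> \<bar>x\<bar> \<le> R \<Longrightarrow>
      \<bar>u t x\<bar> \<le> K \<and> \<bar>ut t x\<bar> \<le> K \<and> \<bar>uy t x\<bar> \<le> K \<and> \<bar>uyy t x\<bar> \<le> K"
    and u_taylor: "\<And>t h x z. 0 \<le> t \<Longrightarrow> 0 \<le> h \<Longrightarrow> t + h \<le> S \<Longrightarrow> \<bar>x\<bar> \<le> R \<Longrightarrow> \<bar>z\<bar> \<le> R \<Longrightarrow>
      \<bar>u (t + h) z - (u t x + h * ut t x + (z - x) * uy t x + (z - x)\<^sup>2 / 2 * uyy t x)\<bar>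
        \<le> K * (h\<^sup>2 + h * \<bar>z - x\<bar> + \<bar>z - x\<bar> ^ 3)"
    and pde: "\<And>t x. 0 \<le> t \<Longrightarrow> t \<le> S \<Longrightarrow> \<bar>x\<bar> \<le> R \<Longrightarrow>
      ut t x + b x * uy t x + \<sigma>\<^sup>2 / 2 * uyy t x + V x * u t x = 0"
    and u_neg: "\<And>t x. 0 \<le> t \<Longrightarrow> t \<le> S \<Longrightarrow> R' \<le> \<bar>x\<bar> \<Longrightarrow> \<bar>x\<bar> \<le> R \<Longrightarrow> u t x \<le> - m"
    and u_measurable: "\<And>t. 0 \<le> t \<Longrightarrow> t \<le> S \<Longrightarrow> u t \<in> borel_measurable borel"
      "\<And>t. 0 \<le> t \<Longrightarrow> t \<le> S \<Longrightarrow> uy t \<in> borel_measurable borel"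
      "\<And>t. 0 \<le> t \<Longrightarrow> t \<le> S \<Longrightarrow> uyy t \<in> borel_measurable borel"
begin

text \<open>Three cases. A path that stays in the box obeys the Euler expansion. If it leaves from
  the collar, u \<le> - m pays for the noise terms while the increment of \<open>w\<close> is small,
  and the cube of the increment dominates them otherwise. If it leaves from the inner part, the
  capped oscillation \<open>D\<close> is bounded below, so a constant is at most a multiple of
  \<open>D\<close>.\<close>

lemma path_step:
  "\<exists>C\<ge>0. \<exists>h0>0. \<forall>h t D y y0 w. 0 < h \<longrightarrow> h \<le> h0 \<longrightarrow> 0 \<le> t \<longrightarrow> t + h \<le> S \<longrightarrow> 0 \<le> D \<longrightarrow> D \<le> 1 \<longrightarrow>
    continuous_on {0..} y \<longrightarrow>
    (\<forall>s\<ge>0. y s = y0 + integral {0..s} (\<lambda>r. b (y r)) + \<sigma> * w s) \<longrightarrow>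
    (\<forall>s\<in>{t..t + h}. min 1 \<bar>w s - w t\<bar> \<le> D) \<longrightarrow> \<bar>y t\<bar> \<le> R \<longrightarrow>
    u t (y t) + \<sigma> * (w (t + h) - w t) * uy t (y t)
        + \<sigma>\<^sup>2 / 2 * uyy t (y t) * ((w (t + h) - w t)\<^sup>2 - h)
      \<le> (if \<forall>s\<in>{t..t + h}. \<bar>y s\<bar> \<le> R then exp (h * V (y t)) * u (t + h) (y (t + h)) else C * D)
        + C * (h * sqrt h + \<bar>w (t + h) - w t\<bar> ^ 3 + h * D)"
proof -
  \<comment> \<open>The Euler remainder carries the product of the Lipschitz and the oscillation
    constant; \<open>K1\<close> covers it together with \<open>K\<close>, so that one constant can
    be fed to \<open>feynman_kac_step\<close>.\<close>
  define K1 where "K1 = K * (1 + (K + \<sigma> + 2 * R))"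
  have K1: "K \<le> K1" "0 \<le> K1" "K * (K + \<sigma> + 2 * R) \<le> K1"
    using K \<sigma> R by (auto simp: K1_def algebra_simps)
  obtain C1 where C1: "0 \<le> C1" and step: "\<forall>h w D r b v u0 u1 ut uy uyy x.
    0 < h \<longrightarrow> h \<le> 1 \<longrightarrow> 0 \<le> D \<longrightarrow> D \<le> 1 \<longrightarrow> \<bar>r\<bar> \<le> K1 * h * (h + D) \<longrightarrow>
    \<bar>b\<bar> \<le> K1 \<longrightarrow> 0 \<le> v \<longrightarrow> v \<le> K1 \<longrightarrow> \<bar>u1\<bar> \<le> K1 \<longrightarrow> \<bar>ut\<bar> \<le> K1 \<longrightarrow> \<bar>uy\<bar> \<le> K1 \<longrightarrow> \<bar>uyy\<bar> \<le> K1 \<longrightarrow>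
    ut + b * uy + \<sigma>\<^sup>2 / 2 * uyy + v * u0 = 0 \<longrightarrow>
    x = h * b + \<sigma> * w + r \<longrightarrow>
    \<bar>u1 - (u0 + h * ut + x * uy + x\<^sup>2 / 2 * uyy)\<bar> \<le> K1 * (h\<^sup>2 + h * \<bar>x\<bar> + \<bar>x\<bar> ^ 3) \<longrightarrow>
    \<bar>exp (h * v) * u1 - (u0 + \<sigma> * w * uy + \<sigma>\<^sup>2 / 2 * uyy * (w\<^sup>2 - h))\<bar>
      \<le> C1 * (h * sqrt h + \<bar>w\<bar> ^ 3 + h * D)"
    using feynman_kac_step[OF K1(2) \<sigma>] by blast
  \<comment> \<open>\<open>A\<close> dominates the coefficients of the increment and of its square.
    The choice 2 A \<epsilon> \<le> m / 2 lets half of the negative value of \<open>u\<close> in the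
    collar absorb increments up to \<epsilon>, and \<delta> is the oscillation forced by crossing
    the collar, capped like \<open>D\<close>.\<close>
  define A where "A = 1 + K * \<sigma> + K * \<sigma>\<^sup>2"
  have A: "1 \<le> A" using K \<sigma> by (simp add: A_def)
  define \<epsilon> where "\<epsilon> = min 1 (m / (4 * A))"
  have \<epsilon>: "0 < \<epsilon>" "\<epsilon> \<le> 1" "2 * A * \<epsilon> \<le> m / 2" using m A by (auto simp: \<epsilon>_def min_def field_simps)
  define \<delta> where "\<delta> = min 1 ((R - R') / (2 * \<sigma>))"
  have \<delta>: "0 < \<delta>" "\<delta> \<le> 1" using R \<sigma> by (auto simp: \<delta>_def)
  \<comment> \<open>One summand per case: staying, leaving the collar with a large increment, and,
    for a crossing of the collar, the constant part and the cubic part.\<close>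
  define C where "C = C1 + 2 * A / \<epsilon>\<^sup>2 + (K + 3 * A) / \<delta> + 2 * A"
  have C: "C1 \<le> C" "2 * A / \<epsilon>\<^sup>2 \<le> C" "(K + 3 * A) / \<delta> \<le> C" "2 * A \<le> C" "0 \<le> C"
    using C1 A K \<epsilon> \<delta> by (auto simp: C_def)
  \<comment> \<open>The first bound lets the other half of \<open>m\<close> pay for the term
    \<open>A * h\<close>; the last one supplies the drift hypothesis of
    \<open>path_exit_oscillation\<close>.\<close>
  define h0 where "h0 = min (m / (2 * A)) (min 1 ((R - R') / (2 * (K + 1))))"
  have h0: "0 < h0" using m A R K by (auto simp: h0_def)
  show ?thesis
  proof (rule exI[of _ C], intro conjI C(5), rule exI[of _ h0], intro conjI allI impI h0)
    fix h t D y0 and y w :: "real \<Rightarrow> real"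
    assume h: "0 < h" "h \<le> h0" and t: "0 \<le> t" "t + h \<le> S" and D: "0 \<le> D" "D \<le> 1"
      and cont: "continuous_on {0..} y"
      and eq: "\<forall>s\<ge>0. y s = y0 + integral {0..s} (\<lambda>r. b (y r)) + \<sigma> * w s"
      and wD: "\<forall>s\<in>{t..t + h}. min 1 \<bar>w s - w t\<bar> \<le> D" and yt: "\<bar>y t\<bar> \<le> R"
    define q where "q = w (t + h) - w t"
    define B where "B = u t (y t) + \<sigma> * q * uy t (y t) + \<sigma>\<^sup>2 / 2 * uyy t (y t) * (q\<^sup>2 - h)"
    define g where "g = h * sqrt h + \<bar>q\<bar> ^ 3 + h * D"
    have tS: "t \<le> S" using t h by simp
    have h1: "h \<le> 1" "A * h \<le> m / 2" "K * h \<le> (R - R') / 2"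
    proof -
      show "h \<le> 1" using h by (simp add: h0_def)
      have "h \<le> m / (2 * A)" using h by (simp add: h0_def)
      then show "A * h \<le> m / 2" using A by (simp add: field_simps)
      have "h \<le> (R - R') / (2 * (K + 1))" using h by (simp add: h0_def)
      then have "(K + 1) * h \<le> (R - R') / 2" using K by (simp add: field_simps)
      then show "K * h \<le> (R - R') / 2" using h by (simp add: algebra_simps)
    qed
    have g: "0 \<le> g" "\<bar>q\<bar> ^ 3 \<le> g" using h D by (auto simp: g_def)
    have "B \<le> (if \<forall>s\<in>{t..t + h}. \<bar>y s\<bar> \<le> R then exp (h * V (y t)) * u (t + h) (y (t + h)) else C * D) + C * g"
    proof (cases "\<forall>s\<in>{t..t + h}. \<bar>y s\<bar> \<le> R")
      case True
      note incr = path_integral_increment[of y y0 b \<sigma> w b R K K t h D]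
      define r where "r = y (t + h) - y t - h * b (y t) - \<sigma> * q"
      have r1: "\<bar>r\<bar> \<le> K * (K + \<sigma> + 2 * R) * (h * (h + D))"
        using incr(1)[of "t + h"] incr(2) True eq cont b_cont b_bound b_lip K \<sigma> R t h D wD
        by (auto simp: r_def q_def)
      also have "\<dots> \<le> K1 * (h * (h + D))" using K1 h D by (intro mult_right_mono) auto
      finally have r: "\<bar>r\<bar> \<le> K1 * h * (h + D)" by (simp add: mult.assoc)
      have yth: "\<bar>y (t + h)\<bar> \<le> R" using True h by auto
      have tay: "\<bar>u (t + h) (y (t + h)) - (u t (y t) + h * ut t (y t) + (y (t + h) - y t) * uy t (y t)
          + (y (t + h) - y t)\<^sup>2 / 2 * uyy t (y t))\<bar>
        \<le> K1 * (h\<^sup>2 + h * \<bar>y (t + h) - y t\<bar> + \<bar>y (t + h) - y t\<bar> ^ 3)"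
      proof (rule order_trans[OF u_taylor])
        show "K * (h\<^sup>2 + h * \<bar>y (t + h) - y t\<bar> + \<bar>y (t + h) - y t\<bar> ^ 3)
            \<le> K1 * (h\<^sup>2 + h * \<bar>y (t + h) - y t\<bar> + \<bar>y (t + h) - y t\<bar> ^ 3)"
          using K1(1) h by (intro mult_right_mono) auto
      qed (use t h yt yth in auto)
      have ub: "\<bar>u (t + h) (y (t + h))\<bar> \<le> K1"
        using u_bound[of "t + h" "y (t + h)"] yth t h K1 by auto
      have "\<bar>exp (h * V (y t)) * u (t + h) (y (t + h)) - B\<bar> \<le> C1 * g"
        unfolding B_def g_def
      proof (rule step[rule_format, where r = r])
        show "y (t + h) - y t = h * b (y t) + \<sigma> * q + r" by (simp add: r_def)
        show "\<bar>b (y t)\<bar> \<le> K1" "V (y t) \<le> K1" "\<bar>ut t (y t)\<bar> \<le> K1" "\<bar>uy t (y t)\<bar> \<le> K1" "\<bar>uyy t (y t)\<bar> \<le> K1"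
          using b_bound[OF yt] V_bound[OF yt] u_bound[OF t(1) tS yt] K1(1) by linarith+
      qed (use h h1 D r V_nonneg ub pde[OF t(1) tS yt] tay in auto)
      moreover have "C1 * g \<le> C * g" using C g by (intro mult_right_mono) auto
      ultimately show ?thesis using True by simp
    next
      case outer: False
      then obtain s where s: "t \<le> s" "s \<le> t + h" "R < \<bar>y s\<bar>" by force
      have Bu: "B \<le> u t (y t) + A * \<bar>q\<bar> + A * q\<^sup>2 + A * h"
      proof -
        have ub: "\<bar>uy t (y t)\<bar> \<le> K" "\<bar>uyy t (y t)\<bar> \<le> K" using u_bound[OF t(1) tS yt] by auto
        have "\<sigma> * q * uy t (y t) \<le> \<bar>\<sigma> * q * uy t (y t)\<bar>" by simp
        also have "\<dots> \<le> \<sigma> * \<bar>q\<bar> * K"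
          unfolding abs_mult using ub \<sigma> by (intro mult_mono) auto
        also have "\<sigma> * \<bar>q\<bar> * K \<le> A * \<bar>q\<bar>"
          using K \<sigma> by (auto simp: A_def algebra_simps)
        finally have 1: "\<sigma> * q * uy t (y t) \<le> A * \<bar>q\<bar>" .
        have "\<sigma>\<^sup>2 / 2 * uyy t (y t) * (q\<^sup>2 - h) \<le> \<bar>\<sigma>\<^sup>2 / 2 * uyy t (y t) * (q\<^sup>2 - h)\<bar>" by simp
        also have "\<dots> \<le> \<sigma>\<^sup>2 * K * (q\<^sup>2 + h)"
          unfolding abs_mult using ub h K
        proof (intro mult_mono)
          show "\<bar>q\<^sup>2 - h\<bar> \<le> q\<^sup>2 + h" using h zero_le_power2[of q] by linarith
        qed auto
        also have "\<dots> \<le> A * (q\<^sup>2 + h)"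
          using K \<sigma> h by (intro mult_right_mono) (auto simp: A_def mult.commute)
        finally have "\<sigma>\<^sup>2 / 2 * uyy t (y t) * (q\<^sup>2 - h) \<le> A * q\<^sup>2 + A * h"
          unfolding distrib_left .
        then show ?thesis using 1 unfolding B_def by linarith
      qed
      show ?thesis
      proof (cases "R' \<le> \<bar>y t\<bar>")
        case True
        then have "u t (y t) \<le> - m" using u_neg[OF t(1) tS] yt by simp
        then have "B \<le> - m / 2 + A * (\<bar>q\<bar> + q\<^sup>2)" using Bu h1 by (simp add: algebra_simps)
        moreover have "A * (\<bar>q\<bar> + q\<^sup>2) \<le> m / 2 + C * g"
        proof (cases "\<bar>q\<bar> \<le> \<epsilon>")
          case True
          then have "q\<^sup>2 \<le> \<epsilon>\<^sup>2" by (metis abs_ge_zero power2_abs power_mono)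
          also have "\<epsilon>\<^sup>2 \<le> \<epsilon>" using \<epsilon> by (simp add: power2_eq_square mult_left_le)
          finally have "A * (\<bar>q\<bar> + q\<^sup>2) \<le> A * (2 * \<epsilon>)" using True A by (intro mult_left_mono) auto
          moreover have "0 \<le> C * g" using C g by simp
          ultimately show ?thesis using \<epsilon> by simp
        next
          case False
          have "\<epsilon>\<^sup>2 \<le> q\<^sup>2" using False \<epsilon> by (metis abs_le_square_iff abs_of_pos linear)
          then have "\<epsilon>\<^sup>2 * \<bar>q\<bar> \<le> \<bar>q\<bar> ^ 3"
            by (simp add: power3_eq_cube power2_eq_square mult_right_mono flip: abs_mult)
          moreover have "\<epsilon>\<^sup>2 * q\<^sup>2 \<le> \<bar>q\<bar> ^ 3"
          proof -
            have "\<epsilon>\<^sup>2 \<le> \<epsilon>" using \<epsilon> by (simp add: power2_eq_square mult_left_le)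
            then have "\<epsilon>\<^sup>2 * q\<^sup>2 \<le> \<bar>q\<bar> * q\<^sup>2" using False by (intro mult_right_mono) auto
            then show ?thesis by (simp add: power3_eq_cube power2_eq_square)
          qed
          ultimately have "\<epsilon>\<^sup>2 * (\<bar>q\<bar> + q\<^sup>2) \<le> 2 * \<bar>q\<bar> ^ 3" by (simp add: algebra_simps)
          then have "A * (\<epsilon>\<^sup>2 * (\<bar>q\<bar> + q\<^sup>2)) \<le> A * (2 * \<bar>q\<bar> ^ 3)" using A by (intro mult_left_mono) auto
          then have "A * (\<bar>q\<bar> + q\<^sup>2) \<le> 2 * A / \<epsilon>\<^sup>2 * \<bar>q\<bar> ^ 3" using \<epsilon> by (simp add: field_simps)
          also have "\<dots> \<le> C * g" using C g by (intro mult_mono) auto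
          finally show ?thesis using m by simp
        qed
        ultimately have "B \<le> C * g" by simp
        moreover have "0 \<le> C * D" using C D by simp
        ultimately show ?thesis unfolding if_not_P[OF outer] by linarith
      next
        case inner: False
        obtain r where r: "t \<le> r" "r \<le> t + h" "(R - R') / (2 * \<sigma>) \<le> \<bar>w r - w t\<bar>"
          using path_exit_oscillation[of y y0 b \<sigma> w R K t h R' s] cont eq b_cont b_bound K \<sigma> t h inner R s h1
          by auto
        then have "\<delta> \<le> D" using wD by (force simp: \<delta>_def)
        then have D1: "K + 3 * A \<le> (K + 3 * A) / \<delta> * D"
          using \<delta> K A mult_left_mono[of \<delta> D "K + 3 * A"] by (simp add: pos_le_divide_eq)
        have "\<bar>q\<bar> \<le> 1 + \<bar>q\<bar> ^ 3 \<and> q\<^sup>2 \<le> 1 + \<bar>q\<bar> ^ 3"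
        proof (cases "\<bar>q\<bar> \<le> 1")
          case True
          then have "q\<^sup>2 \<le> 1" by (metis abs_square_le_1)
          moreover have "0 \<le> \<bar>q\<bar> ^ 3" by simp
          ultimately show ?thesis using True by linarith
        next
          case False
          then have "1 \<le> \<bar>q\<bar>" by simp
          then have "\<bar>q\<bar> ^ 1 \<le> \<bar>q\<bar> ^ 3" "\<bar>q\<bar> ^ 2 \<le> \<bar>q\<bar> ^ 3" by (intro power_increasing; simp)+
          then show ?thesis unfolding power_one_right power2_abs by linarith
        qed
        then have "A * (\<bar>q\<bar> + q\<^sup>2 + h) \<le> A * (3 + 2 * \<bar>q\<bar> ^ 3)" using h1 A by (intro mult_left_mono) auto
        moreover have "u t (y t) \<le> K" using u_bound[OF t(1) tS yt] by auto
        ultimately have "B \<le> K + 3 * A + 2 * A * \<bar>q\<bar> ^ 3" using Bu by (simp add: algebra_simps)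
        moreover have "(K + 3 * A) / \<delta> * D \<le> C * D" using C D by (intro mult_right_mono) auto
        moreover have "2 * A * \<bar>q\<bar> ^ 3 \<le> C * g" using C g A by (intro mult_mono) auto
        ultimately show ?thesis unfolding if_not_P[OF outer] using D1 by linarith
      qed
    qed
    then show "u t (y t) + \<sigma> * (w (t + h) - w t) * uy t (y t)
        + \<sigma>\<^sup>2 / 2 * uyy t (y t) * ((w (t + h) - w t)\<^sup>2 - h)
      \<le> (if \<forall>s\<in>{t..t + h}. \<bar>y s\<bar> \<le> R then exp (h * V (y t)) * u (t + h) (y (t + h)) else C * D)
        + C * (h * sqrt h + \<bar>w (t + h) - w t\<bar> ^ 3 + h * D)"
      by (simp add: B_def g_def q_def)
  qed
qed

end

section \<open>Brownian increments and the modulus of continuity\<close>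

lemma riemann_sum_tendsto:
  fixes f :: "real \<Rightarrow> real"
  assumes f: "continuous_on {0..S} f" and S: "0 < S"
  shows "(\<lambda>n. \<Sum>j<n. S / n * f (real j * (S / n))) \<longlonglongrightarrow> integral {0..S} f"
proof (rule LIMSEQ_I)
  fix e :: real assume "0 < e"
  then have e: "0 < e / (2 * S)" using S by simp
  have "uniformly_continuous_on {0..S} f" using f by (intro compact_uniformly_continuous) auto
  then obtain d where d: "0 < d"
    and uc: "\<And>x x'. x \<in> {0..S} \<Longrightarrow> x' \<in> {0..S} \<Longrightarrow> dist x' x < d \<Longrightarrow> dist (f x') (f x) < e / (2 * S)"
    using e unfolding uniformly_continuous_on_def by meson
  obtain N :: nat where N: "S / d < N" using reals_Archimedean2 by blast
  show "\<exists>N::nat. \<forall>n\<ge>N. norm ((\<Sum>j<n. S / n * f (real j * (S / n))) - integral {0..S} f) < e"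
  proof (intro exI allI impI)
    fix n assume n: "N \<le> n"
    have "0 < S / d" using S d by simp
    then have n0: "0 < real n" "S / d < n" using n N by linarith+
    define h where "h = S / n"
    have h: "0 < h" "h < d" "n * h = S" using n0 S d by (auto simp: h_def field_simps)
    have "k \<le> n \<Longrightarrow> \<bar>(\<Sum>j<k. h * f (real j * h)) - integral {0..k * h} f\<bar> \<le> k * h * (e / (2 * S))" for k
    proof (induction k)
      case (Suc k)
      have kh: "0 \<le> k * h" "k * h \<le> Suc k * h" "Suc k * h \<le> S" "Suc k * h = k * h + h"
        using h Suc.prems mult_right_mono[of "real (Suc k)" n h] by (auto simp: algebra_simps)
      have int: "f integrable_on {a..c}" if "0 \<le> a" "c \<le> S" for a c
        using that by (intro integrable_continuous_interval continuous_on_subset[OF f]) auto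
      have "h * f (k * h) - integral {k * h..Suc k * h} f
          = integral {k * h..Suc k * h} (\<lambda>x. f (k * h) - f x)"
        using kh by (subst integral_diff) (auto intro!: int)
      also have "\<bar>\<dots>\<bar> \<le> e / (2 * S) * (Suc k * h - k * h)"
        unfolding real_norm_def[symmetric]
      proof (rule integral_bound)
        show "continuous_on {k * h..Suc k * h} (\<lambda>x. f (k * h) - f x)"
          using kh by (intro continuous_intros continuous_on_subset[OF f]) auto
        fix x assume "x \<in> {k * h..Suc k * h}"
        then show "norm (f (k * h) - f x) \<le> e / (2 * S)"
          using uc[of x "k * h"] kh h by (auto simp: dist_norm)
      qed (use kh in auto)
      finally have "\<bar>h * f (k * h) - integral {k * h..Suc k * h} f\<bar> \<le> e / (2 * S) * h"
        using kh by simp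
      moreover have "integral {0..k * h} f + integral {k * h..Suc k * h} f = integral {0..Suc k * h} f"
        using kh by (intro Henstock_Kurzweil_Integration.integral_combine int) auto
      moreover have "\<bar>(\<Sum>j<k. h * f (real j * h)) - integral {0..k * h} f\<bar> \<le> k * h * (e / (2 * S))"
        using Suc.IH Suc.prems by (simp only: Suc_leD)
      moreover have "Suc k * h * (e / (2 * S)) = k * h * (e / (2 * S)) + e / (2 * S) * h"
        by (simp add: algebra_simps add_divide_distrib)
      ultimately show ?case by simp
    qed simp
    from this[of n] have "\<bar>(\<Sum>j<n. h * f (real j * h)) - integral {0..S} f\<bar> \<le> e / 2"
      using h S by simp
    then show "norm ((\<Sum>j<n. S / n * f (real j * (S / n))) - integral {0..S} f) < e"
      using \<open>0 < e\<close> unfolding h_def by simp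
  qed
qed

lemma closure_rationals_unit_interval: "closure (\<rat> \<inter> {0..1::real}) = {0..1}"
  using closure_convex_Int_superset[of "{0..1::real}" "\<rat>"]
  by (simp add: Rats_closure_real Int_commute)

section \<open>Mean-zero increments and a measurable modulus of continuity\<close>

context brownian_motion
begin

lemma measurable_F_M: "0 \<le> t \<Longrightarrow> f \<in> borel_measurable (F t) \<Longrightarrow> f \<in> borel_measurable M"
  using F_subalgebra[of t] measurable_from_subalg by blast

lemma measurable_F_mono: "s \<le> t \<Longrightarrow> f \<in> borel_measurable (F s) \<Longrightarrow> f \<in> borel_measurable (F t)"
  using sets_F_mono[of s t] space_F by (auto simp: measurable_def)

lemma W_measurable: "0 \<le> t \<Longrightarrow> W t \<in> borel_measurable M"
  by (rule measurable_F_M[OF _ W_adapted])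

lemma increment_moments:
  assumes "0 \<le> s" "s < t"
  shows "integrable M (\<lambda>\<omega>. W t \<omega> - W s \<omega>)" "expectation (\<lambda>\<omega>. W t \<omega> - W s \<omega>) = 0"
    and "integrable M (\<lambda>\<omega>. (W t \<omega> - W s \<omega>)\<^sup>2)" "expectation (\<lambda>\<omega>. (W t \<omega> - W s \<omega>)\<^sup>2) = t - s"
    and "integrable M (\<lambda>\<omega>. \<bar>W t \<omega> - W s \<omega>\<bar> ^ 3)"
    and "expectation (\<lambda>\<omega>. \<bar>W t \<omega> - W s \<omega>\<bar> ^ 3) \<le> 2 * ((t - s) * sqrt (t - s))"
proof -
  note N = W_increment_normal[OF assms]
  have pos: "0 < sqrt (t - s)" using assms by simp
  note m1 = integrable_normal_moment_nz_1[OF pos, of 0] integral_normal_moment_nz_1[OF pos, of 0]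
  note m2 = normal_moment_even[OF pos, of 0 1]
  note m3 = normal_moment_abs_odd[OF pos, of 0 1]
  show "integrable M (\<lambda>\<omega>. W t \<omega> - W s \<omega>)"
    using distributed_integrable[OF N, of "\<lambda>x. x"] m1 by simp
  show "expectation (\<lambda>\<omega>. W t \<omega> - W s \<omega>) = 0"
    using distributed_integral[OF N, of "\<lambda>x. x"] m1 by simp
  show "integrable M (\<lambda>\<omega>. (W t \<omega> - W s \<omega>)\<^sup>2)"
    using distributed_integrable[OF N, of "\<lambda>x. x\<^sup>2"] integrable.intros[OF m2] by simp
  show "expectation (\<lambda>\<omega>. (W t \<omega> - W s \<omega>)\<^sup>2) = t - s"
    using distributed_integral[OF N, of "\<lambda>x. x\<^sup>2"] has_bochner_integral_integral_eq[OF m2] assms by simp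
  show "integrable M (\<lambda>\<omega>. \<bar>W t \<omega> - W s \<omega>\<bar> ^ 3)"
    using distributed_integrable[OF N, of "\<lambda>x. \<bar>x\<bar> ^ 3"] integrable.intros[OF m3] by simp
  have "expectation (\<lambda>\<omega>. \<bar>W t \<omega> - W s \<omega>\<bar> ^ 3) = 2 * sqrt (t - s) ^ 3 * sqrt (2 / pi)"
    using distributed_integral[OF N, of "\<lambda>x. \<bar>x\<bar> ^ 3"] has_bochner_integral_integral_eq[OF m3] by simp
  also have "\<dots> \<le> 2 * sqrt (t - s) ^ 3 * 1"
    using assms pi_ge_two by (intro mult_left_mono) auto
  also have "sqrt (t - s) ^ 3 = (t - s) * sqrt (t - s)"
    using assms by (simp add: power3_eq_cube)
  finally show "expectation (\<lambda>\<omega>. \<bar>W t \<omega> - W s \<omega>\<bar> ^ 3) \<le> 2 * ((t - s) * sqrt (t - s))" by simp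
qed

text \<open>This removes the noise terms of the Euler step in expectation: with \<xi> built from the
  past and \<open>f\<close> the identity or \<open>\<lambda>x. x\<^sup>2 - h\<close>, the second
  factor has mean zero.\<close>

lemma expectation_mult_increment:
  fixes f :: "real \<Rightarrow> real"
  assumes st: "0 \<le> s" "s < t" and \<xi>: "\<xi> \<in> borel_measurable (F s)" "integrable M \<xi>"
    and f: "f \<in> borel_measurable borel" "integrable M (\<lambda>\<omega>. f (W t \<omega> - W s \<omega>))"
  shows "integrable M (\<lambda>\<omega>. \<xi> \<omega> * f (W t \<omega> - W s \<omega>))"
    and "expectation (\<lambda>\<omega>. \<xi> \<omega> * f (W t \<omega> - W s \<omega>)) = expectation \<xi> * expectation (\<lambda>\<omega>. f (W t \<omega> - W s \<omega>))"
proof -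
  define Z where "Z = (\<lambda>\<omega>. W t \<omega> - W s \<omega>)"
  have Z: "random_variable borel Z"
    unfolding Z_def using st by (intro borel_measurable_diff W_measurable) auto
  have "indep_set (sets (F s)) {Z -` A \<inter> space M |A. A \<in> sets borel}"
    unfolding Z_def using W_increment_indep[OF st] .
  then have ind: "\<And>a b. a \<in> sets (F s) \<Longrightarrow> b \<in> {Z -` A \<inter> space M |A. A \<in> sets borel} \<Longrightarrow> prob (a \<inter> b) = prob a * prob b"
    and sub: "sets (F s) \<subseteq> events"
    unfolding indep_sets2_eq by auto
  have fZ: "random_variable borel (\<lambda>\<omega>. f (Z \<omega>))" using Z f(1) by (rule measurable_compose)
  have \<xi>M: "random_variable borel \<xi>" using \<xi> st by (auto intro: measurable_F_M)
  have stable: "Int_stable {X -` A \<inter> space M |A. A \<in> sets borel}" for X :: "'a \<Rightarrow> real"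
    unfolding Int_stable_def
  proof (intro ballI)
    fix a c assume "a \<in> {X -` A \<inter> space M |A. A \<in> sets borel}" "c \<in> {X -` A \<inter> space M |A. A \<in> sets borel}"
    then obtain A C where "A \<in> sets borel" "a = X -` A \<inter> space M" "C \<in> sets borel" "c = X -` C \<inter> space M"
      by auto
    then show "a \<inter> c \<in> {X -` A \<inter> space M |A. A \<in> sets borel}"
      by (intro CollectI exI[of _ "A \<inter> C"]) auto
  qed
  \<comment> \<open>Independence is given between \<open>F s\<close> and preimages under the
    increment. Events of \<open>f (Z \<omega>)\<close> are such preimages, and intersection
    stability extends the product rule to the generated sigma-algebras.\<close>
  have "indep_var borel \<xi> borel (\<lambda>\<omega>. f (Z \<omega>))"
    unfolding indep_var_eq
  proof (intro conjI \<xi>M fZ indep_set_sigma_sets indep_setI)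
    show "{\<xi> -` A \<inter> space M |A. A \<in> sets borel} \<subseteq> events"
      using \<xi>M by (auto intro: measurable_sets)
    show "{(\<lambda>\<omega>. f (Z \<omega>)) -` A \<inter> space M |A. A \<in> sets borel} \<subseteq> events"
      using fZ by (auto intro: measurable_sets)
    fix a c assume "a \<in> {\<xi> -` A \<inter> space M |A. A \<in> sets borel}"
      and "c \<in> {(\<lambda>\<omega>. f (Z \<omega>)) -` A \<inter> space M |A. A \<in> sets borel}"
    then obtain A C where AC: "A \<in> sets borel" "a = \<xi> -` A \<inter> space M"
      "C \<in> sets borel" "c = (\<lambda>\<omega>. f (Z \<omega>)) -` C \<inter> space M" by auto
    have "a \<in> sets (F s)"
      using measurable_sets[OF \<xi>(1) AC(1)] AC(2) space_F by simp
    moreover have "c = Z -` (f -` C \<inter> space borel) \<inter> space M" "f -` C \<inter> space borel \<in> sets borel"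
      using AC measurable_sets[OF f(1) AC(3)] by auto
    ultimately show "prob (a \<inter> c) = prob a * prob c"
      by (intro ind) blast+
  next
    show "Int_stable {\<xi> -` A \<inter> space M |A. A \<in> sets borel}" by (rule stable)
    show "Int_stable {(\<lambda>\<omega>. f (Z \<omega>)) -` A \<inter> space M |A. A \<in> sets borel}" by (rule stable)
  qed
  from indep_var_integrable[OF this \<xi>(2)] indep_var_lebesgue_integral[OF this \<xi>(2)] f(2)
  show "integrable M (\<lambda>\<omega>. \<xi> \<omega> * f (W t \<omega> - W s \<omega>))"
    and "expectation (\<lambda>\<omega>. \<xi> \<omega> * f (W t \<omega> - W s \<omega>)) = expectation \<xi> * expectation (\<lambda>\<omega>. f (W t \<omega> - W s \<omega>))"
    by (auto simp: Z_def)
qed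

text \<open>The modulus of continuity of the paths on the grid of mesh \<open>S / n\<close>, capped at \<open>1\<close> for integrability;
  the supremum runs over rational points to make it measurable.\<close>

definition grid_modulus :: "real \<Rightarrow> nat \<Rightarrow> 'a \<Rightarrow> real" where
  "grid_modulus S n \<omega> = (SUP (k, q) \<in> {..<n} \<times> (\<rat> \<inter> {0..1}).
     min 1 \<bar>W ((real k + q) * (S / n)) \<omega> - W (k * (S / n)) \<omega>\<bar>)"

lemma bdd_above_grid_modulus:
  "bdd_above ((\<lambda>(k, q). min 1 \<bar>W ((real k + q) * (S / n)) \<omega> - W (k * (S / n)) \<omega>\<bar>) ` ({..<n} \<times> (\<rat> \<inter> {0..1})))"
  by (rule bdd_aboveI[of _ 1]) auto

lemma grid_modulus_measurable:
  assumes "0 < S"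
  shows "grid_modulus S n \<in> borel_measurable M"
  unfolding grid_modulus_def
proof (rule borel_measurable_cSUP)
  show "countable ({..<n} \<times> (\<rat> \<inter> {0..1::real}))"
    using countable_rat by (intro countable_SIGMA) auto
  show "(\<lambda>\<omega>. case i of (k, q) \<Rightarrow> min 1 \<bar>W ((real k + q) * (S / n)) \<omega> - W (k * (S / n)) \<omega>\<bar>)
      \<in> borel_measurable M" if i: "i \<in> {..<n} \<times> (\<rat> \<inter> {0..1})" for i
  proof -
    obtain k q where [simp]: "i = (k, q)" and "0 \<le> q" using i by auto
    have "W ((real k + q) * (S / n)) \<in> borel_measurable M" "W (k * (S / n)) \<in> borel_measurable M"
      using assms \<open>0 \<le> q\<close> by (auto intro!: W_measurable mult_nonneg_nonneg)
    then show ?thesis unfolding \<open>i = (k, q)\<close> prod.case by measurable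
  qed
qed (rule bdd_above_grid_modulus)

lemma grid_modulus_bounds:
  assumes "0 < n"
  shows "0 \<le> grid_modulus S n \<omega>" "grid_modulus S n \<omega> \<le> 1"
proof -
  have mem: "(0, 0) \<in> {..<n} \<times> (\<rat> \<inter> {0..1::real})" using assms by auto
  show "0 \<le> grid_modulus S n \<omega>"
    unfolding grid_modulus_def by (rule cSUP_upper2[OF bdd_above_grid_modulus mem]) simp
  show "grid_modulus S n \<omega> \<le> 1"
    unfolding grid_modulus_def using mem by (intro cSUP_least) auto
qed

text \<open>Rational offsets are dense in the unit interval, so continuity of the path carries the
  bound from the countable supremum to every time of the cell.\<close>

lemma grid_modulus_upper:
  fixes k n :: nat
  assumes cont: "continuous_on {0..} (\<lambda>t. W t \<omega>)" and S: "0 < S" and k: "k < n"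
    and s: "s \<in> {k * (S / n)..k * (S / n) + S / n}"
  shows "min 1 \<bar>W s \<omega> - W (k * (S / n)) \<omega>\<bar> \<le> grid_modulus S n \<omega>"
proof -
  define h where "h = S / n"
  have h: "0 < h" unfolding h_def using S k by (intro divide_pos_pos of_nat_0_less_iff[THEN iffD2]) auto
  define q where "q = (s - k * h) / h"
  have q: "0 \<le> q" "q \<le> 1" "s = (k + q) * h" using s h by (auto simp: q_def h_def[symmetric] field_simps)
  define \<phi> where "\<phi> x = min 1 \<bar>W ((real k + x) * h) \<omega> - W (k * h) \<omega>\<bar>" for x
  have \<phi>: "continuous_on {0..1} \<phi>"
    unfolding \<phi>_def using h by (intro continuous_intros continuous_on_compose2[OF cont]) auto
  have "closure (\<rat> \<inter> {0..1::real}) = {0..1}" by (rule closure_rationals_unit_interval)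
  then have "\<phi> q \<le> grid_modulus S n \<omega>"
  proof (intro continuous_le_on_closure[of "\<rat> \<inter> {0..1}" \<phi> q])
    fix x :: real assume x: "x \<in> \<rat> \<inter> {0..1}"
    show "\<phi> x \<le> grid_modulus S n \<omega>"
      unfolding grid_modulus_def \<phi>_def h_def
      using k x by (intro cSUP_upper2[OF bdd_above_grid_modulus, of "(k, x)"]) auto
  qed (use \<phi> q in auto)
  then show ?thesis using q by (simp add: \<phi>_def h_def)
qed

lemma grid_modulus_tendsto:
  assumes cont: "continuous_on {0..} (\<lambda>t. W t \<omega>)" and S: "0 < S"
  shows "(\<lambda>n. grid_modulus S n \<omega>) \<longlonglongrightarrow> 0"
proof (rule LIMSEQ_I)
  fix e :: real assume e: "0 < e"
  have "uniformly_continuous_on {0..S} (\<lambda>t. W t \<omega>)"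
    by (intro compact_uniformly_continuous continuous_on_subset[OF cont]) auto
  then obtain d where d: "0 < d"
    and uc: "\<And>x x'. x \<in> {0..S} \<Longrightarrow> x' \<in> {0..S} \<Longrightarrow> dist x' x < d \<Longrightarrow> dist (W x' \<omega>) (W x \<omega>) < e / 2"
    using e unfolding uniformly_continuous_on_def by (meson half_gt_zero)
  obtain N :: nat where N: "S / d < N" using reals_Archimedean2 by blast
  show "\<exists>N. \<forall>n\<ge>N. norm (grid_modulus S n \<omega> - 0) < e"
  proof (intro exI allI impI)
    fix n assume "N \<le> n"
    have "0 < S / d" using S d by simp
    then have n0: "0 < n" "S / d < n" using \<open>N \<le> n\<close> N
      by (metis less_le_trans of_nat_0_less_iff of_nat_le_iff order.strict_trans, metis less_le_trans of_nat_le_iff)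
    define h where "h = S / n"
    have h: "0 < h" "h < d" "n * h = S" using n0 S d by (auto simp: h_def field_simps)
    have "grid_modulus S n \<omega> \<le> e / 2"
      unfolding grid_modulus_def
    proof (rule cSUP_least)
      show "{..<n} \<times> (\<rat> \<inter> {0..1::real}) \<noteq> {}" using n0 by (auto intro!: exI[of _ 0])
      fix x :: "nat \<times> real" assume "x \<in> {..<n} \<times> (\<rat> \<inter> {0..1})"
      then obtain k q where x: "x = (k, q)" "k < n" "0 \<le> q" "q \<le> 1" by auto
      have 1: "(real k + q) * h \<le> n * h" using x h by (intro mult_right_mono) auto
      have 2: "q * h \<le> h" "0 \<le> q * h" using x h by auto
      have "dist (W ((real k + q) * h) \<omega>) (W (k * h) \<omega>) < e / 2"
        using 1 2 h x le_less_trans[OF 2(1) h(2)] by (intro uc) (auto simp: dist_norm algebra_simps)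
      then show "(case x of (k, q) \<Rightarrow> min 1 \<bar>W ((real k + q) * (S / n)) \<omega> - W (k * (S / n)) \<omega>\<bar>) \<le> e / 2"
        unfolding x prod.case h_def dist_norm real_norm_def by linarith
    qed
    then show "norm (grid_modulus S n \<omega> - 0) < e" using e grid_modulus_bounds[OF n0(1), of S \<omega>] by simp
  qed
qed

lemma expectation_grid_modulus_tendsto:
  assumes S: "0 < S"
  shows "(\<lambda>n. expectation (grid_modulus S n)) \<longlonglongrightarrow> 0"
proof -
  have "(\<lambda>n. expectation (grid_modulus S (Suc n))) \<longlonglongrightarrow> expectation (\<lambda>_. 0)"
  proof (rule integral_dominated_convergence[where w = "\<lambda>_. 1"])
    show "AE \<omega> in M. (\<lambda>n. grid_modulus S (Suc n) \<omega>) \<longlonglongrightarrow> 0"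
      using W_continuous by eventually_elim (rule LIMSEQ_Suc[OF grid_modulus_tendsto[OF _ S]])
    show "AE \<omega> in M. norm (grid_modulus S (Suc n) \<omega>) \<le> 1" for n
      using grid_modulus_bounds[of "Suc n" S] by simp
  qed (use grid_modulus_measurable[OF S] in auto)
  then show ?thesis by (simp add: filterlim_sequentially_Suc[of "\<lambda>n. expectation (grid_modulus S n)"])
qed

end

section \<open>The Feynman-Kac inequality on a box\<close>

text \<open>A measurable version of the integral of \<open>V (Y\<^sub>s)\<close>: it agrees with the integral on continuous
  paths only, and \<open>M\<close> need not be complete.\<close>

definition grid_weight :: "(real \<Rightarrow> real) \<Rightarrow> real \<Rightarrow> (real \<Rightarrow> 'a \<Rightarrow> real) \<Rightarrow> 'a \<Rightarrow> real" where
  "grid_weight V S Y \<omega> = lim (\<lambda>n. \<Sum>j<n. S / n * V (Y (real j * (S / n)) \<omega>))"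

lemma (in brownian_motion) solves_sde_paths:
  assumes sol: "solves_sde M F W b \<sigma> y0 Y"
  shows "AE \<omega> in M. continuous_on {0..} (\<lambda>t. Y t \<omega>) \<and> continuous_on {0..} (\<lambda>t. W t \<omega>) \<and> Y 0 \<omega> = y0 \<and>
    (\<forall>s\<ge>0. Y s \<omega> = y0 + integral {0..s} (\<lambda>r. b (Y r \<omega>)) + \<sigma> * W s \<omega>)"
proof -
  have c: "AE \<omega> in M. continuous_on {0..} (\<lambda>t. Y t \<omega>)"
    and e: "AE \<omega> in M. \<forall>t\<ge>0. set_integrable lborel {0..t} (\<lambda>s. b (Y s \<omega>)) \<and>
      Y t \<omega> = y0 + (LBINT s:{0..t}. b (Y s \<omega>)) + \<sigma> * W t \<omega>"
    using sol by (auto simp: solves_sde_def)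
  show ?thesis using c e W_continuous W_zero
  proof eventually_elim
    case (elim \<omega>)
    then have eq: "\<forall>s\<ge>0. Y s \<omega> = y0 + integral {0..s} (\<lambda>r. b (Y r \<omega>)) + \<sigma> * W s \<omega>"
      using set_borel_integral_eq_integral(2) by metis
    moreover from eq have "Y 0 \<omega> = y0" using elim(4) by simp
    ultimately show ?case using elim by auto
  qed
qed

lemma (in brownian_motion) grid_weight_measurable:
  assumes Y: "\<And>t. 0 \<le> t \<Longrightarrow> Y t \<in> borel_measurable M" and V: "V \<in> borel_measurable borel" and S: "0 < S"
  shows "grid_weight V S Y \<in> borel_measurable M"
proof -
  have "(\<lambda>\<omega>. V (Y (real j * (S / n)) \<omega>)) \<in> borel_measurable M" for j n :: nat
    using S by (intro measurable_compose[OF Y V]) auto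
  then show ?thesis
    unfolding grid_weight_def by (intro borel_measurable_lim_metric borel_measurable_sum borel_measurable_times) auto
qed

lemma grid_weight_eq:
  assumes c: "continuous_on {0..} (\<lambda>t. Y t \<omega>)" and V: "continuous_on UNIV V" and S: "0 < S"
  shows "(\<lambda>n. \<Sum>j<n. S / n * V (Y (real j * (S / n)) \<omega>)) \<longlonglongrightarrow> (LBINT s:{0..S}. V (Y s \<omega>))"
    and "grid_weight V S Y \<omega> = (LBINT s:{0..S}. V (Y s \<omega>))"
    and "grid_weight V S Y \<omega> = integral {0..S} (\<lambda>s. V (Y s \<omega>))"
proof -
  have cV: "continuous_on {0..S} (\<lambda>t. V (Y t \<omega>))"
    by (intro continuous_on_compose2[OF V] continuous_on_subset[OF c]) auto
  have 0: "(LBINT s:{0..S}. V (Y s \<omega>)) = integral {0..S} (\<lambda>t. V (Y t \<omega>))"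
    by (intro set_borel_integral_eq_integral(2) borel_integrable_atLeastAtMost' cV)
  with riemann_sum_tendsto[OF cV S] show 1: "(\<lambda>n. \<Sum>j<n. S / n * V (Y (real j * (S / n)) \<omega>)) \<longlonglongrightarrow> (LBINT s:{0..S}. V (Y s \<omega>))"
    by simp
  show 2: "grid_weight V S Y \<omega> = (LBINT s:{0..S}. V (Y s \<omega>))"
    unfolding grid_weight_def by (rule limI[OF 1])
  show "grid_weight V S Y \<omega> = integral {0..S} (\<lambda>s. V (Y s \<omega>))"
    using 0 2 by simp
qed

text \<open>The times are the rational fractions of \<open>t\<close>: countably many, which makes
  the event measurable, and including \<open>t\<close> itself and all points of an equidistant grid
  on [0, t], so that grid values are bounded even on paths without continuity.\<close>

definition confined :: "'a measure \<Rightarrow> (real \<Rightarrow> 'a \<Rightarrow> real) \<Rightarrow> real \<Rightarrow> real \<Rightarrow> 'a set" where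
  "confined M Y R t = {\<omega> \<in> space M. \<forall>q\<in>\<rat> \<inter> {0..1}. \<bar>Y (q * t) \<omega>\<bar> \<le> R}"

lemma confined_iff:
  assumes c: "continuous_on {0..} (\<lambda>t. Y t \<omega>)" and \<omega>: "\<omega> \<in> space M" and t: "0 \<le> t"
  shows "\<omega> \<in> confined M Y R t \<longleftrightarrow> (\<forall>s\<in>{0..t}. \<bar>Y s \<omega>\<bar> \<le> R)"
proof
  assume stay: "\<omega> \<in> confined M Y R t"
  have c1: "continuous_on {0..1} (\<lambda>q. \<bar>Y (q * t) \<omega>\<bar>)"
    using t by (intro continuous_intros continuous_on_compose2[OF c]) auto
  have le: "\<bar>Y (q * t) \<omega>\<bar> \<le> R" if q: "q \<in> {0..1}" for q
    using continuous_le_on_closure[of "\<rat> \<inter> {0..1}" "\<lambda>q. \<bar>Y (q * t) \<omega>\<bar>" q R] c1 q stay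
    by (auto simp: closure_rationals_unit_interval confined_def)
  show "\<forall>s\<in>{0..t}. \<bar>Y s \<omega>\<bar> \<le> R"
  proof
    fix s assume s: "s \<in> {0..t}"
    show "\<bar>Y s \<omega>\<bar> \<le> R"
    proof (cases "t = 0")
      case True
      then show ?thesis using le[of 0] s by simp
    next
      case False
      then show ?thesis using le[of "s / t"] s by (simp add: divide_le_eq_1)
    qed
  qed
next
  assume "\<forall>s\<in>{0..t}. \<bar>Y s \<omega>\<bar> \<le> R"
  moreover have "q * t \<in> {0..t}" if "q \<in> {0..1}" for q
    using that t mult_right_mono[of q 1 t] by auto
  ultimately show "\<omega> \<in> confined M Y R t" using \<omega> by (auto simp: confined_def)
qed

lemma (in brownian_motion) confined_sets:
  assumes Y_adapted: "\<And>t. 0 \<le> t \<Longrightarrow> Y t \<in> borel_measurable (F t)" and t: "0 \<le> t"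
  shows "confined M Y R t \<in> sets (F t)"
proof -
  have "confined M Y R t = (\<Inter>q\<in>\<rat> \<inter> {0..1}. {\<omega> \<in> space (F t). \<bar>Y (q * t) \<omega>\<bar> \<le> R})"
    unfolding confined_def space_F by (auto intro!: bexI[of _ 0])
  also have "\<dots> \<in> sets (F t)"
  proof (rule sets.countable_INT')
    show "countable (\<rat> \<inter> {0..1::real})" using countable_rat by auto
    show "\<rat> \<inter> {0..1::real} \<noteq> {}" by (auto intro!: exI[of _ 0])
    have "{\<omega> \<in> space (F t). \<bar>Y (q * t) \<omega>\<bar> \<le> R} \<in> sets (F t)" if "q \<in> \<rat> \<inter> {0..1}" for q
    proof -
      have "q * t \<le> 1 * t" "0 \<le> q * t" using that t mult_right_mono[of q 1 t] by auto
      then have [measurable]: "Y (q * t) \<in> borel_measurable (F t)"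
        by (intro measurable_F_mono[OF _ Y_adapted]) auto
      show ?thesis by measurable
    qed
    then show "(\<lambda>q. {\<omega> \<in> space (F t). \<bar>Y (q * t) \<omega>\<bar> \<le> R}) ` (\<rat> \<inter> {0..1}) \<subseteq> sets (F t)" by auto
  qed
  finally show ?thesis .
qed

lemma (in brownian_motion) confined_events:
  assumes "\<And>t. 0 \<le> t \<Longrightarrow> Y t \<in> borel_measurable (F t)" and "0 \<le> t"
  shows "confined M Y R t \<in> events"
  using confined_sets[OF assms] F_subalgebra[OF assms(2)] by (auto simp: subalgebra_def)

section \<open>Summation over the grid and passage to the limit\<close>

locale sde_box = brownian_motion M F W + feynman_kac_box b V \<sigma> S R R' K m u ut uy uyy
  for M :: "'a measure" and F :: "real \<Rightarrow> 'a measure" and W :: "real \<Rightarrow> 'a \<Rightarrow> real"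
    and b V \<sigma> S R R' K m u ut uy uyy +
  fixes Y :: "real \<Rightarrow> 'a \<Rightarrow> real" and y0 :: real
  assumes sol: "solves_sde M F W b \<sigma> y0 Y" and y0: "\<bar>y0\<bar> \<le> R"
begin

lemma Y_adapted: "0 \<le> t \<Longrightarrow> Y t \<in> borel_measurable (F t)"
  using sol by (auto simp: solves_sde_def)

lemma Y_measurable: "0 \<le> t \<Longrightarrow> Y t \<in> borel_measurable M"
  by (rule measurable_F_M[OF _ Y_adapted])

abbreviation stay :: "real \<Rightarrow> 'a set" where
  "stay \<equiv> confined M Y R"

text \<open>A discrete Feynman-Kac weight killed on leaving the box. The left Riemann sum keeps it
  measurable with respect to the past and lets it grow by one known exponential factor per
  step.\<close>

definition weight :: "nat \<Rightarrow> nat \<Rightarrow> 'a \<Rightarrow> real" where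
  "weight n k \<omega> = indicator (stay (k * (S / n))) \<omega> * exp (\<Sum>j<k. S / n * V (Y (real j * (S / n)) \<omega>))"

lemma stay_sets: "0 \<le> t \<Longrightarrow> stay t \<in> sets (F t)"
  by (rule confined_sets[OF Y_adapted])

lemma stay_events: "0 \<le> t \<Longrightarrow> stay t \<in> events"
  by (rule confined_events[OF Y_adapted])

lemma stay_grid:
  fixes j k n :: nat
  assumes "\<omega> \<in> stay (k * (S / n))" "j \<le> k"
  shows "\<bar>Y (real j * (S / n)) \<omega>\<bar> \<le> R"
proof (cases "k = 0")
  case True
  then show ?thesis using assms by (auto simp: confined_def dest: bspec[of _ _ 0])
next
  case False
  then have "real j / k \<in> \<rat> \<inter> {0..1}" using assms by auto
  then have "\<bar>Y (real j / k * (k * (S / n))) \<omega>\<bar> \<le> R" using assms unfolding confined_def by blast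
  then show ?thesis using False by simp
qed

lemma weight_bounds:
  assumes "k \<le> n" "0 < n"
  shows "0 \<le> weight n k \<omega>" "weight n k \<omega> \<le> exp (K * S)"
proof -
  show "0 \<le> weight n k \<omega>" by (simp add: weight_def)
  show "weight n k \<omega> \<le> exp (K * S)"
  proof (cases "\<omega> \<in> stay (k * (S / n))")
    case True
    have h: "0 \<le> S / n" using S by simp
    have "(\<Sum>j<k. S / n * V (Y (real j * (S / n)) \<omega>)) \<le> (\<Sum>j<k. S / n * K)"
      using stay_grid[OF True] h by (intro sum_mono mult_left_mono V_bound) auto
    also have "\<dots> = k * (S / n) * K" by simp
    also have "\<dots> \<le> n * (S / n) * K" using assms h K by (intro mult_right_mono) auto
    finally show ?thesis using assms True by (simp add: weight_def mult.commute)
  qed (simp add: weight_def)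
qed

lemma V_measurable: "V \<in> borel_measurable borel"
  using V_cont by (rule borel_measurable_continuous_onI)

lemma weight_adapted: "weight n k \<in> borel_measurable (F (k * (S / n)))"
proof -
  have "(\<lambda>\<omega>. V (Y (real j * (S / n)) \<omega>)) \<in> borel_measurable (F (k * (S / n)))" if "j < k" for j
    using that S by (intro measurable_compose[OF measurable_F_mono[OF _ Y_adapted] V_measurable] mult_right_mono) auto
  moreover have "stay (k * (S / n)) \<in> sets (F (k * (S / n)))" using S by (intro stay_sets) auto
  ultimately show ?thesis
    unfolding weight_def
    by (intro borel_measurable_times borel_measurable_indicator borel_measurable_exp borel_measurable_sum) auto
qed

text \<open>The indicator inside \<open>weight\<close> vanishes off the box, so a bound for
  \<open>f\<close> on the box alone turns into boundedness and integrability of the whole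
  product.\<close>

lemma weighted_bounded:
  assumes n: "0 < n" "k \<le> n" and f: "f \<in> borel_measurable borel"
    and bound: "\<And>x. \<bar>x\<bar> \<le> R \<Longrightarrow> \<bar>f x\<bar> \<le> B" and B: "0 \<le> B"
  shows "(\<lambda>\<omega>. weight n k \<omega> * f (Y (k * (S / n)) \<omega>)) \<in> borel_measurable (F (k * (S / n)))"
    and "\<bar>weight n k \<omega> * f (Y (k * (S / n)) \<omega>)\<bar> \<le> exp (K * S) * B"
    and "integrable M (\<lambda>\<omega>. weight n k \<omega> * f (Y (k * (S / n)) \<omega>))"
proof -
  have t: "0 \<le> k * (S / n)" using S by auto
  show meas: "(\<lambda>\<omega>. weight n k \<omega> * f (Y (k * (S / n)) \<omega>)) \<in> borel_measurable (F (k * (S / n)))"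
    using weight_adapted by (intro borel_measurable_times measurable_compose[OF Y_adapted f] t)
  show le: "\<bar>weight n k \<omega> * f (Y (k * (S / n)) \<omega>)\<bar> \<le> exp (K * S) * B" for \<omega>
  proof (cases "\<omega> \<in> stay (k * (S / n))")
    case True
    then show ?thesis
      unfolding abs_mult using weight_bounds[OF n(2,1), of \<omega>] bound[OF stay_grid[OF True order_refl]] B
      by (intro mult_mono) auto
  qed (use B in \<open>simp add: weight_def\<close>)
  then show "integrable M (\<lambda>\<omega>. weight n k \<omega> * f (Y (k * (S / n)) \<omega>))"
    using measurable_F_M[OF t meas] by (intro integrable_const_bound[of _ "exp (K * S) * B"]) auto
qed

text \<open>The weight is known at the start of the step, so the linear and the compensated
  quadratic noise term drop out in expectation. The factor 3 is 1 plus the 2 from the third absolute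
  moment of the increment; the last term charges the modulus to the paths that leave in this very
  step.\<close>

lemma expectation_step:
  "\<exists>C\<ge>0. \<exists>h0>0. \<forall>n>0. \<forall>k<n. S / n \<le> h0 \<longrightarrow>
    expectation (\<lambda>\<omega>. weight n k \<omega> * u (k * (S / n)) (Y (k * (S / n)) \<omega>))
      \<le> expectation (\<lambda>\<omega>. weight n (Suc k) \<omega> * u (Suc k * (S / n)) (Y (Suc k * (S / n)) \<omega>))
        + C * (3 * (S / n * sqrt (S / n)) + S / n * expectation (grid_modulus S n)
            + expectation (\<lambda>\<omega>. (indicator (stay (k * (S / n))) \<omega> - indicator (stay (Suc k * (S / n))) \<omega>) * grid_modulus S n \<omega>))"
proof -
  obtain C h0 where C: "0 \<le> C" and h0: "0 < h0" and step: "\<forall>h t D y y0 w. 0 < h \<longrightarrow> h \<le> h0 \<longrightarrow> 0 \<le> t \<longrightarrow> t + h \<le> S \<longrightarrow> 0 \<le> D \<longrightarrow> D \<le> 1 \<longrightarrow>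
    continuous_on {0..} y \<longrightarrow>
    (\<forall>s\<ge>0. y s = y0 + integral {0..s} (\<lambda>r. b (y r)) + \<sigma> * w s) \<longrightarrow>
    (\<forall>s\<in>{t..t + h}. min 1 \<bar>w s - w t\<bar> \<le> D) \<longrightarrow> \<bar>y t\<bar> \<le> R \<longrightarrow>
    u t (y t) + \<sigma> * (w (t + h) - w t) * uy t (y t)
        + \<sigma>\<^sup>2 / 2 * uyy t (y t) * ((w (t + h) - w t)\<^sup>2 - h)
      \<le> (if \<forall>s\<in>{t..t + h}. \<bar>y s\<bar> \<le> R then exp (h * V (y t)) * u (t + h) (y (t + h)) else C * D)
        + C * (h * sqrt h + \<bar>w (t + h) - w t\<bar> ^ 3 + h * D)"
    using path_step by blast
  define CE where "CE = exp (K * S) * C"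
  have CE: "0 \<le> CE" using C by (simp add: CE_def)
  show ?thesis
  proof (rule exI[of _ CE], intro conjI CE, rule exI[of _ h0], intro conjI allI impI h0)
    fix n k :: nat assume n: "0 < n" "k < n" and hn: "S / n \<le> h0"
    define h where "h = S / n"
    define t where "t = k * h"
    have h: "0 < h" "h \<le> h0" using S n hn by (auto simp: h_def)
    have t: "0 \<le> t" "Suc k * h = t + h" using h by (auto simp: t_def algebra_simps)
    have tS: "t + h \<le> S"
    proof -
      have "Suc k * h \<le> n * h" using n h by (intro mult_right_mono) auto
      then show ?thesis using n t by (simp add: h_def)
    qed
    have kn: "k \<le> n" "Suc k \<le> n" using n by auto
    define q where "q \<omega> = W (t + h) \<omega> - W t \<omega>" for \<omega>
    define D where "D = grid_modulus S n"
    define I where "I \<omega> = indicator (stay t) \<omega> - (indicator (stay (t + h)) \<omega> :: real)" for \<omega>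
    \<comment> \<open>Weight and coefficient form one factor from the past in each noise term, the
      shape in which \<open>expectation_mult_increment\<close> applies.\<close>
    define LHS where "LHS \<omega> = weight n k \<omega> * u t (Y t \<omega>) + weight n k \<omega> * (\<sigma> * uy t (Y t \<omega>)) * q \<omega>
      + weight n k \<omega> * (\<sigma>\<^sup>2 / 2 * uyy t (Y t \<omega>)) * ((q \<omega>)\<^sup>2 - h)" for \<omega>
    define RHS where "RHS \<omega> = weight n (Suc k) \<omega> * u (t + h) (Y (t + h) \<omega>)
      + CE * (h * sqrt h + \<bar>q \<omega>\<bar> ^ 3 + h * D \<omega> + I \<omega> * D \<omega>)" for \<omega>
    have D: "0 \<le> D \<omega>" "D \<omega> \<le> 1" for \<omega>
      using grid_modulus_bounds[OF n(1), of S \<omega>] by (auto simp: D_def)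
    have pointwise: "AE \<omega> in M. LHS \<omega> \<le> RHS \<omega>"
      using solves_sde_paths[OF sol] AE_space
    proof eventually_elim
      case (elim \<omega>)
      then have c: "continuous_on {0..} (\<lambda>t. Y t \<omega>)" and cW: "continuous_on {0..} (\<lambda>t. W t \<omega>)"
        and eq: "\<forall>s\<ge>0. Y s \<omega> = y0 + integral {0..s} (\<lambda>r. b (Y r \<omega>)) + \<sigma> * W s \<omega>" and \<omega>: "\<omega> \<in> space M"
        by auto
      \<comment> \<open>On a continuous path confinement up to \<open>t + h\<close> implies
        confinement up to \<open>t\<close>, so \<open>I\<close> is the indicator of leaving during
        this step.\<close>
      have sub: "\<omega> \<in> stay (t + h) \<longleftrightarrow> \<omega> \<in> stay t \<and> (\<forall>s\<in>{t..t + h}. \<bar>Y s \<omega>\<bar> \<le> R)"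
        using t h by (auto simp: confined_iff[where Y = Y and \<omega> = \<omega> and M = M, OF c \<omega>])
      have g: "0 \<le> h * sqrt h + \<bar>q \<omega>\<bar> ^ 3 + h * D \<omega>"
        using h D[of \<omega>] by (intro add_nonneg_nonneg) auto
      show "LHS \<omega> \<le> RHS \<omega>"
      proof (cases "\<omega> \<in> stay t")
        case False
        then have "weight n k \<omega> = 0" "weight n (Suc k) \<omega> = 0" "I \<omega> = 0"
          using sub by (auto simp: weight_def I_def t t_def h_def[symmetric] simp del: of_nat_Suc)
        then show ?thesis using g CE by (simp add: LHS_def RHS_def)
      next
        case True
        define E where "E = exp (\<Sum>j<k. h * V (Y (real j * h) \<omega>))"
        have wk: "weight n k \<omega> = E" using True by (simp add: weight_def E_def t_def h_def)
        have E: "0 \<le> E" "E \<le> exp (K * S)" using weight_bounds[OF kn(1) n(1), of \<omega>] wk by auto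
        have Yt: "\<bar>Y t \<omega>\<bar> \<le> R" using True t by (auto simp: confined_iff[where Y = Y and \<omega> = \<omega> and M = M, OF c \<omega>])
        have "u t (Y t \<omega>) + \<sigma> * q \<omega> * uy t (Y t \<omega>) + \<sigma>\<^sup>2 / 2 * uyy t (Y t \<omega>) * ((q \<omega>)\<^sup>2 - h)
          \<le> (if \<forall>s\<in>{t..t + h}. \<bar>Y s \<omega>\<bar> \<le> R then exp (h * V (Y t \<omega>)) * u (t + h) (Y (t + h) \<omega>) else C * D \<omega>)
            + C * (h * sqrt h + \<bar>q \<omega>\<bar> ^ 3 + h * D \<omega>)"
          unfolding q_def
        proof (rule step[rule_format])
          show "min 1 \<bar>W s \<omega> - W t \<omega>\<bar> \<le> D \<omega>" if "s \<in> {t..t + h}" for s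
            using grid_modulus_upper[OF cW S n(2), of s] that by (simp add: D_def t_def h_def)
        qed (use h t tS D c eq Yt in auto)
        then have "E * (u t (Y t \<omega>) + \<sigma> * q \<omega> * uy t (Y t \<omega>) + \<sigma>\<^sup>2 / 2 * uyy t (Y t \<omega>) * ((q \<omega>)\<^sup>2 - h))
          \<le> E * ((if \<forall>s\<in>{t..t + h}. \<bar>Y s \<omega>\<bar> \<le> R then exp (h * V (Y t \<omega>)) * u (t + h) (Y (t + h) \<omega>) else C * D \<omega>)
            + C * (h * sqrt h + \<bar>q \<omega>\<bar> ^ 3 + h * D \<omega>))"
          using E by (intro mult_left_mono)
        moreover have "E * (u t (Y t \<omega>) + \<sigma> * q \<omega> * uy t (Y t \<omega>) + \<sigma>\<^sup>2 / 2 * uyy t (Y t \<omega>) * ((q \<omega>)\<^sup>2 - h)) = LHS \<omega>"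
          unfolding LHS_def wk by (simp add: algebra_simps)
        moreover have "E * (C * (h * sqrt h + \<bar>q \<omega>\<bar> ^ 3 + h * D \<omega>)) \<le> CE * (h * sqrt h + \<bar>q \<omega>\<bar> ^ 3 + h * D \<omega>)"
          unfolding CE_def mult.assoc using E C g by (intro mult_right_mono) auto
        moreover have "E * (if \<forall>s\<in>{t..t + h}. \<bar>Y s \<omega>\<bar> \<le> R then exp (h * V (Y t \<omega>)) * u (t + h) (Y (t + h) \<omega>) else C * D \<omega>)
          \<le> weight n (Suc k) \<omega> * u (t + h) (Y (t + h) \<omega>) + CE * (I \<omega> * D \<omega>)"
        proof (cases "\<forall>s\<in>{t..t + h}. \<bar>Y s \<omega>\<bar> \<le> R")
          case stays: True
          then have st: "\<omega> \<in> stay (t + h)" using sub True by blast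
          then have "weight n (Suc k) \<omega> = E * exp (h * V (Y t \<omega>))"
            using t unfolding weight_def h_def[symmetric] t(2) by (simp add: E_def exp_add t_def)
          then show ?thesis using stays st True by (simp add: I_def)
        next
          case leaves: False
          then have st: "\<omega> \<notin> stay (t + h)" using sub by blast
          then have "weight n (Suc k) \<omega> = 0"
            unfolding weight_def h_def[symmetric] t(2) by simp
          moreover have "E * (C * D \<omega>) \<le> exp (K * S) * (C * D \<omega>)"
            using E C D[of \<omega>] by (intro mult_right_mono) auto
          ultimately show ?thesis unfolding if_not_P[OF leaves] using st True by (simp add: I_def CE_def mult.assoc)
        qed
        ultimately show ?thesis unfolding RHS_def distrib_left by linarith
      qed
    qed
    note mom = increment_moments[OF t(1), of "t + h", folded q_def]
    have t_less: "t < t + h" using h by simp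
    have tS': "t \<le> S" using tS h by simp
    have i1: "integrable M (\<lambda>\<omega>. weight n k \<omega> * u t (Y t \<omega>))"
      using weighted_bounded(3)[OF n(1) kn(1) u_measurable(1)[OF t(1) tS'], of K] u_bound[OF t(1) tS'] K
      by (simp add: t_def h_def)
    have f2: "(\<lambda>x. \<sigma> * uy t x) \<in> borel_measurable borel" "(\<lambda>x. \<sigma>\<^sup>2 / 2 * uyy t x) \<in> borel_measurable borel"
      using u_measurable(2,3)[OF t(1) tS'] by auto
    have b2: "\<bar>x\<bar> \<le> R \<Longrightarrow> \<bar>\<sigma> * uy t x\<bar> \<le> \<sigma> * K" "\<bar>x\<bar> \<le> R \<Longrightarrow> \<bar>\<sigma>\<^sup>2 / 2 * uyy t x\<bar> \<le> \<sigma>\<^sup>2 * K" for x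
    proof -
      assume x: "\<bar>x\<bar> \<le> R"
      show "\<bar>\<sigma> * uy t x\<bar> \<le> \<sigma> * K"
        using u_bound[OF t(1) tS' x] \<sigma> by (simp add: abs_mult)
      show "\<bar>\<sigma>\<^sup>2 / 2 * uyy t x\<bar> \<le> \<sigma>\<^sup>2 * K"
        unfolding abs_mult using u_bound[OF t(1) tS' x] by (intro mult_mono) auto
    qed
    have BK: "0 \<le> \<sigma> * K" "0 \<le> \<sigma>\<^sup>2 * K" using \<sigma> K by auto
    note w2 = weighted_bounded[OF n(1) kn(1) f2(1) b2(1) BK(1), folded h_def, folded t_def]
    note w3 = weighted_bounded[OF n(1) kn(1) f2(2) b2(2) BK(2), folded h_def, folded t_def]
    note e2 = expectation_mult_increment[OF t(1) t_less w2(1,3), of "\<lambda>x. x", folded q_def]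
    note e3 = expectation_mult_increment[OF t(1) t_less w3(1,3), of "\<lambda>x. x\<^sup>2 - h", folded q_def]
    have i2: "integrable M (\<lambda>\<omega>. weight n k \<omega> * (\<sigma> * uy t (Y t \<omega>)) * q \<omega>)"
      and z2: "expectation (\<lambda>\<omega>. weight n k \<omega> * (\<sigma> * uy t (Y t \<omega>)) * q \<omega>) = 0"
      using e2 mom(1,2) h by auto
    have i3: "integrable M (\<lambda>\<omega>. weight n k \<omega> * (\<sigma>\<^sup>2 / 2 * uyy t (Y t \<omega>)) * ((q \<omega>)\<^sup>2 - h))"
      and z3: "expectation (\<lambda>\<omega>. weight n k \<omega> * (\<sigma>\<^sup>2 / 2 * uyy t (Y t \<omega>)) * ((q \<omega>)\<^sup>2 - h)) = 0"
      using e3 mom(3,4) h by (auto simp: prob_space)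
    have intL: "integrable M LHS" unfolding LHS_def using i1 i2 i3 by auto
    have expL: "expectation LHS = expectation (\<lambda>\<omega>. weight n k \<omega> * u t (Y t \<omega>))"
      unfolding LHS_def using i1 i2 i3 z2 z3 by simp
    have j1: "integrable M (\<lambda>\<omega>. weight n (Suc k) \<omega> * u (t + h) (Y (t + h) \<omega>))"
      using weighted_bounded(3)[OF n(1) kn(2) u_measurable(1)[of "t + h"], of K] u_bound[of "t + h"] K t h tS
      unfolding h_def[symmetric] t(2) by simp
    have measD: "D \<in> borel_measurable M" unfolding D_def by (rule grid_modulus_measurable[OF S])
    have j2: "integrable M D"
      using measD D by (intro integrable_const_bound[of _ 1]) auto
    have ev: "stay t \<in> events" "stay (t + h) \<in> events" using t h by (auto intro!: stay_events)
    have j3: "integrable M (\<lambda>\<omega>. I \<omega> * D \<omega>)"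
    proof (rule integrable_const_bound[of _ 1])
      show "AE \<omega> in M. norm (I \<omega> * D \<omega>) \<le> 1"
        using D by (auto simp: I_def indicator_def)
      show "(\<lambda>\<omega>. I \<omega> * D \<omega>) \<in> borel_measurable M"
        unfolding I_def using ev measD by simp
    qed
    have expR: "expectation RHS = expectation (\<lambda>\<omega>. weight n (Suc k) \<omega> * u (t + h) (Y (t + h) \<omega>))
        + CE * (h * sqrt h + expectation (\<lambda>\<omega>. \<bar>q \<omega>\<bar> ^ 3) + h * expectation D + expectation (\<lambda>\<omega>. I \<omega> * D \<omega>))"
      and intR: "integrable M RHS"
      unfolding RHS_def using j1 j2 j3 mom(5) h by (auto simp: prob_space)
    have "expectation LHS \<le> expectation RHS"
      by (rule integral_mono_AE[OF intL intR pointwise])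
    also have "\<dots> \<le> expectation (\<lambda>\<omega>. weight n (Suc k) \<omega> * u (t + h) (Y (t + h) \<omega>))
        + CE * (3 * (h * sqrt h) + h * expectation D + expectation (\<lambda>\<omega>. I \<omega> * D \<omega>))"
      unfolding expR using mom(6) h CE by (intro add_left_mono mult_left_mono) auto
    finally show "expectation (\<lambda>\<omega>. weight n k \<omega> * u (k * (S / n)) (Y (k * (S / n)) \<omega>))
      \<le> expectation (\<lambda>\<omega>. weight n (Suc k) \<omega> * u (Suc k * (S / n)) (Y (Suc k * (S / n)) \<omega>))
        + CE * (3 * (S / n * sqrt (S / n)) + S / n * expectation (grid_modulus S n)
            + expectation (\<lambda>\<omega>. (indicator (stay (k * (S / n))) \<omega> - indicator (stay (Suc k * (S / n))) \<omega>) * grid_modulus S n \<omega>))"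
      unfolding expL h_def[symmetric] t(2) by (simp add: t_def I_def D_def)
  qed
qed

text \<open>Over \<open>n\<close> steps of length \<open>h\<close> the errors sum to 3 S sqrt h plus
  S times the expected modulus, and the exit charges telescope to \<open>P 0 - P n\<close>, at most
  one further expected modulus. This is the origin of the constant 3 S + S + 1.\<close>

lemma expectation_grid:
  "\<exists>C. eventually (\<lambda>n. u 0 y0 \<le> expectation (\<lambda>\<omega>. weight n n \<omega> * u S (Y S \<omega>))
      + C * (sqrt (S / n) + expectation (grid_modulus S n))) sequentially"
proof -
  obtain C h0 where C: "0 \<le> C" and h0: "0 < h0" and step: "\<And>n k. 0 < n \<Longrightarrow> k < n \<Longrightarrow> S / n \<le> h0 \<Longrightarrow>
    expectation (\<lambda>\<omega>. weight n k \<omega> * u (k * (S / n)) (Y (k * (S / n)) \<omega>))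
      \<le> expectation (\<lambda>\<omega>. weight n (Suc k) \<omega> * u (Suc k * (S / n)) (Y (Suc k * (S / n)) \<omega>))
        + C * (3 * (S / n * sqrt (S / n)) + S / n * expectation (grid_modulus S n)
            + expectation (\<lambda>\<omega>. (indicator (stay (k * (S / n))) \<omega> - indicator (stay (Suc k * (S / n))) \<omega>) * grid_modulus S n \<omega>))"
    using expectation_step by blast
  obtain N :: nat where N: "S / h0 < N" using reals_Archimedean2 by blast
  have "0 < S / h0" using S h0 by simp
  have "u 0 y0 \<le> expectation (\<lambda>\<omega>. weight n n \<omega> * u S (Y S \<omega>))
      + C * (3 * S + S + 1) * (sqrt (S / n) + expectation (grid_modulus S n))" if "N \<le> n" for n
  proof -
    have rn: "S / h0 < real n" using N that by linarith
    then have n0: "0 < real n" using \<open>0 < S / h0\<close> by linarith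
    then have n: "0 < n" by simp
    define h where "h = S / n"
    have h: "0 < h" "h \<le> h0" "n * h = S" using n0 rn S h0 by (auto simp: h_def field_simps)
    define D where "D = grid_modulus S n"
    have D: "0 \<le> D \<omega>" "D \<omega> \<le> 1" for \<omega> using grid_modulus_bounds[OF n, of S] by (auto simp: D_def)
    define G where "G k = expectation (\<lambda>\<omega>. weight n k \<omega> * u (k * h) (Y (k * h) \<omega>))" for k
    define P where "P k = expectation (\<lambda>\<omega>. indicator (stay (k * h)) \<omega> * D \<omega>)" for k
    have intP: "integrable M (\<lambda>\<omega>. indicator (stay (real k * h)) \<omega> * D \<omega>)" for k
      using D h stay_events[of "k * h"] grid_modulus_measurable[OF S]
      by (intro integrable_const_bound[of _ 1]) (auto simp: indicator_def D_def)
    have Pdiff: "expectation (\<lambda>\<omega>. (indicator (stay (real i * h)) \<omega> - indicator (stay (real j * h)) \<omega>) * D \<omega>) = P i - P j" for i j :: nat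
      unfolding P_def left_diff_distrib using intP by (intro Bochner_Integration.integral_diff)
    have "k \<le> n \<Longrightarrow> G 0 \<le> G k + C * (k * (3 * (h * sqrt h) + h * expectation D) + (P 0 - P k))" for k
    proof (induction k)
      case (Suc k)
      have "G k \<le> G (Suc k) + C * (3 * (h * sqrt h) + h * expectation D + (P k - P (Suc k)))"
        using step[OF n, of k] Suc.prems h(2) Pdiff[of k "Suc k"]
        unfolding G_def h_def[symmetric] D_def[symmetric] by simp
      moreover have "G 0 \<le> G k + C * (k * (3 * (h * sqrt h) + h * expectation D) + (P 0 - P k))"
        using Suc by simp
      ultimately show ?case by (simp add: algebra_simps)
    qed simp
    from this[of n] have G0n: "G 0 \<le> G n + C * (n * (3 * (h * sqrt h) + h * expectation D) + (P 0 - P n))"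
      by simp
    have "P 0 \<le> expectation D"
      unfolding P_def using intP[of 0] D grid_modulus_measurable[OF S, of n, folded D_def]
      by (intro integral_mono) (auto simp: indicator_def D_def[symmetric] intro!: integrable_const_bound[of _ 1])
    moreover have "0 \<le> P n" unfolding P_def using D by (intro integral_nonneg_AE) (auto simp: indicator_def)
    moreover have "n * (3 * (h * sqrt h) + h * expectation D) = 3 * S * sqrt h + S * expectation D"
    proof -
      have "n * (3 * (h * sqrt h) + h * expectation D) = 3 * (n * h) * sqrt h + (n * h) * expectation D"
        by (simp add: algebra_simps)
      then show ?thesis using h by simp
    qed
    moreover have ED: "0 \<le> expectation D" using D by (intro integral_nonneg_AE) auto
    moreover have "0 \<le> S * sqrt h" "0 \<le> S * expectation D" "0 \<le> sqrt h" using S h ED by auto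
    ultimately have "n * (3 * (h * sqrt h) + h * expectation D) + (P 0 - P n)
        \<le> (3 * S + S + 1) * (sqrt h + expectation D)"
      unfolding distrib_left distrib_right by linarith
    then have "C * (n * (3 * (h * sqrt h) + h * expectation D) + (P 0 - P n))
        \<le> C * ((3 * S + S + 1) * (sqrt h + expectation D))"
      using C by (rule mult_left_mono)
    moreover have "G 0 = u 0 y0"
    proof -
      have "AE \<omega> in M. weight n 0 \<omega> * u (real 0 * h) (Y (real 0 * h) \<omega>) = u 0 y0"
        using solves_sde_paths[OF sol] AE_space
      proof eventually_elim
        case (elim \<omega>)
        then show ?case using y0 by (simp add: weight_def confined_def)
      qed
      then have "G 0 = expectation (\<lambda>_. u 0 y0)"
        unfolding G_def using weighted_bounded(3)[OF n _ u_measurable(1)[of 0], of 0 K] S u_bound[of 0] K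
        by (intro integral_cong_AE) (auto intro: borel_measurable_integrable)
      then show ?thesis by (simp add: prob_space)
    qed
    moreover have "G n = expectation (\<lambda>\<omega>. weight n n \<omega> * u S (Y S \<omega>))"
      unfolding G_def h(3) ..
    ultimately show ?thesis using G0n unfolding h_def[symmetric] D_def[symmetric] by (simp add: mult.assoc)
  qed
  then show ?thesis by (intro exI[of _ "C * (3 * S + S + 1)"]) (auto simp: eventually_sequentially)
qed

text \<open>Dominated convergence in the grid inequality: on continuous paths the Riemann sums
  converge to the integral, the integrands are bounded by \<open>exp (K * S) * K\<close>, and the
  error term vanishes with the mesh.\<close>

theorem box_subsolution:
  "integrable M (\<lambda>\<omega>. indicator (stay S) \<omega> * exp (grid_weight V S Y \<omega>) * u S (Y S \<omega>))"
  "u 0 y0 \<le> expectation (\<lambda>\<omega>. indicator (stay S) \<omega> * exp (grid_weight V S Y \<omega>) * u S (Y S \<omega>))"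
proof -
  define f where "f \<omega> = indicator (stay S) \<omega> * exp (grid_weight V S Y \<omega>) * u S (Y S \<omega>)" for \<omega>
  have uS: "u S \<in> borel_measurable borel" using u_measurable(1)[of S] S by simp
  have w: "weight (Suc n) (Suc n) \<omega> = indicator (stay S) \<omega> * exp (\<Sum>j<Suc n. S / Suc n * V (Y (real j * (S / Suc n)) \<omega>))" for n \<omega>
    by (simp add: weight_def del: sum.lessThan_Suc of_nat_Suc)
  have bound: "\<bar>weight (Suc n) (Suc n) \<omega> * u S (Y S \<omega>)\<bar> \<le> exp (K * S) * K" for n \<omega>
    using weighted_bounded(2)[of "Suc n" "Suc n" "u S" K \<omega>] uS u_bound[of S] S K by (simp del: of_nat_Suc)
  have f_meas: "f \<in> borel_measurable M"
    unfolding f_def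
    using stay_events[of S] S measurable_compose[OF Y_measurable uS, of S] grid_weight_measurable[OF Y_measurable V_measurable S]
    by (intro borel_measurable_times borel_measurable_exp) auto
  have meas: "(\<lambda>\<omega>. weight (Suc n) (Suc n) \<omega> * u S (Y S \<omega>)) \<in> borel_measurable M" for n
    using weighted_bounded(3)[of "Suc n" "Suc n" "u S" K] uS u_bound[of S] S K
    by (simp del: of_nat_Suc add: borel_measurable_integrable)
  have conv: "AE \<omega> in M. (\<lambda>n. weight (Suc n) (Suc n) \<omega> * u S (Y S \<omega>)) \<longlonglongrightarrow> f \<omega>"
    using solves_sde_paths[OF sol]
  proof eventually_elim
    case (elim \<omega>)
    then have c: "continuous_on {0..} (\<lambda>t. Y t \<omega>)" by simp
    have "(\<lambda>n. \<Sum>j<n. S / n * V (Y (real j * (S / n)) \<omega>)) \<longlonglongrightarrow> grid_weight V S Y \<omega>"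
      using grid_weight_eq[where Y = Y and \<omega> = \<omega> and V = V, OF c V_cont S] by simp
    then show ?case
      unfolding w f_def by (intro tendsto_intros) (rule LIMSEQ_Suc)
  qed
  show "integrable M f"
    by (rule integrable_dominated_convergence[OF f_meas meas _ conv, where w = "\<lambda>_. exp (K * S) * K"])
      (use bound in auto)
  have "(\<lambda>n. expectation (\<lambda>\<omega>. weight (Suc n) (Suc n) \<omega> * u S (Y S \<omega>))) \<longlonglongrightarrow> expectation f"
    by (rule integral_dominated_convergence[OF f_meas meas _ conv, where w = "\<lambda>_. exp (K * S) * K"])
      (use bound in auto)
  then have lim: "(\<lambda>n. expectation (\<lambda>\<omega>. weight n n \<omega> * u S (Y S \<omega>))) \<longlonglongrightarrow> expectation f"
    by (simp add: filterlim_sequentially_Suc[of "\<lambda>n. expectation (\<lambda>\<omega>. weight n n \<omega> * u S (Y S \<omega>))"])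
  obtain C where ev: "eventually (\<lambda>n. u 0 y0 \<le> expectation (\<lambda>\<omega>. weight n n \<omega> * u S (Y S \<omega>))
      + C * (sqrt (S / n) + expectation (grid_modulus S n))) sequentially"
    using expectation_grid by blast
  have "(\<lambda>n. S / real n) \<longlonglongrightarrow> 0" by (rule lim_const_over_n)
  then have "(\<lambda>n. sqrt (S / real n)) \<longlonglongrightarrow> sqrt 0" by (rule tendsto_real_sqrt)
  then have "(\<lambda>n. expectation (\<lambda>\<omega>. weight n n \<omega> * u S (Y S \<omega>))
      + C * (sqrt (S / real n) + expectation (grid_modulus S n))) \<longlonglongrightarrow> expectation f + C * (sqrt 0 + 0)"
    by (intro tendsto_intros lim expectation_grid_modulus_tendsto S)
  then show "u 0 y0 \<le> expectation f"
    using tendsto_lowerbound[OF _ ev] by simp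
qed

end

section \<open>Explicit solutions of the backward equation\<close>

text \<open>Products p exp q with fixed q are closed under differentiation. Hence all derivatives of
  the explicit solutions can be recorded through their prefactors.\<close>

lemma DERIV_mult_exp:
  fixes p q :: "real \<Rightarrow> real"
  assumes "(p has_real_derivative p') (at x)" "(q has_real_derivative q') (at x)"
  shows "((\<lambda>x. p x * exp (q x)) has_real_derivative (p' + p x * q') * exp (q x)) (at x)"
  using assms by (auto intro!: derivative_eq_intros simp: algebra_simps)

lemma bounded_on_rectangle:
  fixes f :: "real \<Rightarrow> real \<Rightarrow> real"
  assumes "continuous_on ({0..S} \<times> {-R..R}) (\<lambda>p. f (fst p) (snd p))"
  obtains B where "0 \<le> B" "\<And>t y. 0 \<le> t \<Longrightarrow> t \<le> S \<Longrightarrow> \<bar>y\<bar> \<le> R \<Longrightarrow> \<bar>f t y\<bar> \<le> B"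
proof -
  have "compact ((\<lambda>p. f (fst p) (snd p)) ` ({0..S} \<times> {-R..R}))"
    by (intro compact_continuous_image assms compact_Times) auto
  then have "bounded ((\<lambda>p. f (fst p) (snd p)) ` ({0..S} \<times> {-R..R}))" by (rule compact_imp_bounded)
  then obtain B where "\<forall>x\<in>(\<lambda>p. f (fst p) (snd p)) ` ({0..S} \<times> {-R..R}). norm x \<le> B"
    unfolding bounded_iff by blast
  then have B: "\<bar>f (fst p) (snd p)\<bar> \<le> B" if "p \<in> {0..S} \<times> {-R..R}" for p
    using that by auto
  have "\<bar>f t y\<bar> \<le> max 0 B" if "0 \<le> t" "t \<le> S" "\<bar>y\<bar> \<le> R" for t y
  proof -
    have "\<bar>f t y\<bar> \<le> B" using B[of "(t, y)"] that by (simp add: abs_le_iff)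
    then show ?thesis by simp
  qed
  then show ?thesis using that[of "max 0 B"] by auto
qed

text \<open>Writing \<open>u = (\<alpha> + \<beta> y\<^sup>2) exp (G + a y\<^sup>2 + d)\<close> with \<open>G' = - b / \<sigma>\<^sup>2\<close> removes the drift: the
  backward equation with potential \<open>b\<^sup>2 / (2 \<sigma>\<^sup>2)\<close> turns into one without drift and with potential
  \<open>- b' / 2\<close>, which is quadratic in \<open>y\<close>. This leaves a Riccati system for the coefficients.\<close>

locale riccati =
  fixes \<kappa> c \<sigma> S :: real and a \<alpha> \<beta> d :: "real \<Rightarrow> real"
  assumes \<sigma>: "0 < \<sigma>" and S: "0 < S"
    and a: "\<And>t. 0 \<le> t \<Longrightarrow> t \<le> S \<Longrightarrow> (a has_real_derivative (- 2 * \<sigma>\<^sup>2 * (a t)\<^sup>2 - 3 * c / 2)) (at t)"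
    and \<alpha>: "\<And>t. 0 \<le> t \<Longrightarrow> t \<le> S \<Longrightarrow> (\<alpha> has_real_derivative (- \<sigma>\<^sup>2 * \<beta> t)) (at t)"
    and \<beta>: "\<And>t. 0 \<le> t \<Longrightarrow> t \<le> S \<Longrightarrow> (\<beta> has_real_derivative (- 4 * \<sigma>\<^sup>2 * a t * \<beta> t)) (at t)"
    and d: "\<And>t. 0 \<le> t \<Longrightarrow> t \<le> S \<Longrightarrow> (d has_real_derivative (- \<sigma>\<^sup>2 * a t - \<kappa> / 2)) (at t)"
begin

definition "G y = (\<kappa> * y\<^sup>2 / 2 + c * y ^ 4 / 4) / \<sigma>\<^sup>2" for y
definition "P t y = \<alpha> t + \<beta> t * y\<^sup>2" for t y
definition "Q t y = G y + a t * y\<^sup>2 + d t" for t y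

text \<open>These right-hand sides of the Riccati system are functions of their own because the
  second time derivative of \<open>u\<close> differentiates them once more.\<close>

definition "a' t = - 2 * \<sigma>\<^sup>2 * (a t)\<^sup>2 - 3 * c / 2" for t
definition "\<beta>' t = - 4 * \<sigma>\<^sup>2 * a t * \<beta> t" for t
definition "Py t y = 2 * \<beta> t * y" for t y
definition "Qy t y = (\<kappa> * y + c * y ^ 3) / \<sigma>\<^sup>2 + 2 * a t * y" for t y
definition "Qyy t y = (\<kappa> + 3 * c * y\<^sup>2) / \<sigma>\<^sup>2 + 2 * a t" for t y
definition "Pt t y = - \<sigma>\<^sup>2 * \<beta> t + \<beta>' t * y\<^sup>2" for t y
definition "Qt t y = a' t * y\<^sup>2 + (- \<sigma>\<^sup>2 * a t - \<kappa> / 2)" for t y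
text \<open>\<open>P1\<close>, \<open>P2\<close> and \<open>T1\<close> are the prefactors of
  \<open>exp Q\<close> in \<open>uy\<close>, \<open>uyy\<close> and \<open>ut\<close>; each appended
  \<open>y\<close> or \<open>t\<close> marks a further derivative in that variable.\<close>

definition "P1 t y = Py t y + P t y * Qy t y" for t y
definition "P1y t y = 2 * \<beta> t + (Py t y * Qy t y + P t y * Qyy t y)" for t y
definition "P2 t y = P1y t y + P1 t y * Qy t y" for t y
definition "P1yy t y = (2 * \<beta> t * Qy t y + Py t y * Qyy t y) + (Py t y * Qyy t y + P t y * (6 * c * y / \<sigma>\<^sup>2))" for t y
definition "P2y t y = P1yy t y + (P1y t y * Qy t y + P1 t y * Qyy t y)" for t y
definition "T1 t y = Pt t y + P t y * Qt t y" for t y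
definition "T1y t y = 2 * \<beta>' t * y + (Py t y * Qt t y + P t y * (2 * a' t * y))" for t y
definition "T1t t y = (- \<sigma>\<^sup>2 * \<beta>' t + (- 4 * \<sigma>\<^sup>2 * (a' t * \<beta> t + a t * \<beta>' t)) * y\<^sup>2)
  + (Pt t y * Qt t y + P t y * ((- 4 * \<sigma>\<^sup>2 * a t * a' t) * y\<^sup>2 + (- \<sigma>\<^sup>2 * a' t)))" for t y

definition "u t y = P t y * exp (Q t y)" for t y
definition "uy t y = P1 t y * exp (Q t y)" for t y
definition "uyy t y = P2 t y * exp (Q t y)" for t y
definition "uyyy t y = (P2y t y + P2 t y * Qy t y) * exp (Q t y)" for t y
definition "ut t y = T1 t y * exp (Q t y)" for t y
definition "uty t y = (T1y t y + T1 t y * Qy t y) * exp (Q t y)" for t y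
definition "utt t y = (T1t t y + T1 t y * Qt t y) * exp (Q t y)" for t y

section \<open>Derivatives, backward equation and bounds for the ansatz\<close>

lemma y_derivatives:
  "(P t has_real_derivative Py t y) (at y)" "(Py t has_real_derivative 2 * \<beta> t) (at y)"
  "(Q t has_real_derivative Qy t y) (at y)" "(Qy t has_real_derivative Qyy t y) (at y)"
  "(Qyy t has_real_derivative 6 * c * y / \<sigma>\<^sup>2) (at y)"
  "(Pt t has_real_derivative 2 * \<beta>' t * y) (at y)" "(Qt t has_real_derivative 2 * a' t * y) (at y)"
proof -
  show "(P t has_real_derivative Py t y) (at y)"
    unfolding P_def[abs_def] Py_def by (auto intro!: derivative_eq_intros)
  show "(Py t has_real_derivative 2 * \<beta> t) (at y)"
    unfolding Py_def[abs_def] by (auto intro!: derivative_eq_intros)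
  have "((\<lambda>y. \<kappa> * y\<^sup>2 / 2 + c * y ^ 4 / 4) has_real_derivative \<kappa> * y + c * y ^ 3) (at y)"
    by (auto intro!: derivative_eq_intros)
  from DERIV_cdivide[OF this, of "\<sigma>\<^sup>2"] show "(Q t has_real_derivative Qy t y) (at y)"
    unfolding Q_def[abs_def] Qy_def G_def by (rule DERIV_add[OF DERIV_add, THEN DERIV_cong]) (auto intro!: derivative_eq_intros)
  have "((\<lambda>y. \<kappa> * y + c * y ^ 3) has_real_derivative \<kappa> + 3 * c * y\<^sup>2) (at y)"
    by (auto intro!: derivative_eq_intros)
  from DERIV_cdivide[OF this, of "\<sigma>\<^sup>2"] show "(Qy t has_real_derivative Qyy t y) (at y)"
    unfolding Qy_def[abs_def] Qyy_def by (rule DERIV_add) (auto intro!: derivative_eq_intros)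
  have "((\<lambda>y. \<kappa> + 3 * c * y\<^sup>2) has_real_derivative 6 * c * y) (at y)"
    by (auto intro!: derivative_eq_intros)
  from DERIV_cdivide[OF this, of "\<sigma>\<^sup>2"] show "(Qyy t has_real_derivative 6 * c * y / \<sigma>\<^sup>2) (at y)"
    unfolding Qyy_def[abs_def] by (rule DERIV_add[THEN DERIV_cong]) (auto intro!: derivative_eq_intros)
  show "(Pt t has_real_derivative 2 * \<beta>' t * y) (at y)"
    unfolding Pt_def[abs_def] by (auto intro!: derivative_eq_intros)
  show "(Qt t has_real_derivative 2 * a' t * y) (at y)"
    unfolding Qt_def[abs_def] by (auto intro!: derivative_eq_intros)
qed

lemma t_derivatives:
  assumes "0 \<le> t" "t \<le> S"
  shows "(a has_real_derivative a' t) (at t)" "(\<beta> has_real_derivative \<beta>' t) (at t)"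
    "((\<lambda>t. P t y) has_real_derivative Pt t y) (at t)"
    "((\<lambda>t. Q t y) has_real_derivative Qt t y) (at t)"
    "(a' has_real_derivative - 4 * \<sigma>\<^sup>2 * a t * a' t) (at t)"
    "(\<beta>' has_real_derivative - 4 * \<sigma>\<^sup>2 * (a' t * \<beta> t + a t * \<beta>' t)) (at t)"
proof -
  show a1: "(a has_real_derivative a' t) (at t)" using a[OF assms] by (simp add: a'_def)
  show b1: "(\<beta> has_real_derivative \<beta>' t) (at t)" using \<beta>[OF assms] by (simp add: \<beta>'_def)
  show "((\<lambda>t. P t y) has_real_derivative Pt t y) (at t)"
    unfolding P_def Pt_def by (intro DERIV_add DERIV_cmult_right \<alpha>[OF assms] b1)
  show "((\<lambda>t. Q t y) has_real_derivative Qt t y) (at t)"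
    unfolding Q_def Qt_def
    by (rule DERIV_cong[OF DERIV_add[OF DERIV_add[OF DERIV_const DERIV_cmult_right[OF a1]] d[OF assms]]]) simp
  show "(a' has_real_derivative - 4 * \<sigma>\<^sup>2 * a t * a' t) (at t)"
    unfolding a'_def[abs_def] power2_eq_square[of "a _"]
    by (rule DERIV_cong[OF DERIV_diff[OF DERIV_cmult[OF DERIV_mult[OF a1 a1]] DERIV_const]])
      (simp add: a'_def power2_eq_square)
  show "(\<beta>' has_real_derivative - 4 * \<sigma>\<^sup>2 * (a' t * \<beta> t + a t * \<beta>' t)) (at t)"
    unfolding \<beta>'_def[abs_def]
    by (rule DERIV_cong[OF DERIV_mult[OF DERIV_cmult[OF a1] b1]]) (simp add: \<beta>'_def algebra_simps)
qed

lemma P_derivatives: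
  "(P1 t has_real_derivative P1y t y) (at y)" "(P2 t has_real_derivative P2y t y) (at y)"
  "(T1 t has_real_derivative T1y t y) (at y)"
proof -
  note Y = y_derivatives[of t y]
  have P1: "(P1 t has_real_derivative P1y t y) (at y)" for y
    unfolding P1_def[abs_def] P1y_def
    by (rule DERIV_cong[OF DERIV_add[OF y_derivatives(2) DERIV_mult[OF y_derivatives(1,4)]]]) simp
  then show "(P1 t has_real_derivative P1y t y) (at y)" .
  have P1y: "(P1y t has_real_derivative P1yy t y) (at y)"
    unfolding P1y_def[abs_def] P1yy_def
    by (rule DERIV_cong[OF DERIV_add[OF DERIV_const DERIV_add[OF DERIV_mult[OF Y(2,4)] DERIV_mult[OF Y(1,5)]]]])
      simp
  show "(P2 t has_real_derivative P2y t y) (at y)"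
    unfolding P2_def[abs_def] P2y_def
    by (rule DERIV_cong[OF DERIV_add[OF P1y DERIV_mult[OF P1 Y(4)]]]) simp
  show "(T1 t has_real_derivative T1y t y) (at y)"
    unfolding T1_def[abs_def] T1y_def
    by (rule DERIV_cong[OF DERIV_add[OF Y(6) DERIV_mult[OF Y(1,7)]]]) simp
qed

lemma T1_derivative:
  assumes "0 \<le> t" "t \<le> S"
  shows "((\<lambda>t. T1 t y) has_real_derivative T1t t y) (at t)"
proof -
  note D = t_derivatives[OF assms]
  have "((\<lambda>t. Pt t y) has_real_derivative - \<sigma>\<^sup>2 * \<beta>' t + (- 4 * \<sigma>\<^sup>2 * (a' t * \<beta> t + a t * \<beta>' t)) * y\<^sup>2) (at t)"
    unfolding Pt_def by (intro DERIV_add DERIV_cmult DERIV_cmult_right D)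
  moreover have "((\<lambda>t. Qt t y) has_real_derivative (- 4 * \<sigma>\<^sup>2 * a t * a' t) * y\<^sup>2 + (- \<sigma>\<^sup>2 * a' t)) (at t)"
    unfolding Qt_def
    by (rule DERIV_cong[OF DERIV_add[OF DERIV_cmult_right[OF D(5)] DERIV_diff[OF DERIV_cmult[OF D(1)] DERIV_const]]])
      simp
  ultimately show ?thesis
    unfolding T1_def T1t_def
    by (rule DERIV_cong[OF DERIV_add[OF _ DERIV_mult[OF D(3)]]]) simp
qed

lemma u_derivatives:
  "(u t has_real_derivative uy t y) (at y)" "(uy t has_real_derivative uyy t y) (at y)"
  "(uyy t has_real_derivative uyyy t y) (at y)" "(ut t has_real_derivative uty t y) (at y)"
proof -
  show "(u t has_real_derivative uy t y) (at y)"
    unfolding u_def[abs_def] uy_def P1_def by (rule DERIV_mult_exp y_derivatives)+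
  show "(uy t has_real_derivative uyy t y) (at y)"
    unfolding uy_def[abs_def] uyy_def P2_def by (rule DERIV_mult_exp y_derivatives P_derivatives)+
  show "(uyy t has_real_derivative uyyy t y) (at y)"
    unfolding uyy_def[abs_def] uyyy_def by (rule DERIV_mult_exp y_derivatives P_derivatives)+
  show "(ut t has_real_derivative uty t y) (at y)"
    unfolding ut_def[abs_def] uty_def by (rule DERIV_mult_exp y_derivatives P_derivatives)+
qed

lemma ut_derivatives:
  assumes "0 \<le> t" "t \<le> S"
  shows "((\<lambda>t. u t y) has_real_derivative ut t y) (at t)" "((\<lambda>t. ut t y) has_real_derivative utt t y) (at t)"
proof -
  show "((\<lambda>t. u t y) has_real_derivative ut t y) (at t)"
    unfolding u_def ut_def T1_def by (rule DERIV_mult_exp t_derivatives[OF assms])+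
  show "((\<lambda>t. ut t y) has_real_derivative utt t y) (at t)"
    unfolding ut_def utt_def by (rule DERIV_mult_exp T1_derivative[OF assms] t_derivatives[OF assms])+
qed

lemma backward_equation:
  "ut t y + (- \<kappa> * y - c * y ^ 3) * uy t y + \<sigma>\<^sup>2 / 2 * uyy t y
    + (\<kappa> * y + c * y ^ 3)\<^sup>2 / (2 * \<sigma>\<^sup>2) * u t y = 0"
proof -
  define s where "s = \<sigma>\<^sup>2"
  \<comment> \<open>The drift is - s g and the potential s g^2 / 2. Keeping \<open>g\<close> and
    \<open>g1\<close> as letters leaves an identity in which every power of \<open>g\<close>
    cancels; only its derivative \<open>g1\<close> survives, and s g1 is the quadratic \<kappa> + 3
    c y^2.\<close>
  define g where "g = (\<kappa> * y + c * y ^ 3) / s"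
  define g1 where "g1 = (\<kappa> + 3 * c * y\<^sup>2) / s"
  have s: "s \<noteq> 0" using \<sigma> by (simp add: s_def)
  have g: "- \<kappa> * y - c * y ^ 3 = - (s * g)" using s by (simp add: g_def)
  have "\<kappa> * y + c * y ^ 3 = s * g" using s by (simp add: g_def)
  then have V: "(\<kappa> * y + c * y ^ 3)\<^sup>2 / (2 * s) = s * g\<^sup>2 / 2"
    using s by (simp add: power2_eq_square)
  have g1: "s * g1 = \<kappa> + 3 * c * y\<^sup>2" using s by (simp add: g1_def)
  define p where "p = P t y"
  define A where "A = a t"
  define B where "B = \<beta> t"
  have "T1 t y + (- (s * g)) * P1 t y + s / 2 * P2 t y + s * g\<^sup>2 / 2 * P t y
    = p / 2 * (s * g1 - (\<kappa> + 3 * c * y\<^sup>2))"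
    unfolding T1_def P1_def P2_def P1y_def Pt_def Qt_def Qy_def Qyy_def Py_def a'_def \<beta>'_def
      g_def[symmetric] g1_def[symmetric] s_def[symmetric] p_def[symmetric] A_def[symmetric] B_def[symmetric]
    by (simp add: field_simps power2_eq_square)
  then have z: "T1 t y + (- (s * g)) * P1 t y + s / 2 * P2 t y + s * g\<^sup>2 / 2 * P t y = 0"
    using g1 by simp
  have "ut t y + (- (s * g)) * uy t y + s / 2 * uyy t y + s * g\<^sup>2 / 2 * u t y
      = (T1 t y + (- (s * g)) * P1 t y + s / 2 * P2 t y + s * g\<^sup>2 / 2 * P t y) * exp (Q t y)"
    unfolding ut_def uy_def uyy_def u_def by (simp add: algebra_simps)
  then show ?thesis unfolding g s_def[symmetric] V z by simp
qed

lemma coefficients_continuous: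
  "continuous_on {0..S} a" "continuous_on {0..S} \<alpha>" "continuous_on {0..S} \<beta>" "continuous_on {0..S} d"
  by (auto intro!: continuous_at_imp_continuous_on intro: DERIV_isCont[OF a] DERIV_isCont[OF \<alpha>]
      DERIV_isCont[OF \<beta>] DERIV_isCont[OF d])

lemma rectangle_continuous:
  "continuous_on ({0..S} \<times> {-R..R}) (\<lambda>p. Q (fst p) (snd p))"
  "continuous_on ({0..S} \<times> {-R..R}) (\<lambda>p. u (fst p) (snd p))"
  "continuous_on ({0..S} \<times> {-R..R}) (\<lambda>p. uy (fst p) (snd p))"
  "continuous_on ({0..S} \<times> {-R..R}) (\<lambda>p. uyy (fst p) (snd p))"
  "continuous_on ({0..S} \<times> {-R..R}) (\<lambda>p. uyyy (fst p) (snd p))"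
  "continuous_on ({0..S} \<times> {-R..R}) (\<lambda>p. ut (fst p) (snd p))"
  "continuous_on ({0..S} \<times> {-R..R}) (\<lambda>p. uty (fst p) (snd p))"
  "continuous_on ({0..S} \<times> {-R..R}) (\<lambda>p. utt (fst p) (snd p))"
proof -
  let ?X = "{0..S} \<times> {-R..R}"
  have f: "continuous_on ?X (\<lambda>p. f (fst p))" if "continuous_on {0..S} f" for f :: "real \<Rightarrow> real"
    by (rule continuous_on_compose2[OF that]) (auto intro: continuous_intros)
  note co = coefficients_continuous[THEN f] continuous_on_snd[OF continuous_on_id] continuous_on_const
    continuous_on_add continuous_on_diff continuous_on_minus continuous_on_mult continuous_on_power
  have div: "continuous_on ?X (\<lambda>p. g p / \<sigma>\<^sup>2)" if "continuous_on ?X g" for g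
    using that \<sigma> by (intro continuous_intros) auto
  have half: "continuous_on ?X (\<lambda>p. g p / 2)" "continuous_on ?X (\<lambda>p. g p / 4)" if "continuous_on ?X g" for g :: "real \<times> real \<Rightarrow> real"
    using that by (auto intro!: continuous_intros)
  have 1: "continuous_on ?X (\<lambda>p. a' (fst p))" "continuous_on ?X (\<lambda>p. \<beta>' (fst p))"
    "continuous_on ?X (\<lambda>p. P (fst p) (snd p))" "continuous_on ?X (\<lambda>p. Py (fst p) (snd p))"
    "continuous_on ?X (\<lambda>p. Qy (fst p) (snd p))" "continuous_on ?X (\<lambda>p. Qyy (fst p) (snd p))"
    unfolding a'_def \<beta>'_def P_def Py_def Qy_def Qyy_def
    by (intro co div half)+
  have 2: "continuous_on ?X (\<lambda>p. Pt (fst p) (snd p))" "continuous_on ?X (\<lambda>p. Qt (fst p) (snd p))"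
    unfolding Pt_def Qt_def by (intro co div half 1)+
  show Q: "continuous_on ?X (\<lambda>p. Q (fst p) (snd p))"
    unfolding Q_def G_def by (intro co div half)
  have 3: "continuous_on ?X (\<lambda>p. P1 (fst p) (snd p))" "continuous_on ?X (\<lambda>p. P1y (fst p) (snd p))"
    "continuous_on ?X (\<lambda>p. P1yy (fst p) (snd p))" "continuous_on ?X (\<lambda>p. T1 (fst p) (snd p))"
    "continuous_on ?X (\<lambda>p. T1y (fst p) (snd p))" "continuous_on ?X (\<lambda>p. T1t (fst p) (snd p))"
    unfolding P1_def P1y_def P1yy_def T1_def T1y_def T1t_def by (intro co div half 1 2)+
  have 4: "continuous_on ?X (\<lambda>p. P2 (fst p) (snd p))" "continuous_on ?X (\<lambda>p. P2y (fst p) (snd p))"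
    unfolding P2_def P2y_def by (intro co 1 3)+
  have e: "continuous_on ?X (\<lambda>p. g p * exp (Q (fst p) (snd p)))" if "continuous_on ?X g" for g
    by (intro continuous_on_mult continuous_on_exp Q that)
  show "continuous_on ?X (\<lambda>p. u (fst p) (snd p))" "continuous_on ?X (\<lambda>p. uy (fst p) (snd p))"
    "continuous_on ?X (\<lambda>p. uyy (fst p) (snd p))" "continuous_on ?X (\<lambda>p. uyyy (fst p) (snd p))"
    "continuous_on ?X (\<lambda>p. ut (fst p) (snd p))" "continuous_on ?X (\<lambda>p. uty (fst p) (snd p))"
    "continuous_on ?X (\<lambda>p. utt (fst p) (snd p))"
    unfolding u_def uy_def uyy_def uyyy_def ut_def uty_def utt_def
    by (intro e co 1 2 3 4)+
qed

lemma u_measurable: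
  "u t \<in> borel_measurable borel" "uy t \<in> borel_measurable borel" "uyy t \<in> borel_measurable borel"
  by (intro borel_measurable_continuous_onI continuous_at_imp_continuous_on ballI
      DERIV_isCont[OF u_derivatives(1)] DERIV_isCont[OF u_derivatives(2)] DERIV_isCont[OF u_derivatives(3)])+

text \<open>All bounds come from continuity on a compact rectangle. Negativity in the collar can be
  required of the polynomial factor alone: the exponential is at least \<open>exp (- B0)\<close> on
  the rectangle, which serves as \<open>m\<close>.\<close>

lemma feynman_kac_box_exists:
  assumes R: "0 \<le> R'" "R' < R"
    and neg: "\<And>t y. 0 \<le> t \<Longrightarrow> t \<le> S \<Longrightarrow> R' \<le> \<bar>y\<bar> \<Longrightarrow> P t y \<le> - 1"
  shows "\<exists>K m. feynman_kac_box (\<lambda>y. - \<kappa> * y - c * y ^ 3) (\<lambda>y. (\<kappa> * y + c * y ^ 3)\<^sup>2 / (2 * \<sigma>\<^sup>2))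
    \<sigma> S R R' K m u ut uy uyy"
proof -
  let ?b = "\<lambda>y. - \<kappa> * y - c * y ^ 3"
  let ?V = "\<lambda>y. (\<kappa> * y + c * y ^ 3)\<^sup>2 / (2 * \<sigma>\<^sup>2)"
  obtain B0 where B0: "0 \<le> B0" "\<And>t y. 0 \<le> t \<Longrightarrow> t \<le> S \<Longrightarrow> \<bar>y\<bar> \<le> R \<Longrightarrow> \<bar>Q t y\<bar> \<le> B0"
    using bounded_on_rectangle[OF rectangle_continuous(1)] by blast
  obtain B1 where B1: "0 \<le> B1" "\<And>t y. 0 \<le> t \<Longrightarrow> t \<le> S \<Longrightarrow> \<bar>y\<bar> \<le> R \<Longrightarrow> \<bar>u t y\<bar> \<le> B1"
    using bounded_on_rectangle[OF rectangle_continuous(2)] by blast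
  obtain B2 where B2: "0 \<le> B2" "\<And>t y. 0 \<le> t \<Longrightarrow> t \<le> S \<Longrightarrow> \<bar>y\<bar> \<le> R \<Longrightarrow> \<bar>uy t y\<bar> \<le> B2"
    using bounded_on_rectangle[OF rectangle_continuous(3)] by blast
  obtain B3 where B3: "0 \<le> B3" "\<And>t y. 0 \<le> t \<Longrightarrow> t \<le> S \<Longrightarrow> \<bar>y\<bar> \<le> R \<Longrightarrow> \<bar>uyy t y\<bar> \<le> B3"
    using bounded_on_rectangle[OF rectangle_continuous(4)] by blast
  obtain B4 where B4: "0 \<le> B4" "\<And>t y. 0 \<le> t \<Longrightarrow> t \<le> S \<Longrightarrow> \<bar>y\<bar> \<le> R \<Longrightarrow> \<bar>uyyy t y\<bar> \<le> B4"
    using bounded_on_rectangle[OF rectangle_continuous(5)] by blast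
  obtain B5 where B5: "0 \<le> B5" "\<And>t y. 0 \<le> t \<Longrightarrow> t \<le> S \<Longrightarrow> \<bar>y\<bar> \<le> R \<Longrightarrow> \<bar>ut t y\<bar> \<le> B5"
    using bounded_on_rectangle[OF rectangle_continuous(6)] by blast
  obtain B6 where B6: "0 \<le> B6" "\<And>t y. 0 \<le> t \<Longrightarrow> t \<le> S \<Longrightarrow> \<bar>y\<bar> \<le> R \<Longrightarrow> \<bar>uty t y\<bar> \<le> B6"
    using bounded_on_rectangle[OF rectangle_continuous(7)] by blast
  obtain B7 where B7: "0 \<le> B7" "\<And>t y. 0 \<le> t \<Longrightarrow> t \<le> S \<Longrightarrow> \<bar>y\<bar> \<le> R \<Longrightarrow> \<bar>utt t y\<bar> \<le> B7"
    using bounded_on_rectangle[OF rectangle_continuous(8)] by blast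
  have "continuous_on ({0..S} \<times> {-R..R}) (\<lambda>p. ?b (snd p))" by (intro continuous_intros)
  then obtain B8 where B8: "0 \<le> B8" "\<And>t y. 0 \<le> t \<Longrightarrow> t \<le> S \<Longrightarrow> \<bar>y\<bar> \<le> R \<Longrightarrow> \<bar>?b y\<bar> \<le> B8"
    using bounded_on_rectangle[of S R "\<lambda>t. ?b"] by blast
  have "continuous_on ({0..S} \<times> {-R..R}) (\<lambda>p. - \<kappa> - 3 * c * (snd p)\<^sup>2)" by (intro continuous_intros)
  then obtain B9 where B9: "0 \<le> B9" "\<And>t y. 0 \<le> t \<Longrightarrow> t \<le> S \<Longrightarrow> \<bar>y\<bar> \<le> R \<Longrightarrow> \<bar>- \<kappa> - 3 * c * y\<^sup>2\<bar> \<le> B9"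
    using bounded_on_rectangle[of S R "\<lambda>t y. - \<kappa> - 3 * c * y\<^sup>2"] by blast
  have V_cont: "continuous_on UNIV ?V" using \<sigma> by (intro continuous_intros) auto
  have "continuous_on ({0..S} \<times> {-R..R}) (\<lambda>p. ?V (snd p))" using \<sigma> by (intro continuous_intros) auto
  then obtain B10 where B10: "0 \<le> B10" "\<And>t y. 0 \<le> t \<Longrightarrow> t \<le> S \<Longrightarrow> \<bar>y\<bar> \<le> R \<Longrightarrow> \<bar>?V y\<bar> \<le> B10"
    using bounded_on_rectangle[of S R "\<lambda>t. ?V"] by blast
  define K where "K = B1 + B2 + B3 + B4 + B5 + B6 + B7 + B8 + B9 + B10"
  have K: "B1 \<le> K" "B2 \<le> K" "B3 \<le> K" "B4 \<le> K" "B5 \<le> K" "B6 \<le> K" "B7 \<le> K" "B8 \<le> K" "B9 \<le> K" "B10 \<le> K" "0 \<le> K"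
    unfolding K_def using B1(1) B2(1) B3(1) B4(1) B5(1) B6(1) B7(1) B8(1) B9(1) B10(1) by linarith+
  have "feynman_kac_box ?b ?V \<sigma> S R R' K (exp (- B0)) u ut uy uyy"
  proof
    show "0 < \<sigma>" "0 < S" "0 \<le> R'" "R' < R" "0 < exp (- B0)" "0 \<le> K" using \<sigma> S R K by auto
    show "continuous_on UNIV ?b" by (intro continuous_intros)
    show "continuous_on UNIV ?V" by (rule V_cont)
    show "\<bar>?b x\<bar> \<le> K" if "\<bar>x\<bar> \<le> R" for x
      using B8(2)[of 0 x] that S K by linarith
    show "\<bar>?b z - ?b x\<bar> \<le> K * \<bar>z - x\<bar>" if "\<bar>x\<bar> \<le> R" "\<bar>z\<bar> \<le> R" for x z
    proof (rule lipschitz_of_derivative_bound[of "- R" R ?b "\<lambda>y. - \<kappa> - 3 * c * y\<^sup>2"])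
      show "(?b has_real_derivative - \<kappa> - 3 * c * y\<^sup>2) (at y)" for y
        by (auto intro!: derivative_eq_intros simp: power2_eq_square)
      show "\<bar>- \<kappa> - 3 * c * y\<^sup>2\<bar> \<le> K" if "- R \<le> y" "y \<le> R" for y
      proof -
        have "\<bar>y\<bar> \<le> R" using that by auto
        then show ?thesis using B9(2)[of 0 y] S K by linarith
      qed
    qed (use that in auto)
    show "0 \<le> ?V x" for x by simp
    show "?V x \<le> K" if "\<bar>x\<bar> \<le> R" for x
      using B10(2)[of 0 x] that S K by linarith
    show "\<bar>u t x\<bar> \<le> K \<and> \<bar>ut t x\<bar> \<le> K \<and> \<bar>uy t x\<bar> \<le> K \<and> \<bar>uyy t x\<bar> \<le> K"
      if "0 \<le> t" "t \<le> S" "\<bar>x\<bar> \<le> R" for t x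
      using B1(2)[OF that] B2(2)[OF that] B3(2)[OF that] B5(2)[OF that] K by linarith
    show "\<bar>u (t + h) z - (u t x + h * ut t x + (z - x) * uy t x + (z - x)\<^sup>2 / 2 * uyy t x)\<bar>
        \<le> K * (h\<^sup>2 + h * \<bar>z - x\<bar> + \<bar>z - x\<bar> ^ 3)"
      if "0 \<le> t" "0 \<le> h" "t + h \<le> S" "\<bar>x\<bar> \<le> R" "\<bar>z\<bar> \<le> R" for t h x z
    proof (rule parabolic_taylor_bound[where S = S and R = R and uyyy = uyyy and uty = uty and utt = utt])
      show "\<bar>uyyy t y\<bar> \<le> K \<and> \<bar>uty t y\<bar> \<le> K \<and> \<bar>utt t y\<bar> \<le> K"
        if "0 \<le> t" "t \<le> S" "\<bar>y\<bar> \<le> R" for t y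
        using B4(2)[OF that] B6(2)[OF that] B7(2)[OF that] K by linarith
    qed (use that in \<open>auto intro: u_derivatives ut_derivatives\<close>)
    show "ut t x + ?b x * uy t x + \<sigma>\<^sup>2 / 2 * uyy t x + ?V x * u t x = 0" for t x
      by (rule backward_equation)
    show "u t x \<le> - exp (- B0)" if "0 \<le> t" "t \<le> S" "R' \<le> \<bar>x\<bar>" "\<bar>x\<bar> \<le> R" for t x
    proof -
      have "u t x \<le> - 1 * exp (Q t x)"
        unfolding u_def using neg[OF that(1-3)] by (intro mult_right_mono) auto
      moreover have "exp (- B0) \<le> exp (Q t x)"
        using B0(2)[OF that(1,2,4)] by auto
      ultimately show ?thesis by linarith
    qed
  qed (rule u_measurable)+
  then show ?thesis by blast
qed

end

lemma (in brownian_motion) riccati_subsolution: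
  assumes ric: "riccati \<kappa> c \<sigma> S a \<alpha> \<beta> d"
    and sol: "solves_sde M F W (\<lambda>y. - \<kappa> * y - c * y ^ 3) \<sigma> y0 Y"
    and R: "0 \<le> R'" "R' < R" "\<bar>y0\<bar> \<le> R"
    and neg: "\<And>t y. 0 \<le> t \<Longrightarrow> t \<le> S \<Longrightarrow> R' \<le> \<bar>y\<bar> \<Longrightarrow> \<alpha> t + \<beta> t * y\<^sup>2 \<le> - 1"
  defines "U \<equiv> \<lambda>t y. (\<alpha> t + \<beta> t * y\<^sup>2) * exp ((\<kappa> * y\<^sup>2 / 2 + c * y ^ 4 / 4) / \<sigma>\<^sup>2 + a t * y\<^sup>2 + d t)"
    and "w \<equiv> grid_weight (\<lambda>y. (\<kappa> * y + c * y ^ 3)\<^sup>2 / (2 * \<sigma>\<^sup>2)) S Y"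
  shows "integrable M (\<lambda>\<omega>. indicator (confined M Y R S) \<omega> * exp (w \<omega>) * U S (Y S \<omega>))"
    and "U 0 y0 \<le> expectation (\<lambda>\<omega>. indicator (confined M Y R S) \<omega> * exp (w \<omega>) * U S (Y S \<omega>))"
proof -
  interpret riccati \<kappa> c \<sigma> S a \<alpha> \<beta> d by (rule ric)
  have U: "U = u" by (simp add: U_def fun_eq_iff u_def P_def Q_def G_def)
  have "\<exists>K m. feynman_kac_box (\<lambda>y. - \<kappa> * y - c * y ^ 3) (\<lambda>y. (\<kappa> * y + c * y ^ 3)\<^sup>2 / (2 * \<sigma>\<^sup>2))
    \<sigma> S R R' K m u ut uy uyy"
    by (rule feynman_kac_box_exists[OF R(1,2)]) (simp add: P_def neg)
  then obtain K m where box: "feynman_kac_box (\<lambda>y. - \<kappa> * y - c * y ^ 3)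
    (\<lambda>y. (\<kappa> * y + c * y ^ 3)\<^sup>2 / (2 * \<sigma>\<^sup>2)) \<sigma> S R R' K m u ut uy uyy"
    by (elim exE)
  interpret sde_box M F W "\<lambda>y. - \<kappa> * y - c * y ^ 3" "\<lambda>y. (\<kappa> * y + c * y ^ 3)\<^sup>2 / (2 * \<sigma>\<^sup>2)"
    \<sigma> S R R' K m u ut uy uyy Y y0
    by (intro sde_box.intro sde_box_axioms.intro brownian_motion_axioms box sol R(3))
  show "integrable M (\<lambda>\<omega>. indicator (confined M Y R S) \<omega> * exp (w \<omega>) * U S (Y S \<omega>))"
    unfolding w_def U by (rule box_subsolution)
  show "U 0 y0 \<le> expectation (\<lambda>\<omega>. indicator (confined M Y R S) \<omega> * exp (w \<omega>) * U S (Y S \<omega>))"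
    unfolding w_def U by (rule box_subsolution)
qed

text \<open>The linearisation a = \<psi>' / (2 \<sigma>^2 \<psi>) is solved by \<psi> = sin \<phi>.
  Then \<beta> is a multiple of \<psi>^(-2), \<open>d\<close> contains - ln \<psi> / 2, and \<alpha>
  integrates \<psi>^(-2), which gives the cotangent. The hypotheses on \<omega>0 keep the decreasing
  phase \<phi> inside (0, \<pi>) on [0, S].\<close>

lemma riccati_trig:
  fixes \<kappa> c \<sigma> S \<theta> \<omega>0 \<alpha>0 \<beta>0 :: real
  assumes \<sigma>: "0 < \<sigma>" and S: "0 < S" and \<theta>: "0 < \<theta>" "\<theta>\<^sup>2 = 3 * c * \<sigma>\<^sup>2"
    and \<phi>: "\<omega>0 < pi" "0 < \<omega>0 - \<theta> * S"
  defines "\<phi> \<equiv> \<lambda>t. \<omega>0 - \<theta> * t"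
  shows "riccati \<kappa> c \<sigma> S (\<lambda>t. - (\<theta> / (2 * \<sigma>\<^sup>2)) * cot (\<phi> t)) (\<lambda>t. \<alpha>0 + \<sigma>\<^sup>2 * \<beta>0 / \<theta> * cot (\<phi> t))
    (\<lambda>t. - \<beta>0 / (sin (\<phi> t))\<^sup>2) (\<lambda>t. - \<kappa> * t / 2 - ln (sin (\<phi> t)) / 2)"
proof
  fix t assume t: "0 \<le> t" "t \<le> S"
  have "\<theta> * t \<le> \<theta> * S" "0 \<le> \<theta> * t" using t \<theta> by (auto intro: mult_left_mono)
  then have s: "0 < sin (\<phi> t)" using \<phi> by (intro sin_gt_zero) (auto simp: \<phi>_def)
  have s2: "\<sigma>\<^sup>2 \<noteq> 0" using \<sigma> by simp
  have cs: "(cot (\<phi> t))\<^sup>2 + 1 = inverse ((sin (\<phi> t))\<^sup>2)"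
    using s sin_cos_squared_add[of "\<phi> t"] by (simp add: cot_def field_simps)
  have \<phi>': "(\<phi> has_real_derivative - \<theta>) (at t)"
    unfolding \<phi>_def by (auto intro!: derivative_eq_intros)
  have cot': "((\<lambda>t. cot (\<phi> t)) has_real_derivative \<theta> * inverse ((sin (\<phi> t))\<^sup>2)) (at t)"
    using DERIV_chain2[OF DERIV_cot \<phi>'] s by (simp add: mult.commute)
  have sin': "((\<lambda>t. sin (\<phi> t)) has_real_derivative - \<theta> * cos (\<phi> t)) (at t)"
    using DERIV_chain2[OF DERIV_sin \<phi>'] by (simp add: mult.commute)
  show "((\<lambda>t. - (\<theta> / (2 * \<sigma>\<^sup>2)) * cot (\<phi> t)) has_real_derivative
      - 2 * \<sigma>\<^sup>2 * (- (\<theta> / (2 * \<sigma>\<^sup>2)) * cot (\<phi> t))\<^sup>2 - 3 * c / 2) (at t)"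
  proof (rule DERIV_cong[OF DERIV_cmult[OF cot']])
    have c3: "3 * c = \<theta>\<^sup>2 / \<sigma>\<^sup>2" using \<theta> s2 by simp
    show "- (\<theta> / (2 * \<sigma>\<^sup>2)) * (\<theta> * inverse ((sin (\<phi> t))\<^sup>2)) = - 2 * \<sigma>\<^sup>2 * (- (\<theta> / (2 * \<sigma>\<^sup>2)) * cot (\<phi> t))\<^sup>2 - 3 * c / 2"
      unfolding cs[symmetric] c3 using s2 by (simp add: field_simps power2_eq_square)
  qed
  show "((\<lambda>t. \<alpha>0 + \<sigma>\<^sup>2 * \<beta>0 / \<theta> * cot (\<phi> t)) has_real_derivative - \<sigma>\<^sup>2 * (- \<beta>0 / (sin (\<phi> t))\<^sup>2)) (at t)"
    by (rule DERIV_cong[OF DERIV_add[OF DERIV_const DERIV_cmult[OF cot']]])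
      (use \<theta> in \<open>simp add: field_simps\<close>)
  show "((\<lambda>t. - \<beta>0 / (sin (\<phi> t))\<^sup>2) has_real_derivative
      - 4 * \<sigma>\<^sup>2 * (- (\<theta> / (2 * \<sigma>\<^sup>2)) * cot (\<phi> t)) * (- \<beta>0 / (sin (\<phi> t))\<^sup>2)) (at t)"
  proof (rule DERIV_cong[OF DERIV_divide[OF DERIV_const DERIV_power[OF sin']]])
    have "\<sigma>\<^sup>2 * (\<theta> / (2 * \<sigma>\<^sup>2)) = \<theta> / 2" using s2 by simp
    then have "- 4 * \<sigma>\<^sup>2 * (- (\<theta> / (2 * \<sigma>\<^sup>2)) * cot (\<phi> t)) * (- \<beta>0 / (sin (\<phi> t))\<^sup>2)
      = - 2 * \<theta> * cot (\<phi> t) * \<beta>0 / (sin (\<phi> t))\<^sup>2"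
      using \<sigma> by (simp add: mult.assoc)
    then show "(0 * (sin (\<phi> t))\<^sup>2 - - \<beta>0 * (real 2 * (- \<theta> * cos (\<phi> t) * sin (\<phi> t) ^ (2 - Suc 0)))) /
        ((sin (\<phi> t))\<^sup>2 * (sin (\<phi> t))\<^sup>2)
      = - 4 * \<sigma>\<^sup>2 * (- (\<theta> / (2 * \<sigma>\<^sup>2)) * cot (\<phi> t)) * (- \<beta>0 / (sin (\<phi> t))\<^sup>2)"
      using s by (simp add: cot_def power2_eq_square)
  qed (use s in simp)
  show "((\<lambda>t. - \<kappa> * t / 2 - ln (sin (\<phi> t)) / 2) has_real_derivative
      - \<sigma>\<^sup>2 * (- (\<theta> / (2 * \<sigma>\<^sup>2)) * cot (\<phi> t)) - \<kappa> / 2) (at t)"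
    by (rule DERIV_cong[OF DERIV_diff[OF DERIV_cdivide[OF DERIV_cmult[OF DERIV_ident]]
          DERIV_cdivide[OF DERIV_chain2[OF DERIV_ln_divide[OF s] sin']]]])
      (use s2 in \<open>simp add: cot_def\<close>)
qed (use \<sigma> S in auto)

section \<open>The threshold\<close>

text \<open>\<open>ennreal\<close> sends negative values to 0, so it can only enlarge the integral.
  This admits test functions that change sign.\<close>

lemma ennreal_expectation_le_nn_integral:
  fixes f :: "'a \<Rightarrow> real"
  assumes f: "integrable M f"
  shows "ennreal (integral\<^sup>L M f) \<le> (\<integral>\<^sup>+ x. ennreal (f x) \<partial>M)"
proof -
  have i: "integrable M (\<lambda>x. max 0 (f x))" using f by simp
  have "integral\<^sup>L M f \<le> (\<integral>x. max 0 (f x) \<partial>M)"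
    using f i by (intro integral_mono) auto
  then have "ennreal (integral\<^sup>L M f) \<le> ennreal (\<integral>x. max 0 (f x) \<partial>M)" by (rule ennreal_leI)
  also have "\<dots> = (\<integral>\<^sup>+ x. ennreal (max 0 (f x)) \<partial>M)"
    using i by (intro nn_integral_eq_integral[symmetric]) auto
  also have "\<dots> = (\<integral>\<^sup>+ x. ennreal (f x) \<partial>M)"
    by (intro nn_integral_cong) (simp add: max_def ennreal_neg)
  finally show ?thesis .
qed

text \<open>If \<open>x = 0\<close>, only the determinant \<open>sin \<eta> / sin \<mu>\<close> can blow up, which forces \<open>\<mu>\<close> to be much smaller
  than \<open>\<eta>\<close>; otherwise the Gaussian factor \<open>exp (k x\<^sup>2 cot \<mu>)\<close> does, but \<open>\<mu>\<close> has to stay comparable to \<open>\<eta>\<close>.\<close>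

lemma blow_up_parameters:
  fixes k x h B :: real
  assumes k: "0 < k"
  shows "\<exists>\<mu> \<eta>. 0 < \<mu> \<and> 0 < \<eta> \<and> \<mu> + \<eta> < 1 \<and> (sin \<eta>)\<^sup>2 * (cot \<eta> + cot \<mu>) \<le> 3 \<and>
    x\<^sup>2 * (sin \<eta>)\<^sup>2 \<le> x\<^sup>2 * (sin \<mu>)\<^sup>2 \<and>
    B \<le> 1 / 2 * exp (k * cot \<mu> * x\<^sup>2 + (ln (sin \<eta>) - ln (sin \<mu>)) / 2 - h)"
proof (cases "x = 0")
  case False
  \<comment> \<open>Here both parameters are taken equal: the logarithms cancel, k x^2 cot \<eta>
    tends to infinity, and the first condition reduces to sin (2 \<eta>) \<le> 3.\<close>
  define k' where "k' = k * x\<^sup>2"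
  have k': "0 < k'" using k False by (simp add: k'_def)
  have lim: "filterlim (\<lambda>\<eta>. 1 / 2 * exp (k' * (cos \<eta> / sin \<eta>) - h)) at_top (at_right 0)"
    using k' by real_asymp
  have "eventually (\<lambda>\<eta>. B \<le> 1 / 2 * exp (k' * (cos \<eta> / sin \<eta>) - h)) (at_right 0)"
    using lim by (simp add: filterlim_at_top)
  moreover have "eventually (\<lambda>\<eta>::real. 0 < \<eta> \<and> \<eta> < 1 / 2) (at_right 0)"
    by (auto simp: eventually_at_right_less eventually_at_right_field intro!: exI[of _ "1/2"])
  ultimately have "eventually (\<lambda>\<eta>. (B \<le> 1 / 2 * exp (k' * (cos \<eta> / sin \<eta>) - h)) \<and> (0 < \<eta> \<and> \<eta> < 1 / 2)) (at_right 0)"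
    by (rule eventually_conj)
  then obtain \<eta> where \<eta>: "B \<le> 1 / 2 * exp (k' * (cos \<eta> / sin \<eta>) - h)" "0 < \<eta>" "\<eta> < 1 / 2"
    using eventually_happens'[OF trivial_limit_at_right_real] by blast
  have s: "0 < sin \<eta>" using \<eta> pi_gt3 by (intro sin_gt_zero) auto
  have "(sin \<eta>)\<^sup>2 * (cot \<eta> + cot \<eta>) = 2 * (sin \<eta> * cos \<eta>)"
    using s by (simp add: cot_def power2_eq_square)
  also have "\<dots> = sin (2 * \<eta>)" by (simp add: sin_double)
  also have "\<dots> \<le> 3" using sin_le_one[of "2 * \<eta>"] by linarith
  finally show ?thesis
    using \<eta> by (intro exI[of _ \<eta>]) (auto simp: k'_def cot_def mult_ac)
next
  case True
  \<comment> \<open>Here \<mu> = \<eta>^2: the quotient sin \<eta> / sin (\<eta>^2) behaves like 1 /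
    \<eta>, and the first condition survives because its left-hand side tends to 1.\<close>
  have lim: "filterlim (\<lambda>\<eta>. 1 / 2 * exp ((ln (sin \<eta>) - ln (sin (\<eta>\<^sup>2))) / 2 - h)) at_top (at_right 0)"
    by real_asymp
  have lim2: "((\<lambda>\<eta>::real. (sin \<eta>)\<^sup>2 * (cos \<eta> / sin \<eta> + cos (\<eta>\<^sup>2) / sin (\<eta>\<^sup>2))) \<longlongrightarrow> 1) (at_right 0)"
    by real_asymp
  have "eventually (\<lambda>\<eta>. B \<le> 1 / 2 * exp ((ln (sin \<eta>) - ln (sin (\<eta>\<^sup>2))) / 2 - h)) (at_right 0)"
    using lim by (simp add: filterlim_at_top)
  moreover have "eventually (\<lambda>\<eta>::real. (sin \<eta>)\<^sup>2 * (cos \<eta> / sin \<eta> + cos (\<eta>\<^sup>2) / sin (\<eta>\<^sup>2)) < 3) (at_right 0)"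
    using order_tendstoD(2)[OF lim2, of 3] by simp
  moreover have "eventually (\<lambda>\<eta>::real. 0 < \<eta> \<and> \<eta> < 1 / 2) (at_right 0)"
    by (auto simp: eventually_at_right_less eventually_at_right_field intro!: exI[of _ "1/2"])
  ultimately have "eventually (\<lambda>\<eta>. (B \<le> 1 / 2 * exp ((ln (sin \<eta>) - ln (sin (\<eta>\<^sup>2))) / 2 - h)) \<and>
      (sin \<eta>)\<^sup>2 * (cos \<eta> / sin \<eta> + cos (\<eta>\<^sup>2) / sin (\<eta>\<^sup>2)) < 3 \<and> (0 < \<eta> \<and> \<eta> < 1 / 2)) (at_right 0)"
    by eventually_elim auto
  then obtain \<eta> where \<eta>: "B \<le> 1 / 2 * exp ((ln (sin \<eta>) - ln (sin (\<eta>\<^sup>2))) / 2 - h)"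
    "(sin \<eta>)\<^sup>2 * (cos \<eta> / sin \<eta> + cos (\<eta>\<^sup>2) / sin (\<eta>\<^sup>2)) < 3" "0 < \<eta>" "\<eta> < 1 / 2"
    using eventually_happens'[OF trivial_limit_at_right_real] by blast
  have "\<eta>\<^sup>2 < \<eta>" using \<eta> by (simp add: power2_eq_square)
  then show ?thesis
    using \<eta> True by (intro exI[of _ "\<eta>\<^sup>2"] exI[of _ \<eta>]) (auto simp: cot_def)
qed

section \<open>Finiteness below and divergence from the critical horizon on\<close>

locale affine_cubic_sde = brownian_motion M F W
  for M :: "'a measure" and F :: "real \<Rightarrow> 'a measure" and W :: "real \<Rightarrow> 'a \<Rightarrow> real" +
  fixes \<kappa> c \<sigma> y0 :: real and Y :: "real \<Rightarrow> 'a \<Rightarrow> real"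
  assumes \<kappa>: "0 \<le> \<kappa>" and c: "0 < c" and \<sigma>: "0 < \<sigma>"
    and sol: "solves_sde M F W (\<lambda>y. - \<kappa> * y - c * y ^ 3) \<sigma> y0 Y"
begin

definition V :: "real \<Rightarrow> real" where "V y = (\<kappa> * y + c * y ^ 3)\<^sup>2 / (2 * \<sigma>\<^sup>2)"
text \<open>The frequency in \<psi>'' = - \<theta>^2 \<psi>; squaring \<theta> T < \<pi> gives the
  threshold of the theorem.\<close>

definition \<theta> :: real where "\<theta> = sqrt (3 * c) * \<sigma>"
definition N :: "real \<Rightarrow> ennreal" where "N T = (\<integral>\<^sup>+ \<omega>. ennreal (exp (grid_weight V T Y \<omega>)) \<partial>M)"

lemma \<theta>: "0 < \<theta>" "\<theta>\<^sup>2 = 3 * c * \<sigma>\<^sup>2"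
  using c \<sigma> by (auto simp: \<theta>_def power_mult_distrib)

lemma V_cont: "continuous_on UNIV V"
  unfolding V_def using \<sigma> by (intro continuous_intros) auto

lemma V_nonneg: "0 \<le> V y"
  by (simp add: V_def)

lemma Y_measurable: "0 \<le> t \<Longrightarrow> Y t \<in> borel_measurable M"
  using sol by (auto simp: solves_sde_def intro: measurable_F_M)

lemma paths_continuous: "AE \<omega> in M. continuous_on {0..} (\<lambda>t. Y t \<omega>)"
  using sol by (simp add: solves_sde_def)

lemma weight_measurable: "0 < T \<Longrightarrow> grid_weight V T Y \<in> borel_measurable M"
  by (intro grid_weight_measurable Y_measurable borel_measurable_continuous_onI V_cont)

text \<open>The potential is nonnegative. Divergence can thus be read off from horizons strictly
  shorter than \<pi> / \<theta>, where explicit solutions exist, and this is how the case of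
  equality is reached.\<close>

lemma N_mono:
  assumes "0 < S" "S \<le> T"
  shows "N S \<le> N T"
  unfolding N_def
proof (rule nn_integral_mono_AE)
  show "AE \<omega> in M. ennreal (exp (grid_weight V S Y \<omega>)) \<le> ennreal (exp (grid_weight V T Y \<omega>))"
    using paths_continuous
  proof eventually_elim
    case (elim \<omega>)
    have int: "(\<lambda>s. V (Y s \<omega>)) integrable_on {0..r}" for r
      by (intro integrable_continuous_interval continuous_on_compose2[OF V_cont] continuous_on_subset[OF elim]) auto
    have "integral {0..S} (\<lambda>s. V (Y s \<omega>)) \<le> integral {0..T} (\<lambda>s. V (Y s \<omega>))"
      using assms V_nonneg by (intro integral_subset_le int) auto
    then show ?case
      using grid_weight_eq(3)[where Y = Y and \<omega> = \<omega>, OF elim V_cont] assms by simp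
  qed
qed

lemma subsolution:
  assumes "riccati \<kappa> c \<sigma> S a \<alpha> \<beta> d" and "0 \<le> R'" "R' < R" "\<bar>y0\<bar> \<le> R"
    and "\<And>t y. 0 \<le> t \<Longrightarrow> t \<le> S \<Longrightarrow> R' \<le> \<bar>y\<bar> \<Longrightarrow> \<alpha> t + \<beta> t * y\<^sup>2 \<le> - 1"
  shows "integrable M (\<lambda>\<omega>. indicator (confined M Y R S) \<omega> * exp (grid_weight V S Y \<omega>) *
      ((\<alpha> S + \<beta> S * (Y S \<omega>)\<^sup>2) * exp ((\<kappa> * (Y S \<omega>)\<^sup>2 / 2 + c * Y S \<omega> ^ 4 / 4) / \<sigma>\<^sup>2 + a S * (Y S \<omega>)\<^sup>2 + d S)))"
    and "(\<alpha> 0 + \<beta> 0 * y0\<^sup>2) * exp ((\<kappa> * y0\<^sup>2 / 2 + c * y0 ^ 4 / 4) / \<sigma>\<^sup>2 + a 0 * y0\<^sup>2 + d 0)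
      \<le> expectation (\<lambda>\<omega>. indicator (confined M Y R S) \<omega> * exp (grid_weight V S Y \<omega>) *
      ((\<alpha> S + \<beta> S * (Y S \<omega>)\<^sup>2) * exp ((\<kappa> * (Y S \<omega>)\<^sup>2 / 2 + c * Y S \<omega> ^ 4 / 4) / \<sigma>\<^sup>2 + a S * (Y S \<omega>)\<^sup>2 + d S)))"
  unfolding V_def[abs_def] by (intro riccati_subsolution[OF assms(1) sol assms(2-4)] assms(5); assumption)+

lemma N_finite:
  assumes T: "0 < T" and less: "\<theta> * T < pi"
  shows "N T < \<infinity>"
proof -
  \<comment> \<open>This centres the phase at \<pi> / 2: it runs from (\<pi> + \<theta> T) / 2 down
    to (\<pi> - \<theta> T) / 2, inside (0, \<pi>).\<close>
  define \<omega>0 where "\<omega>0 = (pi + \<theta> * T) / 2"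
  define a where "a t = - (\<theta> / (2 * \<sigma>\<^sup>2)) * cot (\<omega>0 - \<theta> * t)" for t
  define d where "d t = - \<kappa> * t / 2 - ln (sin (\<omega>0 - \<theta> * t)) / 2" for t
  \<comment> \<open>With \<alpha> = -1 and \<beta> = 0 the test function is negative everywhere, so
    every box with \<open>R' = 0\<close> is admissible, and after a change of sign the inequality
    bounds an expectation from above.\<close>
  have ric: "riccati \<kappa> c \<sigma> T a (\<lambda>_. - 1) (\<lambda>_. 0) d"
    using riccati_trig[OF \<sigma> T \<theta>, of \<omega>0 \<kappa> "- 1" 0] less
    by (simp add: \<omega>0_def a_def[abs_def] d_def[abs_def] field_simps)
  define e where "e t y = exp ((\<kappa> * y\<^sup>2 / 2 + c * y ^ 4 / 4) / \<sigma>\<^sup>2 + a t * y\<^sup>2 + d t)" for t y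
  define m where "m = exp (d T - (a T)\<^sup>2 * \<sigma>\<^sup>2 / c)"
  have m: "0 < m" by (simp add: m_def)
  have lower: "m \<le> e T y" for y
  proof -
    \<comment> \<open>Completing the square in \<open>y\<^sup>2\<close>: the quartic term beats
      \<open>a T\<close> whatever its sign, with minimum - a(T)^2 \<sigma>^2 / c, which is the
      exponent in \<open>m\<close>.\<close>
    have "0 \<le> c / (4 * \<sigma>\<^sup>2) * (y\<^sup>2 + 2 * a T * \<sigma>\<^sup>2 / c)\<^sup>2" using c by simp
    also have "\<dots> = c * y ^ 4 / 4 / \<sigma>\<^sup>2 + a T * y\<^sup>2 + (a T)\<^sup>2 * \<sigma>\<^sup>2 / c"
      using c \<sigma> by (simp add: field_simps power2_eq_square power4_eq_xxxx)
    finally have "0 \<le> c * y ^ 4 / 4 / \<sigma>\<^sup>2 + a T * y\<^sup>2 + (a T)\<^sup>2 * \<sigma>\<^sup>2 / c" .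
    moreover have "0 \<le> \<kappa> * y\<^sup>2 / 2 / \<sigma>\<^sup>2" using \<kappa> by simp
    ultimately show ?thesis unfolding m_def e_def by (simp add: add_divide_distrib)
  qed
  define f where "f i \<omega> = ennreal (indicator (confined M Y (\<bar>y0\<bar> + 1 + real i) T) \<omega> * exp (grid_weight V T Y \<omega>))" for i \<omega>
  have conf: "confined M Y R T \<in> events" for R
    using sol T by (intro confined_events) (auto simp: solves_sde_def)
  have bound: "(\<integral>\<^sup>+ \<omega>. f i \<omega> \<partial>M) \<le> ennreal (e 0 y0 / m)" for i
  proof -
    let ?R = "\<bar>y0\<bar> + 1 + real i"
    define g where "g \<omega> = indicator (confined M Y ?R T) \<omega> * exp (grid_weight V T Y \<omega>) * e T (Y T \<omega>)" for \<omega>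
    have "integrable M (\<lambda>\<omega>. - g \<omega>)" "- e 0 y0 \<le> expectation (\<lambda>\<omega>. - g \<omega>)"
      using subsolution[OF ric, of 0 ?R] by (simp_all add: g_def e_def)
    then have g: "integrable M g" "expectation g \<le> e 0 y0" by simp_all
    have "(\<integral>\<^sup>+ \<omega>. f i \<omega> \<partial>M) \<le> (\<integral>\<^sup>+ \<omega>. ennreal (g \<omega> / m) \<partial>M)"
      unfolding f_def
    proof (intro nn_integral_mono ennreal_leI)
      fix \<omega>
      have "m * (indicator (confined M Y ?R T) \<omega> * exp (grid_weight V T Y \<omega>)) \<le> g \<omega>"
        unfolding g_def using lower[of "Y T \<omega>"] by (simp add: indicator_def mult.commute)
      then show "indicator (confined M Y ?R T) \<omega> * exp (grid_weight V T Y \<omega>) \<le> g \<omega> / m"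
        using m by (simp add: pos_le_divide_eq mult.commute)
    qed
    also have "\<dots> = ennreal (expectation (\<lambda>\<omega>. g \<omega> / m))"
    proof (rule nn_integral_eq_integral)
      show "integrable M (\<lambda>\<omega>. g \<omega> / m)" using g(1) by simp
      show "AE \<omega> in M. 0 \<le> g \<omega> / m" using m by (simp add: g_def e_def)
    qed
    also have "\<dots> \<le> ennreal (e 0 y0 / m)"
      using g m by (intro ennreal_leI) (simp add: divide_right_mono)
    finally show ?thesis .
  qed
  \<comment> \<open>Fatou's lemma, using that the preceding bound is the same for all boxes: a
    continuous path is bounded on [0, T], so its truncated weights eventually equal the full
    one.\<close>
  have "N T \<le> (\<integral>\<^sup>+ \<omega>. liminf (\<lambda>i. f i \<omega>) \<partial>M)"
    unfolding N_def
  proof (rule nn_integral_mono_AE)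
    show "AE \<omega> in M. ennreal (exp (grid_weight V T Y \<omega>)) \<le> liminf (\<lambda>i. f i \<omega>)"
      using paths_continuous AE_space
    proof eventually_elim
      case (elim \<omega>)
      have "compact ((\<lambda>t. Y t \<omega>) ` {0..T})"
        by (intro compact_continuous_image continuous_on_subset[OF elim(1)]) auto
      then have "bounded ((\<lambda>t. Y t \<omega>) ` {0..T})" by (rule compact_imp_bounded)
      then obtain B where B: "\<forall>x\<in>(\<lambda>t. Y t \<omega>) ` {0..T}. norm x \<le> B" unfolding bounded_iff by blast
      obtain n :: nat where n: "B < n" using reals_Archimedean2 by blast
      have "f i \<omega> = ennreal (exp (grid_weight V T Y \<omega>))" if "n \<le> i" for i
      proof -
        have "real n \<le> real i" using that by simp
        then have "\<forall>s\<in>{0..T}. \<bar>Y s \<omega>\<bar> \<le> \<bar>y0\<bar> + 1 + real i" using B n by force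
        then have "\<omega> \<in> confined M Y (\<bar>y0\<bar> + 1 + real i) T"
          using confined_iff[where Y = Y and \<omega> = \<omega> and M = M, OF elim] T by simp
        then show ?thesis by (simp add: f_def)
      qed
      then have "eventually (\<lambda>i. ennreal (exp (grid_weight V T Y \<omega>)) \<le> f i \<omega>) sequentially"
        by (intro eventually_sequentiallyI[of n]) simp
      then show ?case by (rule Liminf_bounded)
    qed
  qed
  also have "\<dots> \<le> liminf (\<lambda>i. \<integral>\<^sup>+ \<omega>. f i \<omega> \<partial>M)"
    unfolding f_def using conf weight_measurable[OF T] by (intro nn_integral_liminf) simp
  also have "\<dots> \<le> liminf (\<lambda>i::nat. ennreal (e 0 y0 / m))"
    using bound by (intro Liminf_mono) auto
  also have "\<dots> < \<infinity>" by (simp add: Liminf_const)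
  finally show ?thesis .
qed

text \<open>The phase runs from \<pi> - \<mu> at time 0 to \<eta> at time \<open>S\<close>, where
  the polynomial factor is 1 - y^2 / \<rho>. Terminal values are therefore bounded above, while
  small \<mu> makes (sin \<mu>)^(-1/2) and, for y0 \<noteq> 0, the Gaussian exponent at time 0
  large; \<open>P0\<close> keeps the initial polynomial factor at least 1 / 2.\<close>

lemma N_lower_bound:
  assumes pos: "0 < \<mu>" "0 < \<eta>" "\<mu> + \<eta> < 1" and \<rho>: "0 < \<rho>"
  defines "S \<equiv> (pi - \<mu> - \<eta>) / \<theta>"
  assumes P0: "1 / 2 \<le> 1 - \<sigma>\<^sup>2 / (\<theta> * \<rho>) * ((sin \<eta>)\<^sup>2 * (cot \<eta> + cot \<mu>)) - (sin \<eta>)\<^sup>2 / (sin \<mu>)\<^sup>2 * y0\<^sup>2 / \<rho>"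
  shows "ennreal (1 / 2 * exp (\<theta> / (2 * \<sigma>\<^sup>2) * cot \<mu> * y0\<^sup>2 + (ln (sin \<eta>) - ln (sin \<mu>)) / 2
    - (\<kappa> * \<rho> / 2 + c * \<rho>\<^sup>2 / 4) / \<sigma>\<^sup>2)) \<le> N S"
proof -
  note \<theta>0 = \<theta>(1)
  have S: "0 < S" "\<theta> * S = pi - \<mu> - \<eta>" using pos pi_gt3 \<theta>0 by (auto simp: S_def)
  have sin: "0 < sin \<eta>" "0 < sin \<mu>" "0 < cos \<eta>"
    using pos pi_gt3 by (auto intro!: sin_gt_zero cos_gt_zero_pi)
  have cot\<eta>: "0 \<le> cot \<eta>" using sin by (simp add: cot_def)
  \<comment> \<open>\<open>b0\<close>, and below it \<alpha>0, normalise the terminal coefficients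
    to \<beta> S = - 1 / \<rho> and \<alpha> S = 1.\<close>
  define b0 where "b0 = (sin \<eta>)\<^sup>2 / \<rho>"
  have b0: "0 < b0" using sin \<rho> by (simp add: b0_def)
  define \<phi> where "\<phi> t = pi - \<mu> - \<theta> * t" for t
  have \<phi>: "\<phi> 0 = pi - \<mu>" "\<phi> S = \<eta>" using S by (auto simp: \<phi>_def)
  define \<alpha>0 where "\<alpha>0 = 1 - \<sigma>\<^sup>2 * b0 / \<theta> * cot \<eta>"
  define a where "a t = - (\<theta> / (2 * \<sigma>\<^sup>2)) * cot (\<phi> t)" for t
  define d where "d t = - \<kappa> * t / 2 - ln (sin (\<phi> t)) / 2" for t
  define \<alpha> where "\<alpha> t = \<alpha>0 + \<sigma>\<^sup>2 * b0 / \<theta> * cot (\<phi> t)" for t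
  define \<beta> where "\<beta> t = - b0 / (sin (\<phi> t))\<^sup>2" for t
  have ric: "riccati \<kappa> c \<sigma> S a \<alpha> \<beta> d"
    using riccati_trig[OF \<sigma> S(1) \<theta>, of "pi - \<mu>" \<kappa> \<alpha>0 b0] pos S(2)
    unfolding a_def[abs_def] \<alpha>_def[abs_def] \<beta>_def[abs_def] d_def[abs_def] \<phi>_def by simp
  have "continuous_on {0..S} \<alpha>" using ric by (rule riccati.coefficients_continuous)
  then have "compact (\<alpha> ` {0..S})" by (intro compact_continuous_image) auto
  then have "bounded (\<alpha> ` {0..S})" by (rule compact_imp_bounded)
  then obtain A where A: "\<forall>x\<in>\<alpha> ` {0..S}. norm x \<le> A" unfolding bounded_iff by blast
  \<comment> \<open>Since sin^2 \<le> 1, \<beta> t is at most - b0, so beyond \<open>R'\<close> the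
    quadratic term outweighs the bound for \<alpha> by 1.\<close>
  define R' where "R' = sqrt ((\<bar>A\<bar> + 1) / b0)"
  have R': "0 \<le> R'" "R'\<^sup>2 = (\<bar>A\<bar> + 1) / b0" using b0 by (auto simp: R'_def)
  have neg: "\<alpha> t + \<beta> t * y\<^sup>2 \<le> - 1" if t: "0 \<le> t" "t \<le> S" and y: "R' \<le> \<bar>y\<bar>" for t y
  proof -
    have "\<theta> * t \<le> \<theta> * S" "0 \<le> \<theta> * t" using t \<theta>0 by auto
    then have s: "0 < sin (\<phi> t)" using pos S by (intro sin_gt_zero) (auto simp: \<phi>_def)
    then have "(sin (\<phi> t))\<^sup>2 \<le> 1" by (simp add: abs_square_le_1)
    then have "b0 * 1 \<le> b0 / (sin (\<phi> t))\<^sup>2" using b0 s by (simp add: field_simps)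
    then have "\<beta> t * y\<^sup>2 \<le> - b0 * y\<^sup>2" unfolding \<beta>_def by (intro mult_right_mono) auto
    moreover have "R'\<^sup>2 \<le> y\<^sup>2" using R'(1) y by (metis abs_le_square_iff abs_of_nonneg)
    then have "b0 * R'\<^sup>2 \<le> b0 * y\<^sup>2" using b0 by simp
    then have "\<bar>A\<bar> + 1 \<le> b0 * y\<^sup>2" using R'(2) b0 by simp
    moreover have "\<alpha> t \<le> \<bar>A\<bar>" using A t by force
    ultimately show ?thesis by simp
  qed
  define R where "R = max R' \<bar>y0\<bar> + 1"
  have R: "R' < R" "\<bar>y0\<bar> \<le> R" by (auto simp: R_def)
  define U where "U t y = (\<alpha> t + \<beta> t * y\<^sup>2) * exp ((\<kappa> * y\<^sup>2 / 2 + c * y ^ 4 / 4) / \<sigma>\<^sup>2 + a t * y\<^sup>2 + d t)" for t y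
  define g where "g \<omega> = indicator (confined M Y R S) \<omega> * exp (grid_weight V S Y \<omega>) * U S (Y S \<omega>)" for \<omega>
  have g: "integrable M g" "U 0 y0 \<le> expectation g"
    using subsolution[OF ric R'(1) R neg] unfolding g_def[abs_def] U_def by auto
  define H where "H = (\<kappa> * \<rho> / 2 + c * \<rho>\<^sup>2 / 4) / \<sigma>\<^sup>2"
  define C where "C = exp (H - ln (sin \<eta>) / 2)"
  have C: "0 < C" by (simp add: C_def)
  \<comment> \<open>Beyond y^2 = \<rho> the polynomial factor is negative; up to there the quartic
    exponent is at most \<open>H\<close>, and cot \<eta> \<ge> 0 makes the Gaussian exponent
    nonpositive.\<close>
  have US: "U S y \<le> C" for y
  proof -
    have PS: "\<alpha> S + \<beta> S * y\<^sup>2 = 1 - y\<^sup>2 / \<rho>"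
      using sin \<rho> by (simp add: \<alpha>_def \<beta>_def \<phi> \<alpha>0_def b0_def)
    show ?thesis
    proof (cases "y\<^sup>2 \<le> \<rho>")
      case True
      have "y ^ 4 = (y\<^sup>2)\<^sup>2" by simp
      also have "\<dots> \<le> \<rho>\<^sup>2" using True by (intro power_mono) auto
      finally have "(\<kappa> * y\<^sup>2 / 2 + c * y ^ 4 / 4) / \<sigma>\<^sup>2 \<le> H"
        unfolding H_def using True \<kappa> c by (intro divide_right_mono add_mono mult_left_mono) auto
      moreover have "a S * y\<^sup>2 \<le> 0" using cot\<eta> \<theta>0 by (simp add: a_def \<phi> mult_nonpos_nonneg)
      moreover have "d S \<le> - ln (sin \<eta>) / 2" using \<kappa> S by (simp add: d_def \<phi>)
      ultimately have "exp ((\<kappa> * y\<^sup>2 / 2 + c * y ^ 4 / 4) / \<sigma>\<^sup>2 + a S * y\<^sup>2 + d S) \<le> C"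
        unfolding C_def by simp
      moreover have "1 - y\<^sup>2 / \<rho> \<le> 1" "0 \<le> 1 - y\<^sup>2 / \<rho>" using True \<rho> by auto
      ultimately have "(1 - y\<^sup>2 / \<rho>) * exp ((\<kappa> * y\<^sup>2 / 2 + c * y ^ 4 / 4) / \<sigma>\<^sup>2 + a S * y\<^sup>2 + d S) \<le> 1 * C"
        by (intro mult_mono) auto
      then show ?thesis unfolding U_def PS by simp
    next
      case False
      then have "1 - y\<^sup>2 / \<rho> \<le> 0" using \<rho> by simp
      then have "U S y \<le> 0" unfolding U_def PS by (intro mult_nonpos_nonneg) auto
      then show ?thesis using C by simp
    qed
  qed
  have "ennreal (U 0 y0 / C) \<le> ennreal (expectation (\<lambda>\<omega>. g \<omega> / C))"
    using g C by (intro ennreal_leI) (simp add: divide_right_mono)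
  also have "\<dots> \<le> (\<integral>\<^sup>+ \<omega>. ennreal (g \<omega> / C) \<partial>M)"
    using g by (intro ennreal_expectation_le_nn_integral) simp
  also have "\<dots> \<le> N S"
    unfolding N_def
  proof (intro nn_integral_mono ennreal_leI)
    fix \<omega>
    have "exp (grid_weight V S Y \<omega>) * U S (Y S \<omega>) \<le> exp (grid_weight V S Y \<omega>) * C"
      using US by (intro mult_left_mono) auto
    then have "g \<omega> \<le> exp (grid_weight V S Y \<omega>) * C"
      using C by (simp add: g_def indicator_def)
    then show "g \<omega> / C \<le> exp (grid_weight V S Y \<omega>)" using C by (simp add: pos_divide_le_eq)
  qed
  finally have le: "ennreal (U 0 y0 / C) \<le> N S" .
  have cot0: "cot (\<phi> 0) = - cot \<mu>" "sin (\<phi> 0) = sin \<mu>" by (simp_all add: \<phi> cot_def)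
  have "\<alpha> 0 + \<beta> 0 * y0\<^sup>2 = 1 - \<sigma>\<^sup>2 / (\<theta> * \<rho>) * ((sin \<eta>)\<^sup>2 * (cot \<eta> + cot \<mu>)) - (sin \<eta>)\<^sup>2 / (sin \<mu>)\<^sup>2 * y0\<^sup>2 / \<rho>"
    unfolding \<alpha>_def \<beta>_def cot0 \<alpha>0_def b0_def using \<theta>0 \<rho> by (simp add: field_simps)
  then have P0': "1 / 2 \<le> \<alpha> 0 + \<beta> 0 * y0\<^sup>2" using P0 by simp
  have "0 \<le> (\<kappa> * y0\<^sup>2 / 2 + c * y0 ^ 4 / 4) / \<sigma>\<^sup>2" using \<kappa> c by simp
  then have "\<theta> / (2 * \<sigma>\<^sup>2) * cot \<mu> * y0\<^sup>2 + (ln (sin \<eta>) - ln (sin \<mu>)) / 2 - H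
      \<le> (\<kappa> * y0\<^sup>2 / 2 + c * y0 ^ 4 / 4) / \<sigma>\<^sup>2 + a 0 * y0\<^sup>2 + d 0 - (H - ln (sin \<eta>) / 2)"
    unfolding a_def d_def cot0 by (simp add: diff_divide_distrib)
  then have "1 / 2 * exp (\<theta> / (2 * \<sigma>\<^sup>2) * cot \<mu> * y0\<^sup>2 + (ln (sin \<eta>) - ln (sin \<mu>)) / 2 - H)
      \<le> (\<alpha> 0 + \<beta> 0 * y0\<^sup>2) * exp ((\<kappa> * y0\<^sup>2 / 2 + c * y0 ^ 4 / 4) / \<sigma>\<^sup>2 + a 0 * y0\<^sup>2 + d 0 - (H - ln (sin \<eta>) / 2))"
    using P0' by (intro mult_mono) auto
  also have "\<dots> = U 0 y0 / C" unfolding U_def C_def exp_diff by simp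
  finally show ?thesis unfolding H_def[symmetric] using le by (meson ennreal_leI order_trans)
qed

lemma N_infinite:
  assumes T: "0 < T" and ge: "pi \<le> \<theta> * T"
  shows "N T = \<infinity>"
proof (rule ccontr)
  assume "N T \<noteq> \<infinity>"
  then obtain B where B: "0 \<le> B" "N T = ennreal B" by (cases "N T") auto
  \<comment> \<open>\<rho> is fixed before \<mu> and \<eta>, with the 3 taken from
    \<open>blow_up_parameters\<close>: the two losses in the initial polynomial factor then add up
    to at most 1 / 2, and \<open>h\<close> stays constant during the blow-up.\<close>
  define \<rho> where "\<rho> = 2 * (3 * \<sigma>\<^sup>2 / \<theta> + y0\<^sup>2)"
  have "0 < 3 * \<sigma>\<^sup>2 / \<theta>" using \<theta> \<sigma> by simp
  then have \<rho>: "0 < \<rho>" by (simp add: \<rho>_def add_pos_nonneg)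
  define h where "h = (\<kappa> * \<rho> / 2 + c * \<rho>\<^sup>2 / 4) / \<sigma>\<^sup>2"
  have k: "0 < \<theta> / (2 * \<sigma>\<^sup>2)" using \<theta> \<sigma> by simp
  obtain \<mu> \<eta> where \<mu>\<eta>: "0 < \<mu>" "0 < \<eta>" "\<mu> + \<eta> < 1" "(sin \<eta>)\<^sup>2 * (cot \<eta> + cot \<mu>) \<le> 3"
    "y0\<^sup>2 * (sin \<eta>)\<^sup>2 \<le> y0\<^sup>2 * (sin \<mu>)\<^sup>2"
    "B + 1 \<le> 1 / 2 * exp (\<theta> / (2 * \<sigma>\<^sup>2) * cot \<mu> * y0\<^sup>2 + (ln (sin \<eta>) - ln (sin \<mu>)) / 2 - h)"
    using blow_up_parameters[OF k, of y0 "B + 1" h] by blast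
  have "0 < sin \<mu>" using \<mu>\<eta> pi_gt3 by (intro sin_gt_zero) auto
  then have "(sin \<eta>)\<^sup>2 / (sin \<mu>)\<^sup>2 * y0\<^sup>2 \<le> y0\<^sup>2"
    using \<mu>\<eta>(5) by (simp add: pos_divide_le_eq mult.commute)
  then have 1: "(sin \<eta>)\<^sup>2 / (sin \<mu>)\<^sup>2 * y0\<^sup>2 / \<rho> \<le> y0\<^sup>2 / \<rho>" using \<rho> by (intro divide_right_mono) auto
  have "\<sigma>\<^sup>2 / (\<theta> * \<rho>) * ((sin \<eta>)\<^sup>2 * (cot \<eta> + cot \<mu>)) \<le> \<sigma>\<^sup>2 / (\<theta> * \<rho>) * 3"
    using \<mu>\<eta>(4) \<theta> \<rho> by (intro mult_left_mono) auto
  then have 2: "\<sigma>\<^sup>2 / (\<theta> * \<rho>) * ((sin \<eta>)\<^sup>2 * (cot \<eta> + cot \<mu>)) \<le> 3 * \<sigma>\<^sup>2 / \<theta> / \<rho>"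
    by (simp add: mult.commute)
  have "3 * \<sigma>\<^sup>2 / \<theta> + y0\<^sup>2 = \<rho> / 2" by (simp add: \<rho>_def)
  then have "(3 * \<sigma>\<^sup>2 / \<theta> + y0\<^sup>2) / \<rho> = 1 / 2" using \<rho> by simp
  then have "3 * \<sigma>\<^sup>2 / \<theta> / \<rho> + y0\<^sup>2 / \<rho> = 1 / 2" unfolding add_divide_distrib .
  then have "ennreal (1 / 2 * exp (\<theta> / (2 * \<sigma>\<^sup>2) * cot \<mu> * y0\<^sup>2 + (ln (sin \<eta>) - ln (sin \<mu>)) / 2 - h))
      \<le> N ((pi - \<mu> - \<eta>) / \<theta>)"
    unfolding h_def using \<mu>\<eta>(1-3) \<rho> 1 2 by (intro N_lower_bound) linarith+
  also have "\<dots> \<le> N T"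
  proof (rule N_mono)
    show "0 < (pi - \<mu> - \<eta>) / \<theta>" using \<mu>\<eta> \<theta> pi_gt3 by simp
    show "(pi - \<mu> - \<eta>) / \<theta> \<le> T" using \<mu>\<eta> \<theta> ge by (simp add: pos_divide_le_eq mult.commute)
  qed
  finally have "ennreal (B + 1) \<le> ennreal B"
    unfolding B(2) using ennreal_leI[OF \<mu>\<eta>(6)] by (rule order_trans[rotated])
  then show False using B(1) by simp
qed

theorem exponential_moment_finite_iff:
  assumes T: "0 < T"
  shows "(\<integral>\<^sup>+ \<omega>. ennreal (exp (1 / (2 * \<sigma>\<^sup>2) *
      (LBINT s:{0..T}. (\<kappa> * Y s \<omega> + c * Y s \<omega> ^ 3)\<^sup>2))) \<partial>M) < \<infinity> \<longleftrightarrow> c * \<sigma>\<^sup>2 * T\<^sup>2 < pi\<^sup>2 / 3"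
proof -
  have "(\<integral>\<^sup>+ \<omega>. ennreal (exp (1 / (2 * \<sigma>\<^sup>2) *
      (LBINT s:{0..T}. (\<kappa> * Y s \<omega> + c * Y s \<omega> ^ 3)\<^sup>2))) \<partial>M) = N T"
    unfolding N_def
  proof (rule nn_integral_cong_AE)
    show "AE \<omega> in M. ennreal (exp (1 / (2 * \<sigma>\<^sup>2) * (LBINT s:{0..T}. (\<kappa> * Y s \<omega> + c * Y s \<omega> ^ 3)\<^sup>2)))
        = ennreal (exp (grid_weight V T Y \<omega>))"
      using paths_continuous
    proof eventually_elim
      case (elim \<omega>)
      have "grid_weight V T Y \<omega> = (LBINT s:{0..T}. (\<kappa> * Y s \<omega> + c * Y s \<omega> ^ 3)\<^sup>2 / (2 * \<sigma>\<^sup>2))"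
        using grid_weight_eq(2)[where Y = Y and \<omega> = \<omega>, OF elim V_cont T] by (simp add: V_def)
      then show ?case by simp
    qed
  qed
  moreover have "\<theta> * T < pi \<longleftrightarrow> c * \<sigma>\<^sup>2 * T\<^sup>2 < pi\<^sup>2 / 3"
  proof -
    have "\<theta> * T < pi \<longleftrightarrow> (\<theta> * T)\<^sup>2 < pi\<^sup>2"
      using \<theta> T by (auto intro: power2_less_imp_less power_strict_mono)
    then show ?thesis by (simp add: power_mult_distrib \<theta>(2) algebra_simps)
  qed
  ultimately show ?thesis
    using N_finite[OF T] N_infinite[OF T] by (metis not_le less_irrefl)
qed

end

theorem theorem4p1:
  fixes M :: "'a measure" and F :: "real \<Rightarrow> 'a measure" and W :: "real \<Rightarrow> 'a \<Rightarrow> real"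
    and c \<sigma> y0 T :: real
  assumes "brownian_motion M F W"
    and "c > 0" and "\<sigma> > 0" and "T > 0"
  shows "(\<forall>Y. solves_sde M F W (\<lambda>y. - c * y ^ 3) \<sigma> y0 Y \<longrightarrow>
      (let N = (\<integral>\<^sup>+ \<omega>. ennreal (exp (1 / (2 * \<sigma>\<^sup>2) * (LBINT s:{0..T}. c\<^sup>2 * Y s \<omega> ^ 6))) \<partial>M)
       in 1 \<le> N \<and>
          (N < \<infinity> \<longleftrightarrow> c * \<sigma>\<^sup>2 * T\<^sup>2 < pi\<^sup>2 / 3) \<and>
          (c * \<sigma>\<^sup>2 * T\<^sup>2 = pi\<^sup>2 / 3 \<longrightarrow> N = \<infinity>) \<and>
          (c * \<sigma>\<^sup>2 * T\<^sup>2 > pi\<^sup>2 / 3 \<longrightarrow> N = \<infinity>))) \<and>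
    (\<forall>\<kappa>\<ge>0. \<forall>Y. solves_sde M F W (\<lambda>y. - \<kappa> * y - c * y ^ 3) \<sigma> y0 Y \<longrightarrow>
      ((\<integral>\<^sup>+ \<omega>. ennreal (exp (1 / (2 * \<sigma>\<^sup>2) *
          (LBINT s:{0..T}. (\<kappa> * Y s \<omega> + c * Y s \<omega> ^ 3)\<^sup>2))) \<partial>M) < \<infinity>
        \<longleftrightarrow> c * \<sigma>\<^sup>2 * T\<^sup>2 < pi\<^sup>2 / 3))"
proof -
  interpret brownian_motion M F W by fact
  have iff: "(\<integral>\<^sup>+ \<omega>. ennreal (exp (1 / (2 * \<sigma>\<^sup>2) *
        (LBINT s:{0..T}. (\<kappa> * Y s \<omega> + c * Y s \<omega> ^ 3)\<^sup>2))) \<partial>M) < \<infinity> \<longleftrightarrow> c * \<sigma>\<^sup>2 * T\<^sup>2 < pi\<^sup>2 / 3"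
    if "0 \<le> \<kappa>" "solves_sde M F W (\<lambda>y. - \<kappa> * y - c * y ^ 3) \<sigma> y0 Y" for \<kappa> Y
    using that assms
    by (intro affine_cubic_sde.exponential_moment_finite_iff affine_cubic_sde.intro affine_cubic_sde_axioms.intro)
  show ?thesis
  proof (intro conjI allI impI)
    fix Y assume sol: "solves_sde M F W (\<lambda>y. - c * y ^ 3) \<sigma> y0 Y"
    define N where "N = (\<integral>\<^sup>+ \<omega>. ennreal (exp (1 / (2 * \<sigma>\<^sup>2) * (LBINT s:{0..T}. c\<^sup>2 * Y s \<omega> ^ 6))) \<partial>M)"
    have "(0 * Y s \<omega> + c * Y s \<omega> ^ 3)\<^sup>2 = c\<^sup>2 * Y s \<omega> ^ 6" for s \<omega>
      by (simp add: power_mult_distrib)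
    then have N_iff: "N < \<infinity> \<longleftrightarrow> c * \<sigma>\<^sup>2 * T\<^sup>2 < pi\<^sup>2 / 3"
      using iff[of 0 Y] sol by (simp add: N_def)
    \<comment> \<open>This holds for every \<omega>, with or without a continuous path: the integral
      of a nonnegative function is nonnegative and defaults to 0 if it does not exist.\<close>
    have "0 \<le> 1 / (2 * \<sigma>\<^sup>2) * (LBINT s:{0..T}. c\<^sup>2 * Y s \<omega> ^ 6)" for \<omega>
      by (auto intro!: mult_nonneg_nonneg integral_nonneg_AE simp: set_lebesgue_integral_def)
    then have "(\<integral>\<^sup>+ \<omega>. 1 \<partial>M) \<le> N"
      unfolding N_def by (intro nn_integral_mono) (simp only: ennreal_1[symmetric] ennreal_le_iff one_le_exp_iff exp_ge_zero)
    then have "1 \<le> N" by (simp add: emeasure_space_1)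
    then show "let N = (\<integral>\<^sup>+ \<omega>. ennreal (exp (1 / (2 * \<sigma>\<^sup>2) * (LBINT s:{0..T}. c\<^sup>2 * Y s \<omega> ^ 6))) \<partial>M)
       in 1 \<le> N \<and>
          (N < \<infinity> \<longleftrightarrow> c * \<sigma>\<^sup>2 * T\<^sup>2 < pi\<^sup>2 / 3) \<and>
          (c * \<sigma>\<^sup>2 * T\<^sup>2 = pi\<^sup>2 / 3 \<longrightarrow> N = \<infinity>) \<and>
          (c * \<sigma>\<^sup>2 * T\<^sup>2 > pi\<^sup>2 / 3 \<longrightarrow> N = \<infinity>)"
      unfolding N_def[symmetric] Let_def using N_iff by (auto simp: less_top[symmetric])
  qed (rule iff)
qed

end
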